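(* Let $(\lambda_m)$ be a sequence of positive numbers. The following limits hold for each of the three errors $D_m\in\{E_m(\lambda_m),\ \|R_m(\lambda_m)\|_\infty,\ \|R_m(\lambda_m)\|_{2,C}\}$. (i) If $\lambda_m\sim cm^\gamma$ as $m\to\infty$ with $c>0$ and $0\le\gamma<1$, then $$\lim_{m\to\infty}\frac{\log D_m}{m^{(2+\gamma)/3}}=-\frac32c^{1/3}.$$ In particular, for fixed $\lambda_m=\lambda>0$, the common logarithmic scale is $-\frac32(\lambda m^2)^{1/3}$. (ii) If $\lambda_m/m\to\alpha\in(0,\alpha_c)$, where $\alpha_c=\frac{3\sqrt3}2$, then $$\lim_{m\to\infty}D_m^{1/m}=H_e(\alpha).$$ If $\lambda_m=\alpha m$ exactly, with $\alpha\in(0,\alpha_c)$, then (for all sufficiently large $m$) all three errors are bounded above and below by positive constants times $m^{-1/2}H_e(\alpha)^m$.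
   Context: For $\lambda>0$, $F_\lambda(x)=\exp\!\left(-\lambda\frac{1-x}{1+x}\right)$ for $-1<x\le 1$ and $F_\lambda(-1)=0$. Its Chebyshev coefficients are $a_k(\lambda)=\frac2\pi\int_{-1}^1\frac{F_\lambda(x)T_k(x)}{\sqrt{1-x^2}}\,dx$, $k\ge0$ ($T_k$ the Chebyshev polynomials of the first kind). The projection remainder is $R_m(\lambda)=F_\lambda-\frac{a_0(\lambda)}2-\sum_{k=1}^ma_k(\lambda)T_k$. Norms: $\|g\|_\infty=\sup_{[-1,1]}|g|$, $\|g\|_{2,C}^2=\int_{-1}^1\frac{|g(x)|^2}{\sqrt{1-x^2}}\,dx$. With $\mathbb P_m$ the polynomials of degree at most $m$, $E_m(\lambda)=\inf_{p\in\mathbb P_m}\|F_\lambda-p\|_\infty$. For $0<\alpha<\alpha_c$, $\zeta_\alpha$ is the unique root of $\alpha(\zeta^3-\zeta)+1=0$ in the open first quadrant, and $H_e(\alpha)=\left|\frac{\zeta_\alpha-1}{\zeta_\alpha+1}\right|\exp\bigl(\alpha\operatorname{Re}(\zeta_\alpha^2)\bigr)$. The notation $f_m\sim g_m$ means $f_m/g_m\to1$. *)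

theory Defs
  imports
    "HOL-Analysis.Analysis"
    "HOL-Computational_Algebra.Polynomial"
    "HOL-Library.Landau_Symbols"
begin

fun cheb_T :: "nat \<Rightarrow> real poly" where
  "cheb_T 0 = 1"
| "cheb_T (Suc 0) = [:0, 1:]"
| "cheb_T (Suc (Suc n)) = [:0, 2:] * cheb_T (Suc n) - cheb_T n"

text \<open>Only the values on \<open>[-1, 1]\<close> are ever used.\<close>

definition F :: "real \<Rightarrow> real \<Rightarrow> real" where
  "F l x = (if x = -1 then 0 else exp (- l * ((1 - x) / (1 + x))))"

text \<open>In the two weighted integrals below, division by zero makes the integrand \<open>0\<close> at the
  endpoints \<open>x = -1\<close> and \<open>x = 1\<close>, a null set.\<close>

definition cheb_coeff :: "real \<Rightarrow> nat \<Rightarrow> real" where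
  "cheb_coeff l k =
     2 / pi * (LINT x:{-1..1}|lborel. F l x * poly (cheb_T k) x / sqrt (1 - x\<^sup>2))"

definition cheb_remainder :: "nat \<Rightarrow> real \<Rightarrow> real \<Rightarrow> real" where
  "cheb_remainder m l x =
     F l x - cheb_coeff l 0 / 2 - (\<Sum>k=1..m. cheb_coeff l k * poly (cheb_T k) x)"

definition sup_norm :: "(real \<Rightarrow> real) \<Rightarrow> real" where
  "sup_norm g = (SUP x\<in>{-1..1}. \<bar>g x\<bar>)"

definition cheb_norm :: "(real \<Rightarrow> real) \<Rightarrow> real" where
  "cheb_norm g = sqrt (LINT x:{-1..1}|lborel. \<bar>g x\<bar>\<^sup>2 / sqrt (1 - x\<^sup>2))"

definition best_error :: "nat \<Rightarrow> real \<Rightarrow> real" where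
  "best_error m l = (INF p\<in>{p :: real poly. degree p \<le> m}. sup_norm (\<lambda>x. F l x - poly p x))"

definition sup_error :: "nat \<Rightarrow> real \<Rightarrow> real" where
  "sup_error m l = sup_norm (cheb_remainder m l)"

definition l2_error :: "nat \<Rightarrow> real \<Rightarrow> real" where
  "l2_error m l = cheb_norm (cheb_remainder m l)"

definition alpha_c :: real where
  "alpha_c = 3 * sqrt 3 / 2"

text \<open>The description is proper for \<open>0 < a < alpha_c\<close>: the cubic then has one real root, which is
  negative, and two non-real conjugate roots, whose real part is positive since the roots sum to
  \<open>0\<close>.\<close>

definition zeta :: "real \<Rightarrow> complex" where
  "zeta a = (THE z. Re z > 0 \<and> Im z > 0 \<and> of_real a * (z ^ 3 - z) + 1 = 0)"

definition H_e :: "real \<Rightarrow> real" where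
  "H_e a = cmod ((zeta a - 1) / (zeta a + 1)) * exp (a * Re ((zeta a)\<^sup>2))"

end

theory Submission
  imports
    Defs
    "HOL-Probability.Distributions"
    "HOL-Complex_Analysis.Cauchy_Integral_Theorem"
    "HOL-Real_Asymp.Real_Asymp"
begin

text \<open>
  In the variable \<open>y = tan (t / 2)\<close> the function \<open>F l (cos t)\<close> becomes the Gaussian \<open>exp (- l y\<^sup>2)\<close>,
  and \<open>exp (- \<i> t)\<close> becomes \<open>(1 - z) / (1 + z)\<close> with \<open>z = \<i> y\<close>. So the Chebyshev coefficient with index
  \<open>n + 1\<close> is, up to the factor \<open>4 / \<pi>\<close>, the real part of the integral of
  \<open>exp (l z\<^sup>2) ((1 - z) / (1 + z)) ^ n / (1 + z)\<^sup>2\<close> over \<open>y \<ge> 0\<close>, and the line of integration may be moved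
  to any vertical line \<open>z = x + \<i> y\<close> with \<open>x \<ge> 0\<close> (\<open>cheb_coeff_vline\<close>). The critical points of the
  exponent for \<open>n = m\<close> satisfy the cubic equation that
  defines \<open>zeta\<close>. On the vertical line through the critical point the modulus of the integrand is at most
  its value at that point, which is the \<open>m\<close>-th power of \<open>H_e\<close>, times a Gaussian in \<open>y\<close> (\<open>norm_phase_le\<close>).
  This bound holds uniformly in all parameters.

  Upper bounds. Every error is at most a constant times the sum of the moduli of the coefficients
  beyond \<open>m\<close>. Summing the geometric series under the integral costs only a factor \<open>1 / (2 x)\<close>, so the
  Gaussian bound controls all of them (\<open>sup_error_le_tail_bound\<close>).

  Lower bounds. Every error is at least half the modulus of each single coefficient beyond \<open>m\<close>. The
  coefficients oscillate, and a single one may be small. By Laplace's method the coefficient \<open>m + 1\<close>, and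
  a suitable real combination of the coefficients \<open>m + 1\<close> and \<open>m + 2\<close>, are asymptotically the real parts of
  the same complex amplitude times constants that differ by the factor \<open>\<i>\<close>. They cannot both be small
  (\<open>cheb_coeff_lower_bound\<close>). The limit is proved in coordinates in which the saddle may stay bounded or
  escape to infinity, so that both regimes of the theorem are covered.

  It remains to read off the size of the bounds. The real part \<open>x\<close> of the saddle is the solution of
  \<open>8 x\<^sup>3 - 2 x = m / l\<close>, and the logarithm of \<open>H_e\<close> is an elementary function \<open>log_rate x\<close>. If \<open>l / m\<close> converges to
  \<open>\<alpha>\<close>, then \<open>x\<close> converges. If \<open>l / m\<close> tends to \<open>0\<close>, then \<open>x\<close> tends to infinity and \<open>log_rate x\<close> behaves
  like \<open>- 3 / (4 x)\<close>, which gives \<open>- (3 / 2) (l m\<^sup>2) powr (1 / 3)\<close> for the logarithm of the errors.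
\<close>

section \<open>Chebyshev polynomials and cosines\<close>

lemma poly_cheb_T_cos: "poly (cheb_T n) (cos t) = cos (real n * t)"
proof (induction n rule: cheb_T.induct)
  case (3 n)
  have "cos (real (Suc (Suc n)) * t) = cos (real (Suc n) * t + t)"
    and "cos (real n * t) = cos (real (Suc n) * t - t)"
    by (simp_all add: algebra_simps)
  then show ?case
    using 3 by (simp only: cos_add cos_diff) (simp add: algebra_simps)
qed auto

lemma degree_cheb_T_le: "degree (cheb_T n) \<le> n"
proof (induction n rule: cheb_T.induct)
  case (3 n)
  have "degree ([:0, 2:] * cheb_T (Suc n)) \<le> Suc (Suc n)"
    using degree_mult_le[of "[:0, 2:]" "cheb_T (Suc n)"] 3 by simp
  then show ?case
    using 3 by (auto intro!: degree_diff_le)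
qed auto

lemma abs_poly_cheb_T_le_1:
  assumes "x \<in> {-1..1}"
  shows "\<bar>poly (cheb_T n) x\<bar> \<le> 1"
proof -
  have "x = cos (arccos x)"
    using assms by (simp add: cos_arccos)
  then show ?thesis
    by (metis poly_cheb_T_cos abs_cos_le_one)
qed

text \<open>The substitution \<open>x = cos t\<close> absorbs the Chebyshev weight.\<close>

lemma cheb_weight_integral:
  fixes g :: "real \<Rightarrow> real"
  assumes g: "continuous_on {-1..1} g"
  shows "(LINT x:{-1..1}|lborel. g x / sqrt (1 - x\<^sup>2)) = integral {0..pi} (\<lambda>t. g (cos t))"
proof -
  define f where "f = (\<lambda>x. g x / sqrt (1 - x\<^sup>2))"
  let ?S = "{0<..<pi}"
  have img: "cos ` ?S = {-1<..<1}"
  proof (intro equalityI subsetI)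
    fix x :: real
    assume "x \<in> {-1<..<1}"
    then have "arccos x \<in> ?S" "x = cos (arccos x)"
      using arccos_lt_bounded[of x] by (auto simp: cos_arccos)
    then show "x \<in> cos ` ?S"
      by blast
  next
    fix x :: real
    assume "x \<in> cos ` ?S"
    then obtain t where t: "0 < t" "t < pi" "x = cos t"
      by auto
    then show "x \<in> {-1<..<1}"
      using cos_monotone_0_pi[of 0 t] cos_monotone_0_pi[of t pi] by auto
  qed
  have eq: "\<bar>- sin t\<bar> * f (cos t) = g (cos t)" if "t \<in> ?S" for t
  proof -
    have "sin t > 0"
      using that by (simp add: sin_gt_zero)
    moreover have "1 - (cos t)\<^sup>2 = (sin t)\<^sup>2"
      by (simp add: sin_squared_eq)
    ultimately show ?thesis
      by (simp add: f_def)
  qed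
  have cont: "continuous_on {0..pi} (\<lambda>t. g (cos t))"
    by (rule continuous_on_compose2[OF g]) (auto intro!: continuous_intros)
  have "(\<lambda>t. g (cos t)) absolutely_integrable_on {0..pi}"
    using cont by (rule absolutely_integrable_continuous_real)
  then have "(\<lambda>t. g (cos t)) absolutely_integrable_on ?S"
    by (rule set_integrable_subset) auto
  then have ai: "(\<lambda>t. \<bar>- sin t\<bar> * f (cos t)) absolutely_integrable_on ?S"
    using eq by (subst set_integrable_cong[OF refl refl, of _ _ "\<lambda>t. g (cos t)"]) auto
  have "f absolutely_integrable_on (cos ` ?S) \<and>
      integral (cos ` ?S) f = integral ?S (\<lambda>t. \<bar>- sin t\<bar> * f (cos t))"
  proof -
    have "inj_on cos ?S"
      by (rule inj_onI, rule cos_inj_pi) auto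
    moreover have "(cos has_field_derivative - sin t) (at t within ?S)" if "t \<in> ?S" for t :: real
      by (rule has_field_derivative_at_within[OF DERIV_cos])
    ultimately have "(\<lambda>t. \<bar>- sin t\<bar> * f (cos t)) absolutely_integrable_on ?S \<and>
        integral ?S (\<lambda>t. \<bar>- sin t\<bar> * f (cos t)) = b \<longleftrightarrow>
        f absolutely_integrable_on (cos ` ?S) \<and> integral (cos ` ?S) f = b" for b
      by (intro has_absolute_integral_change_of_variables_1') simp_all
    then show ?thesis
      using ai by blast
  qed
  then have fa: "f absolutely_integrable_on {-1<..<1}"
    and fi: "integral {-1<..<1} f = integral ?S (\<lambda>t. \<bar>- sin t\<bar> * f (cos t))"
    by (simp_all add: img)
  have "integral ?S (\<lambda>t. \<bar>- sin t\<bar> * f (cos t)) = integral ?S (\<lambda>t. g (cos t))"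
    using eq by (intro integral_cong) auto
  also have "\<dots> = integral {0..pi} (\<lambda>t. g (cos t))"
    by (simp add: integral_open_interval_real)
  finally have rhs: "integral {-1<..<1} f = integral {0..pi} (\<lambda>t. g (cos t))"
    using fi by simp
  have "(\<lambda>x. indicator {-1..1} x *\<^sub>R g x) \<in> borel_measurable borel"
    using g by (intro borel_measurable_continuous_on_indicator) auto
  then have "(\<lambda>x. indicator {-1..1} x *\<^sub>R g x / sqrt (1 - x\<^sup>2)) \<in> borel_measurable borel"
    by measurable
  then have meas: "(\<lambda>x. indicator {-1..1} x *\<^sub>R f x) \<in> borel_measurable lborel"
    by (simp add: f_def)
  have fa': "f absolutely_integrable_on {-1..1}"
    using fa by (rule absolutely_integrable_spike_set)
      (auto intro: negligible_subset[of "{-1, 1}"])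
  have "(LINT x:{-1..1}|lborel. f x) = (LINT x:{-1..1}|lebesgue. f x)"
    unfolding set_lebesgue_integral_def using meas by (simp add: integral_completion)
  also have "\<dots> = integral {-1..1} f"
    using fa' by (rule set_lebesgue_integral_eq_integral)
  also have "\<dots> = integral {-1<..<1} f"
    by (simp add: integral_open_interval_real)
  finally show ?thesis
    using rhs by (simp add: f_def)
qed

lemma integral_cos_multiple:
  assumes "k > 0"
  shows "integral {0..pi} (\<lambda>t. cos (real k * t)) = 0"
proof -
  have "((\<lambda>t. cos (real k * t)) has_integral sin (real k * pi) / real k - sin (real k * 0) / real k) {0..pi}"
    using assms
    by (intro fundamental_theorem_of_calculus)
      (auto intro!: derivative_eq_intros simp flip: has_real_derivative_iff_has_vector_derivative)
  then show ?thesis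
    by (simp add: integral_unique)
qed

lemma integral_cos_multiple_square:
  assumes "k > 0"
  shows "integral {0..pi} (\<lambda>t. (cos (real k * t))\<^sup>2) = pi / 2"
proof -
  have "(cos (real k * t))\<^sup>2 = 1 / 2 + 1 / 2 * cos (real (2 * k) * t)" for t
    using cos_double_cos[of "real k * t"] by (simp add: algebra_simps)
  moreover have "integral {0..pi} (\<lambda>t. 1 / 2 + 1 / 2 * cos (real (2 * k) * t)) =
      integral {0..pi} (\<lambda>t. 1 / 2) + integral {0..pi} (\<lambda>t. 1 / 2 * cos (real (2 * k) * t))"
    by (intro integral_add integrable_continuous_interval continuous_intros)
  ultimately show ?thesis
    using integral_cos_multiple[of "2 * k"] assms by simp
qed

lemma cos_times_cos_multiple:
  "cos t * cos (real (Suc k) * t) = (cos (real (Suc (Suc k)) * t) + cos (real k * t)) / 2"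
proof -
  have "cos (real (Suc (Suc k)) * t) = cos (real (Suc k) * t + t)"
    and "cos (real k * t) = cos (real (Suc k) * t - t)"
    by (simp_all add: algebra_simps)
  then show ?thesis
    by (simp only: cos_add cos_diff) simp
qed

lemma integral_poly_cos:
  fixes g :: "real \<Rightarrow> real"
  assumes g: "continuous_on {0..pi} g"
    and zero: "\<And>n. n \<le> degree p \<Longrightarrow> integral {0..pi} (\<lambda>t. g t * cos t ^ n) = 0"
  shows "integral {0..pi} (\<lambda>t. g t * poly p (cos t)) = 0"
proof -
  have "integral {0..pi} (\<lambda>t. g t * poly p (cos t)) =
      integral {0..pi} (\<lambda>t. \<Sum>n\<le>degree p. coeff p n * (g t * cos t ^ n))"
    by (simp add: poly_altdef sum_distrib_left mult_ac)
  also have "\<dots> = (\<Sum>n\<le>degree p. integral {0..pi} (\<lambda>t. coeff p n * (g t * cos t ^ n)))"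
    using g by (intro integral_sum integrable_continuous_interval continuous_intros) auto
  finally show ?thesis
    by (simp add: zero)
qed

text \<open>Multiplying by \<open>cos t\<close> moves the frequency by one, so \<open>n\<close> factors cannot bring a
  frequency above \<open>n\<close> down to \<open>0\<close>.\<close>

lemma cos_multiple_orthogonal_poly:
  assumes "degree p < k"
  shows "integral {0..pi} (\<lambda>t. cos (real k * t) * poly p (cos t)) = 0"
proof -
  have "integral {0..pi} (\<lambda>t. cos (real k * t) * cos t ^ n) = 0" if "n < k" for n k
    using that
  proof (induction n arbitrary: k)
    case 0
    then show ?case
      by (simp add: integral_cos_multiple)
  next
    case (Suc n)
    then obtain j where k: "k = Suc j" "n < j"
      by (cases k) auto
    have "cos (real k * t) * cos t ^ Suc n =
        1 / 2 * (cos (real (Suc k) * t) * cos t ^ n) + 1 / 2 * (cos (real j * t) * cos t ^ n)" for t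
    proof -
      have "cos (real k * t) * cos t ^ Suc n = (cos t * cos (real (Suc j) * t)) * cos t ^ n"
        by (simp add: k)
      then show ?thesis
        unfolding cos_times_cos_multiple by (simp add: k field_simps)
    qed
    moreover have "integral {0..pi} (\<lambda>t. 1 / 2 * (cos (real (Suc k) * t) * cos t ^ n) +
          1 / 2 * (cos (real j * t) * cos t ^ n)) =
        integral {0..pi} (\<lambda>t. 1 / 2 * (cos (real (Suc k) * t) * cos t ^ n)) +
        integral {0..pi} (\<lambda>t. 1 / 2 * (cos (real j * t) * cos t ^ n))"
      by (intro integral_add integrable_continuous_interval continuous_intros)
    ultimately show ?case
      using Suc.IH[of "Suc k"] Suc.IH[of j] k by simp
  qed
  then show ?thesis
    using assms by (intro integral_poly_cos continuous_intros) auto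
qed

text \<open>The cosine system is complete: such a \<open>g\<close> is orthogonal to all polynomials in \<open>cos t\<close>,
  among them arbitrarily good uniform approximations of itself.\<close>

lemma continuous_zero_if_cos_coeffs_zero:
  fixes g :: "real \<Rightarrow> real"
  assumes g: "continuous_on {-1..1} g"
    and zero: "\<And>k. integral {0..pi} (\<lambda>t. g (cos t) * cos (real k * t)) = 0"
    and x: "x \<in> {-1..1}"
  shows "g x = 0"
proof -
  have cont: "continuous_on {0..pi} (\<lambda>t. g (cos t))"
    by (rule continuous_on_compose2[OF g]) (auto intro!: continuous_intros)
  note ints = integrable_continuous_interval continuous_intros cont
  have mono: "integral {0..pi} (\<lambda>t. g (cos t) * cos (real k * t) * cos t ^ n) = 0" for n k
  proof (induction n arbitrary: k)
    case 0
    then show ?case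
      by (simp add: zero)
  next
    case (Suc n)
    show ?case
    proof (cases k)
      case 0
      then show ?thesis
        using Suc.IH[of 1] by (simp add: mult_ac)
    next
      case k: (Suc j)
      have "g (cos t) * cos (real k * t) * cos t ^ Suc n =
          1 / 2 * (g (cos t) * cos (real (Suc k) * t) * cos t ^ n) +
          1 / 2 * (g (cos t) * cos (real j * t) * cos t ^ n)" for t
      proof -
        have "g (cos t) * cos (real k * t) * cos t ^ Suc n =
            g (cos t) * (cos t * cos (real (Suc j) * t)) * cos t ^ n"
          by (simp add: k)
        then show ?thesis
          unfolding cos_times_cos_multiple by (simp add: k field_simps)
      qed
      moreover have "integral {0..pi} (\<lambda>t. 1 / 2 * (g (cos t) * cos (real (Suc k) * t) * cos t ^ n) +
            1 / 2 * (g (cos t) * cos (real j * t) * cos t ^ n)) =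
          integral {0..pi} (\<lambda>t. 1 / 2 * (g (cos t) * cos (real (Suc k) * t) * cos t ^ n)) +
          integral {0..pi} (\<lambda>t. 1 / 2 * (g (cos t) * cos (real j * t) * cos t ^ n))"
        by (intro integral_add ints) auto
      ultimately show ?thesis
        using Suc.IH[of "Suc k"] Suc.IH[of j] by simp
    qed
  qed
  have poly0: "integral {0..pi} (\<lambda>t. g (cos t) * poly p (cos t)) = 0" for p
    using mono[where k = 0] cont by (intro integral_poly_cos) auto
  have "compact ((\<lambda>t. g (cos t)) ` {0..pi})"
    using cont by (intro compact_continuous_image) auto
  then have "bounded ((\<lambda>t. g (cos t)) ` {0..pi})"
    by (rule compact_imp_bounded)
  then obtain C where C: "C > 0" "\<And>t. t \<in> {0..pi} \<Longrightarrow> \<bar>g (cos t)\<bar> \<le> C"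
    unfolding bounded_pos by auto
  have "integral {0..pi} (\<lambda>t. (g (cos t))\<^sup>2) \<le> 0 + e" if "e > 0" for e
  proof -
    define d where "d = e / (pi * C)"
    have "d > 0"
      using that C by (simp add: d_def)
    then obtain q where q: "real_polynomial_function q"
      and qd: "\<And>x. x \<in> {-1..1} \<Longrightarrow> \<bar>g x - q x\<bar> < d"
      using Stone_Weierstrass_real_polynomial_function[OF compact_Icc g] by blast
    obtain a n where "q = (\<lambda>x. \<Sum>i\<le>n. a i * x ^ i)"
      using q unfolding real_polynomial_function_iff_sum by blast
    then have qp: "q x = poly (\<Sum>i\<le>n. monom (a i) i) x" for x
      by (simp add: poly_sum poly_monom)
    define p where "p = (\<Sum>i\<le>n. monom (a i) i)"
    have "integral {0..pi} (\<lambda>t. (g (cos t))\<^sup>2) =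
        integral {0..pi} (\<lambda>t. (g (cos t))\<^sup>2) - integral {0..pi} (\<lambda>t. g (cos t) * poly p (cos t))"
      by (simp add: poly0)
    also have "\<dots> = integral {0..pi} (\<lambda>t. (g (cos t))\<^sup>2 - g (cos t) * poly p (cos t))"
      by (intro integral_diff[symmetric] ints)
    also have "\<dots> \<le> integral {0..pi} (\<lambda>t. C * d)"
    proof (intro integral_le ints)
      fix t :: real
      assume t: "t \<in> {0..pi}"
      have "(g (cos t))\<^sup>2 - g (cos t) * poly p (cos t) = g (cos t) * (g (cos t) - poly p (cos t))"
        by (simp add: power2_eq_square algebra_simps)
      also have "\<dots> \<le> \<bar>g (cos t)\<bar> * \<bar>g (cos t) - poly p (cos t)\<bar>"
        by (metis abs_ge_self abs_mult)
      also have "\<dots> \<le> C * d"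
        using C(2)[OF t] qd[of "cos t"] C(1) by (intro mult_mono) (auto simp: qp p_def)
      finally show "(g (cos t))\<^sup>2 - g (cos t) * poly p (cos t) \<le> C * d" .
    qed
    also have "\<dots> = e"
      using C(1) by (simp add: d_def)
    finally show ?thesis
      by simp
  qed
  then have "integral {0..pi} (\<lambda>t. (g (cos t))\<^sup>2) \<le> 0"
    by (rule field_le_epsilon)
  moreover have "integral {0..pi} (\<lambda>t. (g (cos t))\<^sup>2) \<ge> 0"
    by (intro integral_nonneg ints) auto
  ultimately have int0: "integral {0..pi} (\<lambda>t. (g (cos t))\<^sup>2) = 0"
    by (rule antisym)
  have "(\<lambda>t. (g (cos t))\<^sup>2) integrable_on {0..pi}"
    by (intro ints)
  then have "((\<lambda>t. (g (cos t))\<^sup>2) has_integral 0) (cbox 0 pi)"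
    using integrable_integral int0 by fastforce
  then have "(g (cos (arccos x)))\<^sup>2 = 0"
    using x cont
    by (intro has_integral_0_cbox_imp_0[of 0 pi "\<lambda>t. (g (cos t))\<^sup>2"])
      (auto intro!: continuous_intros arccos_lbound arccos_ubound simp: pi_gt_zero not_le)
  then show ?thesis
    using x by (simp add: cos_arccos)
qed

section \<open>Comparison of the errors with the coefficients\<close>

lemma F_cos:
  assumes "0 \<le> t" "t < pi"
  shows "F l (cos t) = exp (- l * (tan (t / 2))\<^sup>2)"
proof -
  have c: "cos (t / 2) > 0"
    using assms by (intro cos_gt_zero_pi) auto
  have 1: "1 + cos t = 2 * (cos (t / 2))\<^sup>2" "1 - cos t = 2 * (sin (t / 2))\<^sup>2"
    using cos_double_cos[of "t / 2"] cos_double_sin[of "t / 2"] by simp_all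
  then have "cos t \<noteq> - 1"
    using c by (metis add.right_inverse mult_eq_0_iff power_not_zero zero_neq_numeral less_irrefl)
  then show ?thesis
    using c by (simp add: F_def 1 tan_def power_divide)
qed

lemma continuous_on_F:
  assumes "l > 0"
  shows "continuous_on {-1..1} (F l)"
  unfolding continuous_on_eq_continuous_within
proof
  fix x :: real
  assume x: "x \<in> {-1..1}"
  show "continuous (at x within {-1..1}) (F l)"
  proof (cases "x = -1")
    case True
    have "((\<lambda>x. exp (- l * ((1 - x) / (1 + x)))) \<longlongrightarrow> 0) (at_right (-1))"
      using assms by real_asymp
    moreover have "\<forall>\<^sub>F x in at_right (-1). exp (- l * ((1 - x) / (1 + x))) = F l x"
      using eventually_at_right_less by (rule eventually_mono) (auto simp: F_def)
    ultimately have "(F l \<longlongrightarrow> 0) (at_right (-1))"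
      by (rule Lim_transform_eventually)
    then show ?thesis
      using True by (simp add: continuous_within at_within_Icc_at_right F_def)
  next
    case False
    then have "isCont (\<lambda>x. exp (- l * ((1 - x) / (1 + x)))) x"
      by (intro continuous_intros) auto
    moreover have eq: "\<forall>\<^sub>F y in nhds x. exp (- l * ((1 - y) / (1 + y))) = F l y"
      using t1_space_nhds[OF False] by (rule eventually_mono) (auto simp: F_def)
    ultimately have "isCont (F l) x"
      using isCont_cong[OF eq] by simp
    then show ?thesis
      by (rule continuous_at_imp_continuous_within)
  qed
qed

lemma cheb_coeff_cos:
  assumes "l > 0"
  shows "cheb_coeff l k = 2 / pi * integral {0..pi} (\<lambda>t. F l (cos t) * cos (real k * t))"
  unfolding cheb_coeff_def using assms
  by (subst cheb_weight_integral) (auto intro!: continuous_intros continuous_on_F simp: poly_cheb_T_cos)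

lemma continuous_on_cheb_remainder:
  "l > 0 \<Longrightarrow> continuous_on {-1..1} (cheb_remainder m l)"
  unfolding cheb_remainder_def by (intro continuous_intros continuous_on_F)

lemma continuous_on_comp_cos:
  fixes g :: "real \<Rightarrow> real"
  assumes "continuous_on {-1..1} g"
  shows "continuous_on A (\<lambda>t. g (cos t))"
  by (rule continuous_on_compose2[OF assms]) (auto intro!: continuous_intros)

lemma abs_le_sup_norm:
  assumes "continuous_on {-1..1} g" "x \<in> {-1..1}"
  shows "\<bar>g x\<bar> \<le> sup_norm g"
proof -
  have "bounded ((\<lambda>x. \<bar>g x\<bar>) ` {-1..1})"
    using assms by (intro compact_imp_bounded compact_continuous_image continuous_intros) auto
  then show ?thesis
    unfolding sup_norm_def using assms by (intro cSUP_upper bounded_imp_bdd_above)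
qed

lemma sup_norm_le:
  "(\<And>x. x \<in> {-1..1} \<Longrightarrow> \<bar>g x\<bar> \<le> C) \<Longrightarrow> sup_norm g \<le> C"
  unfolding sup_norm_def by (intro cSUP_least) auto

text \<open>By orthogonality a coefficient beyond the degree of \<open>p\<close> sees only the error \<open>F l - p\<close>. This is how
  single coefficients bound the errors of all approximations from below.\<close>

lemma cheb_coeff_minus_poly:
  assumes l: "l > 0" and "degree p < k"
  shows "cheb_coeff l k =
    2 / pi * integral {0..pi} (\<lambda>t. (F l (cos t) - poly p (cos t)) * cos (real k * t))"
proof -
  have "integral {0..pi} (\<lambda>t. (F l (cos t) - poly p (cos t)) * cos (real k * t)) =
      integral {0..pi} (\<lambda>t. F l (cos t) * cos (real k * t)) -
      integral {0..pi} (\<lambda>t. cos (real k * t) * poly p (cos t))"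
    unfolding left_diff_distrib mult.commute[of "poly p _"]
    using l by (intro integral_diff integrable_continuous_interval continuous_intros
        continuous_on_comp_cos continuous_on_F)
  then show ?thesis
    using assms by (simp add: cheb_coeff_cos cos_multiple_orthogonal_poly)
qed

definition cheb_partial_sum :: "nat \<Rightarrow> real \<Rightarrow> real poly" where
  "cheb_partial_sum m l = [:cheb_coeff l 0 / 2:] + (\<Sum>k=1..m. smult (cheb_coeff l k) (cheb_T k))"

lemma degree_cheb_partial_sum: "degree (cheb_partial_sum m l) \<le> m"
  unfolding cheb_partial_sum_def
  by (intro degree_add_le degree_sum_le)
    (auto intro: order_trans[OF degree_smult_le] order_trans[OF degree_cheb_T_le])

lemma cheb_remainder_eq: "cheb_remainder m l x = F l x - poly (cheb_partial_sum m l) x"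
  by (simp add: cheb_remainder_def cheb_partial_sum_def poly_sum)

lemma abs_cheb_coeff_le_best_error:
  assumes l: "l > 0" and k: "m < k"
  shows "\<bar>cheb_coeff l k\<bar> \<le> 2 * best_error m l"
proof -
  have "\<bar>cheb_coeff l k\<bar> / 2 \<le> sup_norm (\<lambda>x. F l x - poly p x)" if p: "degree p \<le> m" for p
  proof -
    let ?d = "\<lambda>x. F l x - poly p x"
    have cd: "continuous_on {-1..1} ?d"
      using l by (intro continuous_intros continuous_on_F)
    have "\<bar>integral {0..pi} (\<lambda>t. ?d (cos t) * cos (real k * t))\<bar> \<le> sup_norm ?d * (pi - 0)"
      unfolding real_norm_def[symmetric]
    proof (rule integral_bound)
      show "continuous_on {0..pi} (\<lambda>t. ?d (cos t) * cos (real k * t))"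
        by (rule continuous_on_mult[OF continuous_on_comp_cos[OF cd]]) (intro continuous_intros)
      fix t :: real
      have "\<bar>?d (cos t)\<bar> * \<bar>cos (real k * t)\<bar> \<le> sup_norm ?d * 1"
        using abs_le_sup_norm[OF cd, of "cos t"] by (intro mult_mono) auto
      then show "norm (?d (cos t) * cos (real k * t)) \<le> sup_norm ?d"
        by (simp add: abs_mult)
    qed simp
    then have "2 / pi * \<bar>integral {0..pi} (\<lambda>t. ?d (cos t) * cos (real k * t))\<bar> \<le>
        2 / pi * (sup_norm ?d * (pi - 0))"
      by (intro mult_left_mono) auto
    moreover have "\<bar>cheb_coeff l k\<bar> = 2 / pi * \<bar>integral {0..pi} (\<lambda>t. ?d (cos t) * cos (real k * t))\<bar>"
      using cheb_coeff_minus_poly[OF l, of p k] p k by (simp add: abs_mult)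
    ultimately show ?thesis
      by simp
  qed
  then have "\<bar>cheb_coeff l k\<bar> / 2 \<le> best_error m l"
    unfolding best_error_def by (intro cINF_greatest) (auto intro: exI[of _ 0])
  then show ?thesis
    by simp
qed

lemma cheb_norm_eq:
  assumes "continuous_on {-1..1} g"
  shows "cheb_norm g = sqrt (integral {0..pi} (\<lambda>t. (g (cos t))\<^sup>2))"
  unfolding cheb_norm_def using assms
  by (subst cheb_weight_integral) (auto intro!: continuous_intros)

text \<open>Bessel's inequality for a single coefficient: subtracting from the remainder its
  component along \<open>cos (k t)\<close> leaves a function with a nonnegative square integral.\<close>

lemma abs_cheb_coeff_le_l2_error:
  assumes l: "l > 0" and k: "m < k"
  shows "\<bar>cheb_coeff l k\<bar> \<le> l2_error m l"
proof -
  let ?R = "\<lambda>t. cheb_remainder m l (cos t)" and ?a = "cheb_coeff l k"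
  let ?c = "\<lambda>t. cos (real k * t)"
  note cR = continuous_on_comp_cos[OF continuous_on_cheb_remainder[OF l, of m], of "{0..pi}"]
  have 1: "(\<lambda>t. (?R t)\<^sup>2) integrable_on {0..pi}" "(\<lambda>t. 2 * ?a * (?R t * ?c t)) integrable_on {0..pi}"
    "(\<lambda>t. ?a\<^sup>2 * (?c t)\<^sup>2) integrable_on {0..pi}"
    using cR by (auto intro!: integrable_continuous_interval continuous_intros)
  have a: "integral {0..pi} (\<lambda>t. ?R t * ?c t) = pi / 2 * ?a"
    unfolding cheb_remainder_eq
    using cheb_coeff_minus_poly[OF l, of "cheb_partial_sum m l" k] degree_cheb_partial_sum[of m l] k
    by simp
  have "0 \<le> integral {0..pi} (\<lambda>t. (?R t - ?a * ?c t)\<^sup>2)"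
    using cR by (intro integral_nonneg integrable_continuous_interval continuous_intros) auto
  also have "\<dots> = integral {0..pi} (\<lambda>t. ((?R t)\<^sup>2 - 2 * ?a * (?R t * ?c t)) + ?a\<^sup>2 * (?c t)\<^sup>2)"
    by (simp add: power2_eq_square algebra_simps)
  also have "\<dots> = integral {0..pi} (\<lambda>t. (?R t)\<^sup>2) - integral {0..pi} (\<lambda>t. 2 * ?a * (?R t * ?c t))
      + integral {0..pi} (\<lambda>t. ?a\<^sup>2 * (?c t)\<^sup>2)"
    using 1 by (simp only: integral_add integral_diff integrable_diff)
  also have "\<dots> = integral {0..pi} (\<lambda>t. (?R t)\<^sup>2) - pi / 2 * ?a\<^sup>2"
    using k by (simp only: integral_mult_right a integral_cos_multiple_square)
      (simp add: power2_eq_square algebra_simps)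
  finally have "pi / 2 * ?a\<^sup>2 \<le> integral {0..pi} (\<lambda>t. (?R t)\<^sup>2)"
    by simp
  moreover have "1 * ?a\<^sup>2 \<le> pi / 2 * ?a\<^sup>2"
    using pi_ge_two by (intro mult_right_mono) auto
  ultimately have "?a\<^sup>2 \<le> integral {0..pi} (\<lambda>t. (?R t)\<^sup>2)"
    by linarith
  then have "sqrt (?a\<^sup>2) \<le> sqrt (integral {0..pi} (\<lambda>t. (?R t)\<^sup>2))"
    by (rule real_sqrt_le_mono)
  then show ?thesis
    unfolding l2_error_def by (simp add: cheb_norm_eq[OF continuous_on_cheb_remainder[OF l]])
qed

lemma best_error_le_sup_error:
  assumes "l > 0"
  shows "best_error m l \<le> sup_error m l"
proof -
  have "best_error m l \<le> sup_norm (\<lambda>x. F l x - poly (cheb_partial_sum m l) x)"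
    unfolding best_error_def
  proof (intro cINF_lower bdd_belowI2)
    show "cheb_partial_sum m l \<in> {p. degree p \<le> m}"
      by (simp add: degree_cheb_partial_sum)
    fix p :: "real poly"
    have "\<bar>F l 0 - poly p 0\<bar> \<le> sup_norm (\<lambda>x. F l x - poly p x)"
      using assms by (intro abs_le_sup_norm continuous_intros continuous_on_F) auto
    then show "0 \<le> sup_norm (\<lambda>x. F l x - poly p x)"
      by linarith
  qed
  then show ?thesis
    by (simp add: sup_error_def cheb_remainder_eq[abs_def])
qed

lemma l2_error_le_sup_error:
  assumes l: "l > 0"
  shows "l2_error m l \<le> sqrt pi * sup_error m l"
proof -
  let ?R = "cheb_remainder m l"
  note cR = continuous_on_cheb_remainder[OF l, of m]
  have le: "\<bar>?R x\<bar> \<le> sup_error m l" if "x \<in> {-1..1}" for x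
    unfolding sup_error_def using cR that by (rule abs_le_sup_norm)
  have s: "0 \<le> sup_error m l"
    using le[of 0] by simp
  have "integral {0..pi} (\<lambda>t. (?R (cos t))\<^sup>2) \<le> integral {0..pi} (\<lambda>t. (sup_error m l)\<^sup>2)"
  proof (intro integral_le integrable_continuous_interval continuous_intros continuous_on_comp_cos cR)
    fix t :: real
    show "(?R (cos t))\<^sup>2 \<le> (sup_error m l)\<^sup>2"
      using le[of "cos t"] s by (simp add: abs_le_square_iff[symmetric])
  qed
  then have "l2_error m l \<le> sqrt (pi * (sup_error m l)\<^sup>2)"
    unfolding l2_error_def cheb_norm_eq[OF cR] by (intro real_sqrt_le_mono) simp
  then show ?thesis
    using s by (simp add: real_sqrt_mult)
qed

text \<open>The next coefficient is the projection of the current remainder on \<open>cos (k t)\<close>, so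
  subtracting it kills the \<open>k\<close>-th coefficient, and later terms are orthogonal to it.\<close>

lemma cheb_partial_sum_coeff:
  assumes l: "l > 0" and "k \<le> m"
  shows "integral {0..pi} (\<lambda>t. (F l (cos t) - poly (cheb_partial_sum m l) (cos t)) * cos (real k * t)) = 0"
  using \<open>k \<le> m\<close>
proof (induction m rule: dec_induct)
  case base
  show ?case
  proof (cases k)
    case 0
    have "integral {0..pi} (\<lambda>t. F l (cos t) - cheb_coeff l 0 / 2) =
        integral {0..pi} (\<lambda>t. F l (cos t)) - integral {0..pi} (\<lambda>t. cheb_coeff l 0 / 2)"
      using l by (intro integral_diff integrable_continuous_interval continuous_intros
          continuous_on_comp_cos continuous_on_F)
    then show ?thesis
      using l by (simp add: 0 cheb_partial_sum_def cheb_coeff_cos)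
  next
    case (Suc j)
    let ?S = "\<lambda>t. poly (cheb_partial_sum j l) (cos t)"
    have "integral {0..pi} (\<lambda>t. (F l (cos t) - poly (cheb_partial_sum k l) (cos t)) * cos (real k * t)) =
        integral {0..pi} (\<lambda>t. (F l (cos t) - ?S t) * cos (real k * t) -
          cheb_coeff l k * (cos (real k * t))\<^sup>2)"
      by (simp add: Suc cheb_partial_sum_def poly_cheb_T_cos power2_eq_square algebra_simps)
    also have "\<dots> = integral {0..pi} (\<lambda>t. (F l (cos t) - ?S t) * cos (real k * t)) -
        integral {0..pi} (\<lambda>t. cheb_coeff l k * (cos (real k * t))\<^sup>2)"
      using l by (intro integral_diff integrable_continuous_interval continuous_intros
          continuous_on_comp_cos continuous_on_F)
    also have "\<dots> = pi / 2 * cheb_coeff l k - cheb_coeff l k * (pi / 2)"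
    proof -
      have "degree (cheb_partial_sum j l) < k"
        using degree_cheb_partial_sum[of j l] Suc by simp
      from cheb_coeff_minus_poly[OF l this] show ?thesis
        using Suc by (simp add: integral_cos_multiple_square del: of_nat_Suc)
    qed
    finally show ?thesis
      by simp
  qed
next
  case (step m)
  let ?S = "\<lambda>t. poly (cheb_partial_sum m l) (cos t)"
  have "integral {0..pi} (\<lambda>t. (F l (cos t) - poly (cheb_partial_sum (Suc m) l) (cos t)) * cos (real k * t)) =
      integral {0..pi} (\<lambda>t. (F l (cos t) - ?S t) * cos (real k * t) -
        cheb_coeff l (Suc m) * (cos (real (Suc m) * t) * poly (cheb_T k) (cos t)))"
    by (simp add: cheb_partial_sum_def poly_cheb_T_cos algebra_simps)
  also have "\<dots> = integral {0..pi} (\<lambda>t. (F l (cos t) - ?S t) * cos (real k * t)) -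
      integral {0..pi} (\<lambda>t. cheb_coeff l (Suc m) * (cos (real (Suc m) * t) * poly (cheb_T k) (cos t)))"
    using l by (intro integral_diff integrable_continuous_interval continuous_intros
        continuous_on_comp_cos continuous_on_F)
  also have "\<dots> = 0 - cheb_coeff l (Suc m) * 0"
    using step degree_cheb_T_le[of k] cos_multiple_orthogonal_poly[of "cheb_T k" "Suc m"]
    by (simp only: integral_mult_right)
  finally show ?case
    by simp
qed

text \<open>An absolutely summable Chebyshev series converges uniformly, and its limit has the same
  coefficients as \<open>F l\<close>, hence equals it.\<close>

lemma cheb_series_sums:
  assumes l: "l > 0" and s: "summable (\<lambda>k. \<bar>cheb_coeff l k\<bar>)" and x: "x \<in> {-1..1}"
  shows "(\<lambda>m. poly (cheb_partial_sum m l) x) \<longlonglongrightarrow> F l x"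
proof -
  define S where "S = (\<lambda>m x. poly (cheb_partial_sum m l) x)"
  have S_Suc: "S (Suc m) x = S m x + cheb_coeff l (Suc m) * poly (cheb_T (Suc m)) x" for m x
    by (simp add: S_def cheb_partial_sum_def)
  have S_eq: "S m x = (\<Sum>k<Suc m. cheb_coeff l k * poly (cheb_T k) x) - cheb_coeff l 0 / 2" for m x
    by (induction m) (simp_all add: S_Suc, simp add: S_def cheb_partial_sum_def)
  define T where "T = (\<lambda>x. (\<Sum>k. cheb_coeff l k * poly (cheb_T k) x) - cheb_coeff l 0 / 2)"
  have "uniform_limit {-1..1} (\<lambda>n x. \<Sum>k<n. cheb_coeff l k * poly (cheb_T k) x)
      (\<lambda>x. \<Sum>k. cheb_coeff l k * poly (cheb_T k) x) sequentially"
  proof (rule Weierstrass_m_test[OF _ s])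
    fix k and x :: real
    assume "x \<in> {-1..1}"
    then show "norm (cheb_coeff l k * poly (cheb_T k) x) \<le> \<bar>cheb_coeff l k\<bar>"
      using mult_left_mono[OF abs_poly_cheb_T_le_1[of x k], of "\<bar>cheb_coeff l k\<bar>"]
      by (simp add: abs_mult)
  qed
  then have "uniform_limit {-1..1} (\<lambda>n x. \<Sum>k<Suc n. cheb_coeff l k * poly (cheb_T k) x)
      (\<lambda>x. \<Sum>k. cheb_coeff l k * poly (cheb_T k) x) sequentially"
    by (rule filterlim_compose[OF _ filterlim_Suc])
  then have uS: "uniform_limit {-1..1} S T sequentially"
    unfolding S_eq[abs_def] T_def by (intro uniform_limit_intros)
  have cT: "continuous_on {-1..1} T"
    by (rule uniform_limit_theorem[OF _ uS])
      (auto simp: S_def intro!: always_eventually continuous_on_poly continuous_on_id)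
  have "F l x - T x = 0"
  proof (rule continuous_zero_if_cos_coeffs_zero[where g = "\<lambda>x. F l x - T x"])
    show "continuous_on {-1..1} (\<lambda>x. F l x - T x)"
      using l cT by (intro continuous_intros continuous_on_F)
    fix k
    let ?c = "\<lambda>t. cos (real k * t)"
    have "uniform_limit {0..pi} (\<lambda>m t. S m (cos t)) (\<lambda>t. T (cos t)) sequentially"
      unfolding uniform_limit_iff
    proof (intro allI impI)
      fix e :: real
      assume "e > 0"
      with uS have "\<forall>\<^sub>F n in sequentially. \<forall>x\<in>{-1..1}. dist (S n x) (T x) < e"
        unfolding uniform_limit_iff by blast
      then show "\<forall>\<^sub>F n in sequentially. \<forall>t\<in>{0..pi}. dist (S n (cos t)) (T (cos t)) < e"
        by (rule eventually_mono) auto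
    qed
    moreover have "bounded ((\<lambda>t. T (cos t)) ` {0..pi})"
      by (intro compact_imp_bounded compact_continuous_image continuous_on_comp_cos cT) auto
    moreover have "bounded (?c ` {0..pi})"
      by (intro compact_imp_bounded compact_continuous_image continuous_intros) auto
    ultimately have "uniform_limit {0..pi} (\<lambda>m t. (F l (cos t) - S m (cos t)) * ?c t)
        (\<lambda>t. (F l (cos t) - T (cos t)) * ?c t) sequentially"
      using l by (intro uniform_lim_mult uniform_limit_intros compact_imp_bounded
          compact_continuous_image continuous_intros continuous_on_comp_cos continuous_on_F cT) auto
    moreover have "continuous_on {0..pi} (\<lambda>t. (F l (cos t) - S m (cos t)) * ?c t)" for m
      using l unfolding S_def by (intro continuous_intros continuous_on_comp_cos continuous_on_F)
    ultimately obtain I J where I: "\<And>m. ((\<lambda>t. (F l (cos t) - S m (cos t)) * ?c t) has_integral I m) {0..pi}"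
      and J: "((\<lambda>t. (F l (cos t) - T (cos t)) * ?c t) has_integral J) {0..pi}"
      and IJ: "I \<longlonglongrightarrow> J"
      by (elim uniform_limit_integral) auto
    have "I m = 0" if "m \<ge> k" for m
    proof -
      have "integral {0..pi} (\<lambda>t. (F l (cos t) - S m (cos t)) * ?c t) = 0"
        unfolding S_def using l that by (rule cheb_partial_sum_coeff)
      then show ?thesis
        using I[of m] by (simp add: integral_unique)
    qed
    then have "I \<longlonglongrightarrow> 0"
      by (intro tendsto_eventually) (auto simp: eventually_at_top_linorder)
    then have "J = 0"
      using IJ LIMSEQ_unique by blast
    then show "integral {0..pi} (\<lambda>t. (F l (cos t) - T (cos t)) * ?c t) = 0"
      using J by (simp add: integral_unique)
  qed (use x in auto)
  moreover have "(\<lambda>m. S m x) \<longlonglongrightarrow> T x"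
    using uS x by (rule tendsto_uniform_limitI)
  ultimately show ?thesis
    by (simp add: S_def)
qed

text \<open>The remainder is the sum of the tail, and \<open>\<bar>T\<^sub>k\<bar> \<le> 1\<close> on \<open>[-1, 1]\<close>.\<close>

lemma sup_error_le_suminf:
  assumes l: "l > 0" and s: "summable (\<lambda>j. \<bar>cheb_coeff l (Suc (m + j))\<bar>)"
  shows "sup_error m l \<le> (\<Sum>j. \<bar>cheb_coeff l (Suc (m + j))\<bar>)"
  unfolding sup_error_def
proof (rule sup_norm_le)
  fix x :: real
  assume x: "x \<in> {-1..1}"
  have "summable (\<lambda>j. \<bar>cheb_coeff l (j + Suc m)\<bar>)"
    using s by (simp add: add_ac)
  then have s': "summable (\<lambda>k. \<bar>cheb_coeff l k\<bar>)"
    by (rule summable_iff_shift[THEN iffD1])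
  have "poly (cheb_partial_sum (m + n) l) x =
      poly (cheb_partial_sum m l) x + (\<Sum>j<n. cheb_coeff l (Suc (m + j)) * poly (cheb_T (Suc (m + j))) x)" for n
    by (induction n) (simp_all add: cheb_partial_sum_def)
  then have "(\<lambda>n. \<bar>(\<Sum>j<n. cheb_coeff l (Suc (m + j)) * poly (cheb_T (Suc (m + j))) x)\<bar>) =
      (\<lambda>n. \<bar>poly (cheb_partial_sum (m + n) l) x - poly (cheb_partial_sum m l) x\<bar>)"
    by simp
  moreover have "(\<lambda>n. \<bar>poly (cheb_partial_sum (n + m) l) x - poly (cheb_partial_sum m l) x\<bar>)
      \<longlonglongrightarrow> \<bar>F l x - poly (cheb_partial_sum m l) x\<bar>"
    by (intro tendsto_intros LIMSEQ_ignore_initial_segment cheb_series_sums l s' x)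
  ultimately have lim: "(\<lambda>n. \<bar>(\<Sum>j<n. cheb_coeff l (Suc (m + j)) * poly (cheb_T (Suc (m + j))) x)\<bar>)
      \<longlonglongrightarrow> \<bar>cheb_remainder m l x\<bar>"
    by (simp add: cheb_remainder_eq add.commute)
  have "\<bar>(\<Sum>j<n. cheb_coeff l (Suc (m + j)) * poly (cheb_T (Suc (m + j))) x)\<bar> \<le>
      (\<Sum>j. \<bar>cheb_coeff l (Suc (m + j))\<bar>)" for n
  proof -
    have "\<bar>(\<Sum>j<n. cheb_coeff l (Suc (m + j)) * poly (cheb_T (Suc (m + j))) x)\<bar> \<le>
        (\<Sum>j<n. \<bar>cheb_coeff l (Suc (m + j))\<bar>)"
      using mult_left_mono[OF abs_poly_cheb_T_le_1[OF x] abs_ge_zero]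
      by (intro order_trans[OF sum_abs] sum_mono) (simp add: abs_mult)
    also have "\<dots> \<le> (\<Sum>j. \<bar>cheb_coeff l (Suc (m + j))\<bar>)"
      using s by (intro sum_le_suminf) auto
    finally show ?thesis .
  qed
  with lim show "\<bar>cheb_remainder m l x\<bar> \<le> (\<Sum>j. \<bar>cheb_coeff l (Suc (m + j))\<bar>)"
    by (intro LIMSEQ_le_const2) auto
qed

section \<open>A contour integral for the coefficients\<close>

lemma gaussian_integral:
  fixes a c :: real
  assumes "a > 0"
  shows "integrable lborel (\<lambda>v. exp (- a * (v - c)\<^sup>2))" (is ?int)
    and "(LINT v|lborel. exp (- a * (v - c)\<^sup>2)) = sqrt (pi / a)" (is ?eq)
proof -
  define \<sigma> where "\<sigma> = sqrt (1 / (2 * a))"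
  have \<sigma>: "\<sigma> > 0" "\<sigma>\<^sup>2 = 1 / (2 * a)"
    using assms by (simp_all add: \<sigma>_def)
  have eq: "exp (- a * (v - c)\<^sup>2) = sqrt (pi / a) * normal_density c \<sigma> v" for v
    using assms by (simp add: normal_density_def \<sigma>(2) real_sqrt_divide)
  show ?int
    unfolding eq using \<sigma> by (intro integrable_mult_right integrable_normal_density)
  show ?eq
    unfolding eq using \<sigma> by simp
qed

text \<open>The integrand of the coefficient with index \<open>n + 1\<close> in the variable \<open>z\<close>, where \<open>z = \<i> y\<close> and
  \<open>y = tan (t / 2)\<close>. The measure contributes \<open>1 / (1 - z\<^sup>2)\<close>, whose pole at \<open>z = 1\<close> is cancelled by one of the
  \<open>n + 1\<close> factors \<open>(1 - z) / (1 + z)\<close>; so the kernel is holomorphic to the right of \<open>-1\<close>.\<close>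

definition cheb_kernel :: "real \<Rightarrow> nat \<Rightarrow> complex \<Rightarrow> complex" where
  "cheb_kernel l n z = exp (of_real l * z\<^sup>2) * ((1 - z) / (1 + z)) ^ n / (1 + z)\<^sup>2"

abbreviation vline :: "real \<Rightarrow> real \<Rightarrow> complex" where
  "vline x y \<equiv> of_real x + \<i> * of_real y"

lemma cmod_square_vline: "(cmod (1 + vline x y))\<^sup>2 = (1 + x)\<^sup>2 + y\<^sup>2"
    "(cmod (1 - vline x y))\<^sup>2 = (1 - x)\<^sup>2 + y\<^sup>2"
  by (simp_all add: cmod_power2)

lemma norm_exp_square: "norm (exp (of_real l * z\<^sup>2)) = exp (l * ((Re z)\<^sup>2 - (Im z)\<^sup>2))"
  by (simp add: Re_power2)

lemma cmod_one_plus_ge_1: "Re z \<ge> 0 \<Longrightarrow> 1 \<le> cmod (1 + z)"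
  using complex_Re_le_cmod[of "1 + z"] by simp

lemma norm_cayley_le_1:
  assumes "Re z \<ge> 0"
  shows "norm ((1 - z) / (1 + z)) \<le> 1"
proof -
  have "(cmod (1 - z))\<^sup>2 \<le> (cmod (1 + z))\<^sup>2"
    using assms unfolding cmod_power2 by (simp add: power2_eq_square algebra_simps)
  then have "cmod (1 - z) \<le> cmod (1 + z)"
    by (simp add: power2_le_iff_abs_le)
  moreover have "cmod (1 + z) > 0"
    using cmod_one_plus_ge_1[OF assms] by linarith
  ultimately show ?thesis
    by (simp add: norm_divide)
qed

lemma norm_cheb_kernel_le:
  assumes "Re z \<ge> 0"
  shows "norm (cheb_kernel l n z) \<le> exp (l * ((Re z)\<^sup>2 - (Im z)\<^sup>2))"
proof -
  have "norm (cheb_kernel l n z) =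
      exp (l * ((Re z)\<^sup>2 - (Im z)\<^sup>2)) * norm ((1 - z) / (1 + z)) ^ n / (cmod (1 + z))\<^sup>2"
    unfolding cheb_kernel_def by (simp only: norm_mult norm_divide norm_power norm_exp_square)
  also have "\<dots> \<le> exp (l * ((Re z)\<^sup>2 - (Im z)\<^sup>2)) * 1 / 1"
    using cmod_one_plus_ge_1[OF assms] norm_cayley_le_1[OF assms]
    by (intro frac_le mult_left_mono power_le_one one_le_power mult_nonneg_nonneg) auto
  finally show ?thesis
    by simp
qed

lemma continuous_on_cheb_kernel_vline:
  assumes "x \<ge> 0"
  shows "continuous_on A (\<lambda>y. cheb_kernel l n (vline x y))"
proof -
  have "1 + vline x y \<noteq> 0" for y
    using assms by (auto simp: complex_eq_iff)
  then show ?thesis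
    unfolding cheb_kernel_def by (intro continuous_intros) auto
qed

lemma integrable_cheb_kernel:
  assumes "l > 0" "x \<ge> 0"
  shows "integrable lborel (\<lambda>y. cheb_kernel l n (vline x y))"
proof (rule Bochner_Integration.integrable_bound)
  show "integrable lborel (\<lambda>y. exp (l * x\<^sup>2) * exp (- l * (y - 0)\<^sup>2))"
    using assms by (intro integrable_mult_right gaussian_integral)
  show "(\<lambda>y. cheb_kernel l n (vline x y)) \<in> borel_measurable lborel"
    using continuous_on_cheb_kernel_vline[OF assms(2)]
    by (simp add: borel_measurable_continuous_onI)
  show "AE y in lborel. norm (cheb_kernel l n (vline x y)) \<le>
      norm (exp (l * x\<^sup>2) * exp (- l * (y - 0)\<^sup>2))"
    using norm_cheb_kernel_le[of "vline x _" l n] assms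
    by (intro always_eventually allI) (simp add: exp_add[symmetric] algebra_simps)
qed

lemma set_integrable_cheb_kernel:
  assumes "l > 0" "x \<ge> 0"
  shows "set_integrable lborel {0..} (\<lambda>y. cheb_kernel l n (vline x y))"
  unfolding set_integrable_def
  by (rule integrable_mult_indicator) (use integrable_cheb_kernel[OF assms] in auto)

text \<open>The half-angle variable \<open>y = tan (t / 2)\<close> turns \<open>F l (cos t)\<close> into a Gaussian and
  \<open>exp (- \<i> t)\<close> into the Cayley transform of \<open>\<i> y\<close>.\<close>

lemma cayley_imaginary_axis: "(1 - \<i> * of_real y) / (1 + \<i> * of_real y) = cis (- (2 * arctan y))"
proof -
  have p: "1 + y\<^sup>2 > 0"
    by (simp add: add_pos_nonneg)
  have c: "cos (2 * arctan y) = (1 - y\<^sup>2) / (1 + y\<^sup>2)" "sin (2 * arctan y) = 2 * y / (1 + y\<^sup>2)"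
    using p by (simp_all add: cos_double sin_double cos_arctan sin_arctan power_divide diff_divide_distrib)
  let ?w = "1 + \<i> * complex_of_real y" and ?v = "1 - \<i> * complex_of_real y"
  have vv: "?v * ?v = of_real (1 + y\<^sup>2) * cis (- (2 * arctan y))"
    using p by (simp add: complex_eq_iff c power2_eq_square)
  have wv: "?w * ?v = of_real (1 + y\<^sup>2)"
    by (simp add: complex_eq_iff power2_eq_square)
  have "?v \<noteq> 0"
    by (auto simp: complex_eq_iff)
  then have "?v / ?w = (?v * ?v) / (?w * ?v)"
    by simp
  also have "\<dots> = cis (- (2 * arctan y))"
  proof -
    have "complex_of_real (1 + y\<^sup>2) \<noteq> 0"
      using p by (simp only: of_real_eq_0_iff)
    then show ?thesis
      unfolding vv wv by (rule nonzero_mult_div_cancel_left)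
  qed
  finally show ?thesis .
qed

lemma cheb_kernel_imaginary_axis:
  assumes "y > 0"
  shows "2 / (1 + y\<^sup>2) * (F l (cos (2 * arctan y)) * cos (real (Suc n) * (2 * arctan y))) =
    2 * Re (cheb_kernel l n (vline 0 y))"
proof -
  let ?u = "(1 - \<i> * of_real y) / (1 + \<i> * of_real y)"
  have nz: "1 + \<i> * of_real y \<noteq> 0" "1 - \<i> * of_real y \<noteq> 0"
    by (auto simp: complex_eq_iff)
  have "of_real (1 + y\<^sup>2) = (1 + \<i> * of_real y) * (1 - \<i> * complex_of_real y)"
    by (simp add: complex_eq_iff power2_eq_square)
  then have inv: "1 / (1 + \<i> * of_real y)\<^sup>2 = ?u / of_real (1 + y\<^sup>2)"
    using nz by (simp only:) (simp add: power2_eq_square)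
  have "cheb_kernel l n (vline 0 y) = exp (of_real (- l * y\<^sup>2)) * ?u ^ n * (1 / (1 + \<i> * of_real y)\<^sup>2)"
    by (simp add: cheb_kernel_def power_mult_distrib)
  also have "\<dots> = of_real (exp (- l * y\<^sup>2)) * ?u ^ Suc n / of_real (1 + y\<^sup>2)"
    unfolding inv exp_of_real by simp
  also have "?u ^ Suc n = cis (- (real (Suc n) * (2 * arctan y)))"
    unfolding cayley_imaginary_axis by (simp only: Complex.DeMoivre mult_minus_right)
  finally have "Re (cheb_kernel l n (vline 0 y)) =
      exp (- l * y\<^sup>2) * cos (real (Suc n) * (2 * arctan y)) / (1 + y\<^sup>2)"
    by (simp only: Re_divide_of_real) simp
  moreover have "F l (cos (2 * arctan y)) = exp (- l * y\<^sup>2)"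
    using assms arctan_ubound[of y] by (subst F_cos) (auto simp: tan_arctan)
  ultimately show ?thesis
    by simp
qed

lemma cheb_coeff_imaginary_axis:
  assumes l: "l > 0"
  shows "cheb_coeff l (Suc n) = 4 / pi * Re (LINT y:{0..}|lborel. cheb_kernel l n (vline 0 y))"
proof -
  define h where "h = (\<lambda>t. F l (cos t) * cos (real (Suc n) * t))"
  let ?g = "\<lambda>y. 2 * arctan y" and ?K = "\<lambda>y. Re (cheb_kernel l n (vline 0 y))"
  have img: "?g ` {0<..} = {0<..<pi}"
  proof (intro equalityI subsetI)
    fix t :: real
    assume t: "t \<in> {0<..<pi}"
    then have "t = ?g (tan (t / 2))"
      by (subst arctan_tan) auto
    moreover have "tan (t / 2) > 0"
      using t by (intro tan_gt_zero) auto
    ultimately show "t \<in> ?g ` {0<..}"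
      by blast
  qed (use arctan_ubound in \<open>auto simp: field_simps\<close>)
  have ch: "continuous_on {0..pi} h"
    unfolding h_def using l by (intro continuous_intros continuous_on_comp_cos continuous_on_F)
  have hi: "h absolutely_integrable_on {0<..<pi}"
    using absolutely_integrable_continuous_real[OF ch] by (rule set_integrable_subset) auto
  have "(\<lambda>y. \<bar>2 / (1 + y\<^sup>2)\<bar> * h (?g y)) absolutely_integrable_on {0<..} \<and>
      integral {0<..} (\<lambda>y. \<bar>2 / (1 + y\<^sup>2)\<bar> * h (?g y)) = b \<longleftrightarrow>
      h absolutely_integrable_on (?g ` {0<..}) \<and> integral (?g ` {0<..}) h = b" for b
  proof (rule has_absolute_integral_change_of_variables_1')
    show "inj_on ?g {0<..}"
      by (rule inj_onI) (simp add: arctan_eq_iff)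
    show "(?g has_field_derivative 2 / (1 + y\<^sup>2)) (at y within {0<..})" for y
      by (auto intro!: derivative_eq_intros simp: divide_inverse)
  qed simp
  then have "integral {0<..<pi} h = integral {0<..} (\<lambda>y. \<bar>2 / (1 + y\<^sup>2)\<bar> * h (?g y))"
    using hi unfolding img by blast
  also have "\<dots> = integral {0<..} (\<lambda>y. 2 * ?K y)"
  proof (rule integral_cong)
    fix y :: real
    assume y: "y \<in> {0<..}"
    have "\<bar>2 / (1 + y\<^sup>2)\<bar> = 2 / (1 + y\<^sup>2)"
      by simp
    then show "\<bar>2 / (1 + y\<^sup>2)\<bar> * h (?g y) = 2 * ?K y"
      unfolding h_def using cheb_kernel_imaginary_axis[of y l n] y by (simp only:) simp
  qed
  also have "\<dots> = integral {0..} (\<lambda>y. 2 * ?K y)"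
    by (rule integral_spike_set) (auto intro: negligible_subset[of "{0}"])
  also have "\<dots> = 2 * integral {0..} ?K"
    by simp
  also have "integral {0..} ?K = (LINT y:{0..}|lborel. ?K y)"
    using set_integrable_cheb_kernel[OF l order_refl, of n]
    by (intro set_borel_integral_eq_integral(2)[symmetric]) (auto simp: set_integrable_def dest: integrable_Re)
  also have "\<dots> = Re (LINT y:{0..}|lborel. cheb_kernel l n (vline 0 y))"
    using set_integrable_cheb_kernel[OF l order_refl, of n]
    unfolding set_lebesgue_integral_def set_integrable_def by (subst integral_Re[symmetric]) auto
  finally show ?thesis
    using l by (simp add: cheb_coeff_cos h_def integral_open_interval_real del: of_nat_Suc)
qed

text \<open>The line of integration may be moved to the right: the kernel is holomorphic there and decays
  like a Gaussian upwards. At the lower end the two paths differ by an integral over a piece of the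
  real axis, on which the kernel is real; it contributes only to the imaginary part of the contour
  integral, that is, not to the real part of the integral over the height \<open>y\<close>.\<close>

lemma cheb_coeff_vline:
  assumes l: "l > 0" and x: "x \<ge> 0"
  shows "cheb_coeff l (Suc n) = 4 / pi * Re (LINT y:{0..}|lborel. cheb_kernel l n (vline x y))"
proof -
  define S where "S = {z :: complex. - 1 < Re z}"
  have S: "convex S" "open S"
    unfolding S_def by (simp_all add: convex_halfspace_Re_gt open_halfspace_Re_gt)
  have nz: "1 + z \<noteq> 0" if "z \<in> S" for z
    using that by (auto simp: S_def complex_eq_iff)
  have hol: "cheb_kernel l n holomorphic_on S"
    unfolding cheb_kernel_def using nz by (intro holomorphic_intros) auto
  have "\<exists>\<Phi>. \<forall>z\<in>S. (\<Phi> has_field_derivative cheb_kernel l n z) (at z within S)"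
    by (rule holomorphic_convex_primitive'[OF S hol]) (intro exI ballI)
  then obtain \<Phi> where "\<forall>z\<in>S. (\<Phi> has_field_derivative cheb_kernel l n z) (at z within S)" ..
  then have \<Phi>: "(\<Phi> has_field_derivative cheb_kernel l n z) (at z)" if "z \<in> S" for z
    using that at_within_open[OF that S(2)] by (metis (no_types))
  have up: "(\<lambda>R. \<Phi> (vline a (real R)) - \<Phi> (of_real a)) \<longlonglongrightarrow>
      \<i> * (LINT y:{0..}|lborel. cheb_kernel l n (vline a y))" if a: "a \<ge> 0" for a
  proof -
    have "(LINT y:{0..R}|lborel. cheb_kernel l n (vline a y)) = (\<Phi> (vline a R) - \<Phi> (of_real a)) / \<i>"
      if "R \<ge> 0" for R
    proof -
      have "((\<lambda>y. cheb_kernel l n (vline a y)) has_integral \<Phi> (vline a R) / \<i> - \<Phi> (vline a 0) / \<i>) {0..R}"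
      proof (rule fundamental_theorem_of_calculus[OF that])
        fix y
        have "vline a y \<in> S"
          using a by (simp add: S_def)
        note \<Phi>[OF this]
        moreover have "((\<lambda>y. vline a y) has_vector_derivative \<i>) (at y within {0..R})"
          by (auto intro!: derivative_eq_intros)
        ultimately have "(\<Phi> \<circ> vline a has_vector_derivative \<i> * cheb_kernel l n (vline a y)) (at y within {0..R})"
          by (intro field_vector_diff_chain_within[OF _ has_field_derivative_at_within])
        then have "((\<lambda>y. (\<Phi> \<circ> vline a) y / \<i>) has_vector_derivative \<i> * cheb_kernel l n (vline a y) / \<i>)
            (at y within {0..R})"
          by (rule has_vector_derivative_divide)
        then show "((\<lambda>y. \<Phi> (vline a y) / \<i>) has_vector_derivative cheb_kernel l n (vline a y)) (at y within {0..R})"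
          by (simp add: o_def)
      qed
      moreover have "set_integrable lborel {0..R} (\<lambda>y. cheb_kernel l n (vline a y))"
        by (rule set_integrable_subset[OF set_integrable_cheb_kernel[OF l a]]) auto
      ultimately show ?thesis
        by (simp add: set_borel_integral_eq_integral(2) integral_unique algebra_simps)
    qed
    moreover have "((\<lambda>R. LINT y:{0..R}|lborel. cheb_kernel l n (vline a y)) \<longlongrightarrow>
        (LINT y:{0..}|lborel. cheb_kernel l n (vline a y))) at_top"
      by (intro tendsto_set_lebesgue_integral_at_top set_integrable_cheb_kernel l a) auto
    then have "(\<lambda>R. LINT y:{0..real R}|lborel. cheb_kernel l n (vline a y)) \<longlonglongrightarrow>
        (LINT y:{0..}|lborel. cheb_kernel l n (vline a y))"
      by (rule filterlim_compose[OF _ filterlim_real_sequentially])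
    ultimately have "(\<lambda>R. (\<Phi> (vline a (real R)) - \<Phi> (of_real a)) / \<i>) \<longlonglongrightarrow>
        (LINT y:{0..}|lborel. cheb_kernel l n (vline a y))"
      by simp
    from tendsto_mult[OF tendsto_const[of \<i>] this] show ?thesis
      by simp
  qed
  have top: "(\<lambda>R. \<Phi> (vline x (real R)) - \<Phi> (vline 0 (real R))) \<longlonglongrightarrow> 0"
  proof (rule Lim_null_comparison)
    show "(\<lambda>R. exp (l * (x\<^sup>2 - (real R)\<^sup>2)) * x) \<longlonglongrightarrow> 0"
      using l by real_asymp
    have "norm (\<Phi> (vline x R) - \<Phi> (vline 0 R)) \<le> exp (l * (x\<^sup>2 - R\<^sup>2)) * x" for R
    proof -
      have "norm (\<Phi> (vline x R) - \<Phi> (vline 0 R)) \<le>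
          exp (l * (x\<^sup>2 - R\<^sup>2)) * norm (vline x R - vline 0 R)"
      proof (rule field_differentiable_bound[where S = "{z. 0 \<le> Re z \<and> Re z \<le> x \<and> Im z = R}"
            and f' = "cheb_kernel l n"])
        show "convex {z. 0 \<le> Re z \<and> Re z \<le> x \<and> Im z = R}"
        proof -
          have "{z. 0 \<le> Re z \<and> Re z \<le> x \<and> Im z = R} = {z. Re z \<ge> 0} \<inter> {z. Re z \<le> x} \<inter> {z. Im z \<ge> R} \<inter> {z. Im z \<le> R}"
            by auto
          then show ?thesis
            by (auto intro!: convex_Int convex_halfspace_Re_ge convex_halfspace_Re_le
                convex_halfspace_Im_ge convex_halfspace_Im_le)
        qed
        fix z
        assume z: "z \<in> {z. 0 \<le> Re z \<and> Re z \<le> x \<and> Im z = R}"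
        then show "(\<Phi> has_field_derivative cheb_kernel l n z) (at z within {z. 0 \<le> Re z \<and> Re z \<le> x \<and> Im z = R})"
          by (auto simp: S_def intro: has_field_derivative_at_within[OF \<Phi>])
        have "(Re z)\<^sup>2 \<le> x\<^sup>2"
          using z by (intro power_mono) auto
        then have "exp (l * ((Re z)\<^sup>2 - (Im z)\<^sup>2)) \<le> exp (l * (x\<^sup>2 - R\<^sup>2))"
          using l z by simp
        moreover have "norm (cheb_kernel l n z) \<le> exp (l * ((Re z)\<^sup>2 - (Im z)\<^sup>2))"
          using z by (intro norm_cheb_kernel_le) simp
        ultimately show "norm (cheb_kernel l n z) \<le> exp (l * (x\<^sup>2 - R\<^sup>2))"
          by (rule order_trans[rotated])
      qed (use x in auto)
      then show ?thesis
        using x by simp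
    qed
    then show "\<forall>\<^sub>F R in sequentially. norm (\<Phi> (vline x (real R)) - \<Phi> (vline 0 (real R))) \<le>
        exp (l * (x\<^sup>2 - (real R)\<^sup>2)) * x"
      by (intro always_eventually allI)
  qed
  have bottom: "Im (\<Phi> (of_real x)) = Im (\<Phi> 0)"
  proof -
    have "\<exists>c. \<forall>t\<in>{0..x}. Im (\<Phi> (of_real t)) = c"
    proof (rule has_field_derivative_zero_constant)
      fix t
      assume t: "t \<in> {0..x}"
      have "cheb_kernel l n (of_real t) = of_real (exp (l * t\<^sup>2) * ((1 - t) / (1 + t)) ^ n / (1 + t)\<^sup>2)"
        by (simp add: cheb_kernel_def flip: exp_of_real)
      then have "Im (cheb_kernel l n (of_real t)) = 0"
        by (simp only: Im_complex_of_real)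
      have "of_real t \<in> S"
        using t by (simp add: S_def)
      then have "(\<Phi> has_field_derivative cheb_kernel l n (of_real t)) (at (of_real t) within of_real ` {0..x})"
        by (rule has_field_derivative_at_within[OF \<Phi>])
      moreover have "(complex_of_real has_vector_derivative 1) (at t within {0..x})"
        using has_vector_derivative_of_real[OF DERIV_ident[THEN has_field_derivative_at_within]] by simp
      ultimately have "(\<Phi> \<circ> complex_of_real has_vector_derivative 1 * cheb_kernel l n (of_real t)) (at t within {0..x})"
        by (intro field_vector_diff_chain_within)
      from bounded_linear.has_vector_derivative[OF bounded_linear_Im this] show "((\<lambda>t. Im (\<Phi> (of_real t))) has_real_derivative 0) (at t within {0..x})"
        using \<open>Im (cheb_kernel l n (of_real t)) = 0\<close>
        by (simp add: has_real_derivative_iff_has_vector_derivative o_def)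
    qed simp
    then show ?thesis
      using x by (metis atLeastAtMost_iff of_real_0 order_refl)
  qed
  have "(\<lambda>R. (\<Phi> (vline x (real R)) - \<Phi> (of_real x)) - (\<Phi> (vline 0 (real R)) - \<Phi> (of_real 0))) \<longlonglongrightarrow>
      \<i> * (LINT y:{0..}|lborel. cheb_kernel l n (vline x y)) -
      \<i> * (LINT y:{0..}|lborel. cheb_kernel l n (vline 0 y))"
    by (intro tendsto_diff up) (use x in auto)
  moreover have "(\<lambda>R. (\<Phi> (vline x (real R)) - \<Phi> (vline 0 (real R))) - (\<Phi> (of_real x) - \<Phi> (of_real 0)))
      \<longlonglongrightarrow> 0 - (\<Phi> (of_real x) - \<Phi> (of_real 0))"
    by (intro tendsto_intros top)
  ultimately have "\<i> * (LINT y:{0..}|lborel. cheb_kernel l n (vline x y)) -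
      \<i> * (LINT y:{0..}|lborel. cheb_kernel l n (vline 0 y)) = 0 - (\<Phi> (of_real x) - \<Phi> (of_real 0))"
    by (intro LIMSEQ_unique) (auto simp: algebra_simps)
  then have "Im (\<i> * (LINT y:{0..}|lborel. cheb_kernel l n (vline x y))) =
      Im (\<i> * (LINT y:{0..}|lborel. cheb_kernel l n (vline 0 y)))"
    using bottom by (simp add: complex_eq_iff)
  then show ?thesis
    using cheb_coeff_imaginary_axis[OF l] by simp
qed

section \<open>The saddle point and the upper bound\<close>

text \<open>For \<open>0 < a < alpha_c\<close> the three roots of \<open>a (z\<^sup>3 - z) + 1\<close> sum to \<open>0\<close> and two of them are not real,
  so they are \<open>x \<plusminus> \<i> eta\<close> and \<open>- 2 x\<close> for some real \<open>x\<close>.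
  Comparing the other coefficients gives \<open>eta\<^sup>2 = 3 x\<^sup>2 - 1\<close> and \<open>a (8 x\<^sup>3 - 2 x) = 1\<close>. The real part \<open>x\<close> is
  therefore a parameter for the whole saddle point problem, and it replaces \<open>a\<close> from here on.\<close>

definition eta :: "real \<Rightarrow> real" where
  "eta x = sqrt (3 * x\<^sup>2 - 1)"

abbreviation saddle :: "real \<Rightarrow> complex" where
  "saddle x \<equiv> vline x (eta x)"

definition cayley :: "complex \<Rightarrow> complex" where
  "cayley z = (1 - z) / (1 + z)"

definition phase :: "real \<Rightarrow> nat \<Rightarrow> complex \<Rightarrow> complex" where
  "phase l m z = exp (of_real l * z\<^sup>2) * cayley z ^ m"

definition peak :: "real \<Rightarrow> nat \<Rightarrow> real \<Rightarrow> real" where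
  "peak l m x = norm (phase l m (saddle x))"

text \<open>The exponent of the Gaussian bound in \<open>norm_phase_le\<close> below, per unit of \<open>l\<close>.\<close>

definition decay :: "real \<Rightarrow> real" where
  "decay x = (3 * x\<^sup>2 - 1) / (4 * x\<^sup>2 + 2 * x)"

text \<open>The last assumption says that \<open>saddle x\<close> is a critical point of
  \<open>l z\<^sup>2 + m ln ((1 - z) / (1 + z))\<close>.\<close>

locale saddle_point =
  fixes l x :: real and m :: nat
  assumes l_pos: "l > 0"
    and x_pos: "x > 0"
    and x_large: "3 * x\<^sup>2 > 1"
    and m_eq: "real m = l * (8 * x ^ 3 - 2 * x)"
begin

lemma x_gt_half: "x > 1 / 2"
proof -
  have "(1 / 2)\<^sup>2 < x\<^sup>2"
    using x_large by (simp add: power_divide)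
  then show ?thesis
    by (rule power2_less_imp_less) (use x_pos in simp)
qed

lemma eta_pos: "eta x > 0" and eta_square: "(eta x)\<^sup>2 = 3 * x\<^sup>2 - 1"
  using x_large by (simp_all add: eta_def)

lemma cmod_one_plus_saddle: "(cmod (1 + saddle x))\<^sup>2 = 4 * x\<^sup>2 + 2 * x"
  by (simp only: cmod_square_vline eta_square) (simp add: power2_eq_square algebra_simps)

lemma cmod_one_minus_saddle: "(cmod (1 - saddle x))\<^sup>2 = 4 * x\<^sup>2 - 2 * x"
  by (simp only: cmod_square_vline eta_square) (simp add: power2_eq_square algebra_simps)

lemma decay_pos: "decay x > 0"
  using x_pos x_large by (simp add: decay_def add_pos_pos)

lemma norm_cayley_vline: "(norm (cayley (vline x y)))\<^sup>2 = ((1 - x)\<^sup>2 + y\<^sup>2) / ((1 + x)\<^sup>2 + y\<^sup>2)"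
  by (simp only: cayley_def norm_divide power_divide cmod_square_vline)

lemma norm_cayley_saddle: "(norm (cayley (saddle x)))\<^sup>2 = (2 * x - 1) / (2 * x + 1)"
proof -
  have "(norm (cayley (saddle x)))\<^sup>2 = ((2 * x) * (2 * x - 1)) / ((2 * x) * (2 * x + 1))"
    by (simp only: cayley_def norm_divide power_divide cmod_one_plus_saddle cmod_one_minus_saddle)
      (simp add: power2_eq_square algebra_simps)
  then show ?thesis
    using x_pos by simp
qed

lemma cayley_saddle_nonzero: "cayley (saddle x) \<noteq> 0"
  using norm_cayley_saddle x_gt_half by auto

lemma phase_saddle_nonzero: "phase l m (saddle x) \<noteq> 0" and peak_pos: "peak l m x > 0"
  using cayley_saddle_nonzero by (simp_all add: phase_def peak_def)

text \<open>In the variable \<open>s = y\<^sup>2\<close> the inequality \<open>1 + q \<le> exp q\<close>, applied to the quotient of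
  the squared moduli of the Cayley transforms, leaves exactly the exponent
  \<open>- l (s - s\<^sub>0)\<^sup>2 / ((1 + x)\<^sup>2 + s)\<close> with \<open>s\<^sub>0 = eta\<^sup>2\<close>: the linear terms cancel because \<open>saddle x\<close> is
  a critical point. So the saddle is the only maximum of the modulus on the half line, and the
  decay away from it is Gaussian.\<close>

lemma norm_phase_le:
  assumes y: "y \<ge> 0"
  shows "norm (phase l m (vline x y)) \<le> peak l m x * exp (- (l * decay x) * (y - eta x)\<^sup>2)"
proof -
  define s s0 A B where "s = y\<^sup>2" and "s0 = 3 * x\<^sup>2 - 1" and "A = (1 - x)\<^sup>2" and "B = (1 + x)\<^sup>2"
  define u u0 where "u = norm (cayley (vline x y))" and "u0 = norm (cayley (saddle x))"
  have AB: "A + s0 = 2 * x * (2 * x - 1)" "B + s0 = 2 * x * (2 * x + 1)" "B - A = 4 * x"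
    by (simp_all add: A_def B_def s0_def power2_eq_square algebra_simps)
  have pos: "A + s0 > 0" "B + s > 0" "B + s0 > 0" "s0 > 0"
  proof -
    show "B + s > 0"
      using x_pos by (simp add: B_def s_def add_pos_nonneg)
    show "s0 > 0"
      using x_large by (simp add: s0_def)
  qed (use x_gt_half in \<open>simp_all add: AB\<close>)
  define q where "q = (s - s0) * (B - A) / ((A + s0) * (B + s))"
  have usq: "u\<^sup>2 = (A + s) / (B + s)" "u0\<^sup>2 = (A + s0) / (B + s0)"
    by (simp_all add: u_def u0_def norm_cayley_vline A_def B_def s_def s0_def eta_square)
  have "1 + q = ((A + s0) * (B + s) + (s - s0) * (B - A)) / ((A + s0) * (B + s))"
    using pos by (simp add: q_def add_divide_distrib)
  also have "(A + s0) * (B + s) + (s - s0) * (B - A) = (A + s) * (B + s0)"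
    by (simp add: algebra_simps)
  finally have q1: "1 + q = (A + s) * (B + s0) / ((A + s0) * (B + s))" .
  have "u\<^sup>2 = u0\<^sup>2 * (1 + q)"
  proof -
    have "c / d = a / b * (c * b / (a * d))" if "a > 0" "b > 0" for a b c d :: real
      using that by simp
    then show ?thesis
      using pos unfolding usq q1 by blast
  qed
  also have "\<dots> \<le> u0\<^sup>2 * exp q"
    by (intro mult_left_mono) (simp_all add: exp_ge_add_one_self)
  also have "\<dots> = (u0 * exp (q / 2))\<^sup>2"
    by (simp add: power_mult_distrib flip: exp_double)
  finally have "u \<le> u0 * exp (q / 2)"
    by (rule power2_le_imp_le) (simp add: u0_def)
  then have "u ^ m \<le> (u0 * exp (q / 2)) ^ m"
    by (intro power_mono) (simp_all add: u_def)
  also have "\<dots> = u0 ^ m * exp (real m * (q / 2))"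
    by (simp add: power_mult_distrib flip: exp_of_nat_mult)
  finally have um: "u ^ m \<le> u0 ^ m * exp (real m * (q / 2))" .
  have x1: "2 * x - 1 \<noteq> 0" "x \<noteq> 0"
    using x_gt_half by auto
  have mq: "real m * (q / 2) = l * (s - s0) * (B + s0) / (B + s)"
  proof -
    have "real m = l * (2 * x * (2 * x - 1) * (2 * x + 1))"
      by (simp add: m_eq power3_eq_cube algebra_simps)
    then show ?thesis
      using x1 pos unfolding q_def AB by (simp add: divide_simps) (simp add: algebra_simps)
  qed
  have sum: "l * (x\<^sup>2 - s) + real m * (q / 2) = l * (x\<^sup>2 - s0) - l * ((s - s0)\<^sup>2 / (B + s))"
    using pos unfolding mq by (simp add: divide_simps) (simp add: power2_eq_square algebra_simps)
  have gauss: "decay x * (y - eta x)\<^sup>2 \<le> (s - s0)\<^sup>2 / (B + s)"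
  proof -
    have s0: "s0 = (eta x)\<^sup>2"
      by (simp add: s0_def eta_square)
    have ss: "s - s0 = (y - eta x) * (y + eta x)"
      by (simp add: s_def s0 power2_eq_square algebra_simps)
    have "s0 * (B + s) \<le> (s + s0) * (B + s0)"
      using pos by (simp add: s_def B_def algebra_simps)
    also have "\<dots> \<le> (y + eta x)\<^sup>2 * (B + s0)"
      using y eta_pos pos by (intro mult_right_mono) (simp_all add: s_def s0 power2_sum)
    finally have "s0 / (B + s0) \<le> (y + eta x)\<^sup>2 / (B + s)"
      using pos by (simp add: divide_simps mult.commute)
    then have "s0 / (B + s0) * (y - eta x)\<^sup>2 \<le> (y + eta x)\<^sup>2 / (B + s) * (y - eta x)\<^sup>2"
      by (intro mult_right_mono) auto
    moreover have "decay x = s0 / (B + s0)"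
      by (simp only: decay_def AB(2)) (simp add: s0_def power2_eq_square algebra_simps)
    ultimately show ?thesis
      by (simp add: ss power_mult_distrib mult.commute)
  qed
  have ph: "norm (phase l m (vline x y)) = exp (l * (x\<^sup>2 - s)) * u ^ m"
    "peak l m x = exp (l * (x\<^sup>2 - s0)) * u0 ^ m"
    unfolding phase_def peak_def norm_mult norm_power norm_exp_square u_def u0_def
    by (simp_all add: s_def s0_def eta_square)
  have "norm (phase l m (vline x y)) \<le> exp (l * (x\<^sup>2 - s)) * (u0 ^ m * exp (real m * (q / 2)))"
    unfolding ph using um by (intro mult_left_mono) auto
  also have "\<dots> = u0 ^ m * exp (l * (x\<^sup>2 - s) + real m * (q / 2))"
    by (simp add: exp_add)
  also have "\<dots> \<le> u0 ^ m * exp (l * (x\<^sup>2 - s0) - l * (decay x * (y - eta x)\<^sup>2))"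
    unfolding sum using mult_left_mono[OF gauss, of l] l_pos
    by (intro mult_left_mono) (simp_all add: u0_def)
  also have "\<dots> = peak l m x * exp (- (l * decay x) * (y - eta x)\<^sup>2)"
    unfolding ph exp_diff by (simp add: exp_minus divide_inverse mult_ac)
  finally show ?thesis .
qed

lemma cheb_kernel_eq_phase: "cheb_kernel l (m + j) z = phase l m z * (cayley z ^ j / (1 + z)\<^sup>2)"
  by (simp add: cheb_kernel_def phase_def cayley_def power_add)

text \<open>The tail is summed under the integral sign, as a geometric series. Its value
  \<open>1 / (1 - \<bar>u\<bar>)\<close> is compensated by the factor \<open>1 / \<bar>1 + z\<bar>\<^sup>2\<close>, since
  \<open>1 - \<bar>u\<bar>\<^sup>2 = 4 x / \<bar>1 + z\<bar>\<^sup>2\<close>.\<close>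

lemma sum_norm_cayley_le: "(\<Sum>j<N. norm (cayley (vline x y) ^ j / (1 + vline x y)\<^sup>2)) \<le> 1 / (2 * x)"
proof -
  define u d where "u = norm (cayley (vline x y))" and "d = (cmod (1 + vline x y))\<^sup>2"
  have d: "d = (1 + x)\<^sup>2 + y\<^sup>2" "d > 0"
    using x_pos by (simp_all add: d_def cmod_square_vline add_pos_nonneg)
  have "1 - u\<^sup>2 = (d - ((1 - x)\<^sup>2 + y\<^sup>2)) / d"
    using d(2) unfolding u_def norm_cayley_vline d(1)[symmetric] by (simp add: diff_divide_distrib)
  also have "d - ((1 - x)\<^sup>2 + y\<^sup>2) = 4 * x"
    by (simp add: d(1) power2_eq_square algebra_simps)
  finally have u2: "(1 - u) * (1 + u) = 4 * x / d"
    by (simp add: power2_eq_square algebra_simps)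
  have u: "0 \<le> u" "u \<le> 1"
    using norm_cayley_le_1[of "vline x y"] x_pos by (simp_all add: u_def cayley_def)
  have "4 * x / d \<le> (1 - u) * 2"
    unfolding u2[symmetric] using u by (intro mult_left_mono) auto
  then have lb: "2 * x / d \<le> 1 - u"
    by simp
  have "(1 - u) * (\<Sum>j<N. u ^ j) = 1 - u ^ N"
    by (simp add: one_diff_power_eq)
  then have "2 * x / d * (\<Sum>j<N. u ^ j) \<le> 1"
    using mult_right_mono[OF lb, of "\<Sum>j<N. u ^ j"] u by (simp add: sum_nonneg) (smt (verit) zero_le_power)
  then have "(\<Sum>j<N. u ^ j) / d \<le> 1 / (2 * x)"
    using x_pos d(2) by (simp add: field_simps)
  moreover have "(\<Sum>j<N. norm (cayley (vline x y) ^ j / (1 + vline x y)\<^sup>2)) = (\<Sum>j<N. u ^ j) / d"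
    by (simp add: u_def d_def norm_divide norm_power sum_divide_distrib)
  ultimately show ?thesis
    by simp
qed

definition tail_bound :: real where
  "tail_bound = 2 / (pi * x) * peak l m x * sqrt (pi / (l * decay x))"

lemma sum_abs_cheb_coeff_le: "(\<Sum>j<N. \<bar>cheb_coeff l (Suc (m + j))\<bar>) \<le> tail_bound"
proof -
  let ?K = "\<lambda>j y. cheb_kernel l (m + j) (vline x y)"
  let ?g = "\<lambda>y. peak l m x / (2 * x) * exp (- (l * decay x) * (y - eta x)\<^sup>2)"
  have x0: "x \<ge> 0"
    using x_pos by simp
  have int: "integrable lborel (\<lambda>y. indicator {0..} y *\<^sub>R norm (?K j y))" for j
    by (rule integrable_mult_indicator) (use integrable_cheb_kernel[OF l_pos x0] in auto)
  have ld: "l * decay x > 0"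
    using l_pos decay_pos by simp
  have le: "(LINT y|lborel. (\<Sum>j<N. indicator {0..} y *\<^sub>R norm (?K j y))) \<le> (LINT y|lborel. ?g y)"
  proof (intro integral_mono Bochner_Integration.integrable_sum int integrable_mult_right
      gaussian_integral(1) ld)
    fix y :: real
    show "(\<Sum>j<N. indicator {0..} y *\<^sub>R norm (?K j y)) \<le> ?g y"
    proof (cases "y \<ge> 0")
      case True
      have "(\<Sum>j<N. indicator {0..} y *\<^sub>R norm (?K j y)) =
          norm (phase l m (vline x y)) * (\<Sum>j<N. norm (cayley (vline x y) ^ j / (1 + vline x y)\<^sup>2))"
        using True by (simp only: cheb_kernel_eq_phase norm_mult sum_distrib_left) simp
      also have "\<dots> \<le> (peak l m x * exp (- (l * decay x) * (y - eta x)\<^sup>2)) * (1 / (2 * x))"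
        using peak_pos by (intro mult_mono norm_phase_le sum_norm_cayley_le True sum_nonneg) auto
      finally show ?thesis
        by simp
    next
      case False
      then show ?thesis
        using peak_pos x_pos by simp
    qed
  qed
  have "\<bar>cheb_coeff l (Suc (m + j))\<bar> \<le> 4 / pi * (LINT y:{0..}|lborel. norm (?K j y))" for j
  proof -
    have "\<bar>Re (LINT y:{0..}|lborel. ?K j y)\<bar> \<le> norm (LINT y:{0..}|lborel. ?K j y)"
      by (rule abs_Re_le_cmod)
    also have "\<dots> \<le> (LINT y:{0..}|lborel. norm (?K j y))"
      unfolding set_lebesgue_integral_def by (rule order_trans[OF integral_norm_bound]) simp
    finally show ?thesis
      unfolding cheb_coeff_vline[OF l_pos x0] by (simp add: abs_mult divide_right_mono)
  qed
  then have "(\<Sum>j<N. \<bar>cheb_coeff l (Suc (m + j))\<bar>) \<le>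
      (\<Sum>j<N. 4 / pi * (LINT y:{0..}|lborel. norm (?K j y)))"
    by (intro sum_mono)
  also have "\<dots> = 4 / pi * (LINT y|lborel. (\<Sum>j<N. indicator {0..} y *\<^sub>R norm (?K j y)))"
    unfolding set_lebesgue_integral_def
    by (subst Bochner_Integration.integral_sum) (use int in \<open>simp_all add: sum_distrib_left\<close>)
  also have "\<dots> \<le> 4 / pi * (LINT y|lborel. ?g y)"
    using le by (intro mult_left_mono) auto
  also have "\<dots> = tail_bound"
    using gaussian_integral(2)[OF ld, of "eta x"] by (simp add: tail_bound_def)
  finally show ?thesis
    by simp
qed

lemma sup_error_le_tail_bound: "sup_error m l \<le> tail_bound"
proof -
  have s: "summable (\<lambda>j. \<bar>cheb_coeff l (Suc (m + j))\<bar>)"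
    by (rule summableI_nonneg_bounded[OF _ sum_abs_cheb_coeff_le]) simp
  have "sup_error m l \<le> (\<Sum>j. \<bar>cheb_coeff l (Suc (m + j))\<bar>)"
    using l_pos s by (rule sup_error_le_suminf)
  also have "\<dots> \<le> tail_bound"
    using s by (intro suminf_le_const sum_abs_cheb_coeff_le)
  finally show ?thesis .
qed

end

section \<open>The complex Gaussian integral\<close>

lemma complex_gaussian_integrable:
  assumes "Re K > 0"
  shows "integrable lborel (\<lambda>v. exp (- (K * (complex_of_real v)\<^sup>2)))"
proof (rule Bochner_Integration.integrable_bound)
  show "integrable lborel (\<lambda>v. exp (- Re K * (v - 0)\<^sup>2))"
    using assms by (rule gaussian_integral)
  have "continuous_on UNIV (\<lambda>v. exp (- (K * (complex_of_real v)\<^sup>2)))"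
    by (intro continuous_intros)
  then show "(\<lambda>v. exp (- (K * (complex_of_real v)\<^sup>2))) \<in> borel_measurable lborel"
    by (simp add: borel_measurable_continuous_onI)
  have "norm (exp (- (K * (complex_of_real v)\<^sup>2))) = exp (- Re K * v\<^sup>2)" for v
    by (simp flip: of_real_power)
  then show "AE v in lborel. norm (exp (- (K * (complex_of_real v)\<^sup>2))) \<le> norm (exp (- Re K * (v - 0)\<^sup>2))"
    by simp
qed

text \<open>For complex \<open>K\<close> the path of the real Gaussian integral is turned to the direction of
  \<open>csqrt K\<close>. Its endpoints move inside sectors where \<open>exp (- z\<^sup>2)\<close> decays.\<close>

lemma complex_gaussian_integral:
  assumes K: "Re K > 0"
  shows "csqrt K * (LINT v|lborel. exp (- (K * (complex_of_real v)\<^sup>2))) = of_real (sqrt pi)"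
proof -
  have "(\<lambda>z. exp (- z\<^sup>2)) holomorphic_on (UNIV :: complex set)"
    by (intro holomorphic_intros)
  then have "\<exists>\<Phi>. \<forall>z\<in>UNIV. (\<Phi> has_field_derivative exp (- z\<^sup>2)) (at (z :: complex) within UNIV)"
    by (rule holomorphic_convex_primitive'[OF convex_UNIV open_UNIV]) (intro exI ballI)
  then obtain \<Phi> where \<Phi>: "\<And>z :: complex. (\<Phi> has_field_derivative exp (- z\<^sup>2)) (at z)"
    by auto
  have lim: "(\<lambda>n. \<Phi> (w * real n) - \<Phi> (- (w * real n))) \<longlonglongrightarrow>
      w * (LINT v|lborel. exp (- (w\<^sup>2 * (complex_of_real v)\<^sup>2)))" if w: "Re (w\<^sup>2) > 0" for w
  proof -
    let ?g = "\<lambda>v. exp (- (w\<^sup>2 * (complex_of_real v)\<^sup>2))"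
    note int = complex_gaussian_integrable[OF w]
    have "(\<lambda>n. LINT v|lborel. indicator {- real n..real n} v *\<^sub>R ?g v) \<longlonglongrightarrow> (LINT v|lborel. ?g v)"
    proof (rule integral_dominated_convergence)
      show "integrable lborel (\<lambda>v. norm (?g v))"
        using int by (rule integrable_norm)
      have "(\<lambda>n. indicator {- real n..real n} v *\<^sub>R ?g v) \<longlonglongrightarrow> ?g v" for v
      proof (rule tendsto_eventually)
        have "\<forall>\<^sub>F n in sequentially. real n \<ge> \<bar>v\<bar>"
          using filterlim_real_sequentially by (simp add: filterlim_at_top)
        then show "\<forall>\<^sub>F n in sequentially. indicator {- real n..real n} v *\<^sub>R ?g v = ?g v"
          by (rule eventually_mono) (auto simp: indicator_def abs_le_iff)
      qed
      then show "AE v in lborel. (\<lambda>n. indicator {- real n..real n} v *\<^sub>R ?g v) \<longlonglongrightarrow> ?g v"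
        by simp
      show "?g \<in> borel_measurable lborel"
        using int by (rule borel_measurable_integrable)
      then show "(\<lambda>v. indicator {- real n..real n} v *\<^sub>R ?g v) \<in> borel_measurable lborel" for n
        by measurable
      show "AE v in lborel. norm (indicator {- real n..real n} v *\<^sub>R ?g v) \<le> norm (?g v)" for n
        by (auto simp: indicator_def)
    qed
    then have "(\<lambda>n. w * (LINT v|lborel. indicator {- real n..real n} v *\<^sub>R ?g v)) \<longlonglongrightarrow> w * (LINT v|lborel. ?g v)"
      by (rule tendsto_mult_left)
    moreover have "w * (LINT v|lborel. indicator {- R..R} v *\<^sub>R ?g v) = \<Phi> (w * R) - \<Phi> (- (w * R))"
      if "R \<ge> 0" for R :: real
    proof -
      have "((\<lambda>v. w * ?g v) has_integral \<Phi> (w * of_real R) - \<Phi> (w * of_real (- R))) {- R..R}"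
      proof (rule fundamental_theorem_of_calculus)
        fix v
        have "((\<lambda>v. w * of_real v) has_vector_derivative w * of_real 1) (at v within {- R..R})"
          by (intro derivative_intros)
        moreover have "(\<Phi> has_field_derivative exp (- (w * of_real v)\<^sup>2)) (at (w * of_real v) within (\<lambda>v. w * of_real v) ` {- R..R})"
          by (rule has_field_derivative_at_within[OF \<Phi>])
        ultimately have "(\<Phi> \<circ> (\<lambda>v. w * of_real v) has_vector_derivative w * of_real 1 * exp (- (w * of_real v)\<^sup>2))
            (at v within {- R..R})"
          by (rule field_vector_diff_chain_within)
        then show "((\<lambda>v. \<Phi> (w * of_real v)) has_vector_derivative w * ?g v) (at v within {- R..R})"
          by (simp add: o_def power_mult_distrib)
      qed (use that in simp)
      then have "integral {- R..R} (\<lambda>v. w * ?g v) = \<Phi> (w * of_real R) - \<Phi> (w * of_real (- R))"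
        by (rule integral_unique)
      moreover have "set_integrable lborel {- R..R} (\<lambda>v. w * ?g v)"
        unfolding set_integrable_def using int
        by (intro integrable_mult_indicator integrable_mult_right) auto
      then have "(LINT v:{- R..R}|lborel. w * ?g v) = integral {- R..R} (\<lambda>v. w * ?g v)"
        by (rule set_borel_integral_eq_integral(2))
      ultimately show ?thesis
        by (simp add: set_lebesgue_integral_def mult_scaleR_right[symmetric] del: mult_scaleR_right)
    qed
    ultimately show ?thesis
      by (simp only: of_nat_0_le_iff)
  qed
  define w where "w = csqrt K"
  have w: "w\<^sup>2 = K" "Re w \<ge> 0"
    using csqrt_principal[of K] by (auto simp: w_def)
  define c where "c = min 1 (Re K) / 2"
  have c: "c > 0"
    using K by (simp add: c_def)
  have turn: "(\<lambda>n. \<Phi> (s * (w * real n)) - \<Phi> (s * real n)) \<longlonglongrightarrow> 0" if s: "s\<^sup>2 = 1" "norm s = 1" for s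
  proof (rule Lim_null_comparison)
    show "(\<lambda>n. exp (- (c * (real n)\<^sup>2)) * (norm (w - 1) * real n)) \<longlonglongrightarrow> 0"
      using c by real_asymp
    have "norm (\<Phi> (s * (w * real n)) - \<Phi> (s * real n)) \<le> exp (- (c * (real n)\<^sup>2)) * (norm (w - 1) * real n)" for n
    proof -
      let ?S = "closed_segment (s * real n) (s * (w * real n))"
      have "norm (\<Phi> (s * (w * real n)) - \<Phi> (s * real n)) \<le>
          exp (- (c * (real n)\<^sup>2)) * norm (s * (w * real n) - s * real n)"
      proof (rule field_differentiable_bound[where S = ?S and f' = "\<lambda>z. exp (- z\<^sup>2)"])
        show "(\<Phi> has_field_derivative exp (- z\<^sup>2)) (at z within ?S)" for z
          by (rule has_field_derivative_at_within[OF \<Phi>])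
        fix z
        assume "z \<in> ?S"
        then obtain t where t: "0 \<le> t" "t \<le> 1" "z = (1 - t) *\<^sub>R (s * real n) + t *\<^sub>R (s * (w * real n))"
          by (auto simp: closed_segment_def)
        define p where "p = of_real (1 - t) + of_real t * w"
        have "z = s * (real n * p)"
          by (simp add: t(3) p_def scaleR_conv_of_real algebra_simps)
        then have "z\<^sup>2 = of_real ((real n)\<^sup>2) * p\<^sup>2"
          by (simp add: power_mult_distrib s)
        then have zp: "Re (z\<^sup>2) = (real n)\<^sup>2 * Re (p\<^sup>2)"
          by simp
        have "p\<^sup>2 = of_real ((1 - t)\<^sup>2) + of_real (2 * (1 - t) * t) * w + of_real (t\<^sup>2) * K"
          unfolding p_def w(1)[symmetric] by (simp add: power2_eq_square algebra_simps)
        then have p: "Re (p\<^sup>2) = (1 - t)\<^sup>2 + 2 * (1 - t) * t * Re w + t\<^sup>2 * Re K"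
          by simp
        have "1 \<le> 2 * ((1 - t)\<^sup>2 + t\<^sup>2)"
          using zero_le_power2[of "1 - 2 * t"] by (simp add: power2_eq_square algebra_simps)
        then have "c \<le> c * (2 * ((1 - t)\<^sup>2 + t\<^sup>2))"
          using c by (simp only: mult_le_cancel_left1) simp
        also have "\<dots> = (2 * c) * (1 - t)\<^sup>2 + (2 * c) * t\<^sup>2"
          by (simp add: algebra_simps)
        also have "\<dots> \<le> 1 * (1 - t)\<^sup>2 + Re K * t\<^sup>2"
          by (intro add_mono mult_right_mono) (auto simp: c_def)
        also have "\<dots> \<le> Re (p\<^sup>2)"
          using t w(2) unfolding p by simp
        finally have "c * (real n)\<^sup>2 \<le> Re (z\<^sup>2)"
          unfolding zp by (metis mult.commute mult_left_mono zero_le_power2)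
        then show "norm (exp (- z\<^sup>2)) \<le> exp (- (c * (real n)\<^sup>2))"
          by simp
      qed auto
      also have "norm (s * (w * real n) - s * real n) = norm (s * ((w - 1) * real n))"
        by (simp add: algebra_simps)
      also have "\<dots> = norm (w - 1) * real n"
        by (simp add: norm_mult s)
      finally show ?thesis .
    qed
    then show "\<forall>\<^sub>F n in sequentially. norm (\<Phi> (s * (w * real n)) - \<Phi> (s * real n)) \<le>
        exp (- (c * (real n)\<^sup>2)) * (norm (w - 1) * real n)"
      by (intro always_eventually allI)
  qed
  let ?n = "\<lambda>n. complex_of_real (real n)"
  have "(\<lambda>n. (\<Phi> (w * ?n n) - \<Phi> (- (w * ?n n))) -
      ((\<Phi> (1 * (w * ?n n)) - \<Phi> (1 * ?n n)) - (\<Phi> ((- 1) * (w * ?n n)) - \<Phi> ((- 1) * ?n n)))) \<longlonglongrightarrow>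
      w * (LINT v|lborel. exp (- (w\<^sup>2 * (complex_of_real v)\<^sup>2))) - (0 - 0)"
  proof (rule tendsto_diff[OF lim tendsto_diff[OF turn turn]])
    show "Re (w\<^sup>2) > 0"
      using K by (simp add: w)
  qed simp_all
  then have "(\<lambda>n. \<Phi> (?n n) - \<Phi> (- ?n n)) \<longlonglongrightarrow> w * (LINT v|lborel. exp (- (w\<^sup>2 * (complex_of_real v)\<^sup>2)))"
    by simp
  moreover have "(\<lambda>n. \<Phi> (1 * ?n n) - \<Phi> (- (1 * ?n n))) \<longlonglongrightarrow>
      1 * (LINT v|lborel. exp (- (1\<^sup>2 * (complex_of_real v)\<^sup>2)))"
    by (rule lim) simp
  then have "(\<lambda>n. \<Phi> (?n n) - \<Phi> (- ?n n)) \<longlonglongrightarrow> (LINT v|lborel. exp (- (1\<^sup>2 * (complex_of_real v)\<^sup>2)))"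
    by simp
  ultimately have "w * (LINT v|lborel. exp (- (w\<^sup>2 * (complex_of_real v)\<^sup>2))) =
      (LINT v|lborel. exp (- (1\<^sup>2 * (complex_of_real v)\<^sup>2)))"
    by (rule LIMSEQ_unique)
  also have "\<dots> = (LINT v|lborel. of_real (exp (- 1 * (v - 0)\<^sup>2)))"
    by (simp flip: exp_of_real)
  also have "\<dots> = of_real (sqrt pi)"
    by (subst integral_complex_of_real, subst gaussian_integral) simp_all
  finally show ?thesis
    by (simp add: w_def)
qed

section \<open>The phase near the saddle\<close>

context saddle_point
begin

lemma m_eq_complex: "of_nat m = of_real l * (saddle x - saddle x ^ 3)"
proof -
  have sq: "(saddle x)\<^sup>2 = of_real (1 - 2 * x\<^sup>2) + 2 * \<i> * of_real x * of_real (eta x)"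
    using eta_square by (simp add: complex_eq_iff power2_eq_square)
  have "saddle x - saddle x ^ 3 = saddle x * (1 - (saddle x)\<^sup>2)"
    by (simp add: power2_eq_square power3_eq_cube algebra_simps)
  also have "\<dots> = 2 * of_real x * (of_real (x\<^sup>2) + of_real ((eta x)\<^sup>2))"
    unfolding sq by (simp add: power2_eq_square algebra_simps)
  also have "\<dots> = of_real (8 * x ^ 3 - 2 * x)"
    unfolding eta_square by (simp add: power2_eq_square power3_eq_cube algebra_simps)
  finally have "of_real l * (saddle x - saddle x ^ 3) = of_real (real m)"
    by (simp add: m_eq)
  then show ?thesis
    by simp
qed

text \<open>The logarithmic derivative of \<open>phase\<close> is \<open>2 l z - 2 m / (1 - z\<^sup>2)\<close>; after \<open>m\<close> is
  expressed through the saddle, the factor \<open>z - saddle x\<close> splits off.\<close>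

lemma phase_deriv:
  assumes nz: "1 + z \<noteq> 0" "1 - z \<noteq> 0"
  shows "(phase l m has_field_derivative
    2 * of_real l * (z - saddle x) * ((z\<^sup>2 + z * saddle x + (saddle x)\<^sup>2 - 1) / (z\<^sup>2 - 1)) * phase l m z) (at z)"
proof -
  define \<zeta> where "\<zeta> = saddle x"
  have nz2: "1 - z\<^sup>2 \<noteq> 0" "z\<^sup>2 - 1 \<noteq> 0"
    using nz by (auto simp: power2_eq_square square_eq_1_iff eq_neg_iff_add_eq_0 add.commute)
  have c0: "cayley z \<noteq> 0"
    using nz by (simp add: cayley_def)
  have c: "(cayley has_field_derivative cayley z * (- 2 / (1 - z\<^sup>2))) (at z)"
  proof -
    have "(cayley has_field_derivative (- (1 + z) - (1 - z)) / ((1 + z) * (1 + z))) (at z)"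
      unfolding cayley_def[abs_def] using nz by (auto intro!: derivative_eq_intros)
    also have "(- (1 + z) - (1 - z)) / ((1 + z) * (1 + z)) = cayley z * (- 2 / ((1 - z) * (1 + z)))"
    proof -
      have "- 2 / (a * a) = b / a * (- 2 / (b * a))" if "b \<noteq> 0" for a b :: complex
        using that by simp
      from this[OF nz(2), of "1 + z"] show ?thesis
        by (simp add: cayley_def)
    qed
    also have "(1 - z) * (1 + z) = 1 - z\<^sup>2"
      by (simp add: power2_eq_square algebra_simps)
    finally show ?thesis .
  qed
  have cm: "of_nat m * cayley z ^ (m - 1) * cayley z = of_nat m * cayley z ^ m"
    by (cases m) simp_all
  have "(phase l m has_field_derivative
      exp (of_real l * z\<^sup>2) * (of_real l * (2 * z)) * cayley z ^ m +
      exp (of_real l * z\<^sup>2) * (of_nat m * cayley z ^ (m - 1) * (cayley z * (- 2 / (1 - z\<^sup>2))))) (at z)"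
    unfolding phase_def[abs_def] by (rule derivative_eq_intros c refl | simp)+
  also have "of_nat m * cayley z ^ (m - 1) * (cayley z * (- 2 / (1 - z\<^sup>2))) =
      of_nat m * cayley z ^ m * (- 2 / (1 - z\<^sup>2))"
    by (simp only: mult.assoc[symmetric] cm)
  also have "exp (of_real l * z\<^sup>2) * (of_real l * (2 * z)) * cayley z ^ m +
      exp (of_real l * z\<^sup>2) * (of_nat m * cayley z ^ m * (- 2 / (1 - z\<^sup>2))) =
      (of_real l * (2 * z) - 2 * of_nat m / (1 - z\<^sup>2)) * phase l m z"
    by (simp add: phase_def algebra_simps)
  also have "of_real l * (2 * z) - 2 * of_nat m / (1 - z\<^sup>2) =
      2 * of_real l * (z - \<zeta>) * ((z\<^sup>2 + z * \<zeta> + \<zeta>\<^sup>2 - 1) / (z\<^sup>2 - 1))"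
  proof -
    have "of_real l * (2 * z) - 2 * of_nat m / (1 - z\<^sup>2) =
        2 * of_real l * (z * (z\<^sup>2 - 1) + (\<zeta> - \<zeta> ^ 3)) / (z\<^sup>2 - 1)"
      using nz2 unfolding m_eq_complex \<zeta>_def[symmetric]
      by (simp add: divide_simps) (simp add: algebra_simps)
    also have "z * (z\<^sup>2 - 1) + (\<zeta> - \<zeta> ^ 3) = (z - \<zeta>) * (z\<^sup>2 + z * \<zeta> + \<zeta>\<^sup>2 - 1)"
      by (simp add: power2_eq_square power3_eq_cube algebra_simps)
    finally show ?thesis
      by (simp add: mult.assoc)
  qed
  finally show ?thesis
    unfolding \<zeta>_def .
qed

lemma cmod_one_plus_saddle_le:
  assumes y: "y \<ge> 0"
  shows "cmod (1 + saddle x) \<le> 2 * cmod (1 + vline x y)"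
proof (rule power2_le_imp_le)
  have "4 * x\<^sup>2 + 2 * x \<le> 4 * ((1 + x)\<^sup>2 + y\<^sup>2)"
    using x_pos by (simp add: power2_eq_square algebra_simps)
  then show "(cmod (1 + saddle x))\<^sup>2 \<le> (2 * cmod (1 + vline x y))\<^sup>2"
    unfolding cmod_one_plus_saddle unfolding power_mult_distrib cmod_square_vline by simp
qed simp

lemma x_le_cmod_one_plus_saddle: "2 * x \<le> cmod (1 + saddle x)"
proof (rule power2_le_imp_le)
  show "(2 * x)\<^sup>2 \<le> (cmod (1 + saddle x))\<^sup>2"
    unfolding cmod_one_plus_saddle using x_pos by (simp add: power2_eq_square)
qed simp

lemma Im_cayley_saddle: "Im (cayley (saddle x)) = - 2 * eta x / (4 * x\<^sup>2 + 2 * x)"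
  unfolding cayley_def Im_divide cmod_power2[symmetric] cmod_one_plus_saddle
  by (simp add: algebra_simps)

end

text \<open>Both regimes are treated at once: the saddle is measured by \<open>1 / x n\<close>, which tends to \<open>0\<close>
  when the saddle escapes to infinity and to a positive number when it stays bounded. The width
  \<open>1 / sqrt (l n)\<close> of the Gaussian is small compared with \<open>x n\<close>, the size of the saddle.\<close>

locale saddle_sequence =
  fixes l x :: "nat \<Rightarrow> real" and m :: "nat \<Rightarrow> nat" and \<tau> :: real
  assumes saddle_point: "\<And>n. saddle_point (l n) (x n) (m n)"
    and tau: "(\<lambda>n. 1 / x n) \<longlonglongrightarrow> \<tau>"
    and tau_less: "\<tau>\<^sup>2 < 3"
    and narrow: "filterlim (\<lambda>n. l n * (x n)\<^sup>2) at_top sequentially"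
begin

lemma l_pos: "l n > 0" and x_pos: "x n > 0" and eta_pos: "eta (x n) > 0"
  using saddle_point[of n, THEN saddle_point.l_pos] saddle_point[of n, THEN saddle_point.x_pos]
    saddle_point[of n, THEN saddle_point.eta_pos] by auto

abbreviation \<zeta> :: "nat \<Rightarrow> complex" where
  "\<zeta> n \<equiv> saddle (x n)"

text \<open>The line through the saddle in the scale of the Gaussian; on real \<open>v\<close> it is vertical. A complex
  argument allows the mean value inequality for holomorphic functions.\<close>

definition Z :: "nat \<Rightarrow> complex \<Rightarrow> complex" where
  "Z n v = \<zeta> n + \<i> * v / of_real (sqrt (l n))"

text \<open>\<open>\<sigma>\<close> and \<open>\<omega>\<close> are the limits of \<open>eta (x n) / x n\<close> and \<open>\<zeta> n / x n\<close>, and \<open>- 2 \<kappa>\<close> is the limit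
  of the second derivative of \<open>ln (phase_ratio n v)\<close> at \<open>v = 0\<close>, in the notation introduced below.\<close>

definition \<sigma> :: real where
  "\<sigma> = sqrt (3 - \<tau>\<^sup>2)"

definition \<omega> :: complex where
  "\<omega> = 1 + \<i> * of_real \<sigma>"

definition \<kappa> :: complex where
  "\<kappa> = (3 * \<omega>\<^sup>2 - (of_real \<tau>)\<^sup>2) / (\<omega>\<^sup>2 - (of_real \<tau>)\<^sup>2)"

lemma sigma: "\<sigma> > 0" "\<sigma>\<^sup>2 = 3 - \<tau>\<^sup>2"
  using tau_less by (simp_all add: \<sigma>_def)

lemma tau_nonneg: "\<tau> \<ge> 0"
  using tau by (rule LIMSEQ_le_const) (auto intro: exI[of _ 0] less_imp_le[OF x_pos])

lemma omega_square: "\<omega>\<^sup>2 = (of_real \<tau>)\<^sup>2 + (- 2 + 2 * \<i> * of_real \<sigma>)"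
  using sigma(2) by (simp add: \<omega>_def complex_eq_iff power2_eq_square)

lemma kappa_denom: "\<omega>\<^sup>2 - (of_real \<tau>)\<^sup>2 \<noteq> 0"
  by (simp add: omega_square complex_eq_iff)

lemma Re_kappa_pos: "Re \<kappa> > 0"
proof -
  have "3 * \<omega>\<^sup>2 - (of_real \<tau>)\<^sup>2 = of_real (- 2 * \<sigma>\<^sup>2) + 6 * \<i> * of_real \<sigma>"
    unfolding omega_square sigma(2) by (simp add: algebra_simps)
  then have "\<kappa> = (of_real (- 2 * \<sigma>\<^sup>2) + 6 * \<i> * of_real \<sigma>) / (- 2 + 2 * \<i> * of_real \<sigma>)"
    by (simp add: \<kappa>_def omega_square)
  then have "Re \<kappa> = (4 * \<sigma>\<^sup>2 + 12 * \<sigma>\<^sup>2) / (4 + 4 * \<sigma>\<^sup>2)"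
    by (simp add: Re_divide power2_eq_square)
  also have "\<dots> > 0"
    using sigma(1) by (simp add: add_pos_pos)
  finally show ?thesis .
qed

lemma eps_tendsto: "(\<lambda>n. 1 / (sqrt (l n) * x n)) \<longlonglongrightarrow> 0"
proof -
  have "filterlim (\<lambda>n. sqrt (l n * (x n)\<^sup>2)) at_top sequentially"
    by (rule filterlim_compose[OF sqrt_at_top narrow])
  then have "filterlim (\<lambda>n. sqrt (l n) * x n) at_top sequentially"
    using x_pos by (simp add: real_sqrt_mult less_imp_le)
  then show ?thesis
    using tendsto_inverse_0_at_top by (auto simp: inverse_eq_divide)
qed

lemma eta_over_x: "eta (x n) / x n = sqrt (3 - (1 / x n)\<^sup>2)"
proof -
  have "sqrt (3 - (1 / x n)\<^sup>2) = sqrt ((3 * (x n)\<^sup>2 - 1) / (x n)\<^sup>2)"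
    using x_pos[of n] by (simp add: field_simps)
  then show ?thesis
    using x_pos[of n] by (simp add: real_sqrt_divide eta_def)
qed

lemma eta_over_x_tendsto: "(\<lambda>n. eta (x n) / x n) \<longlonglongrightarrow> \<sigma>"
  unfolding eta_over_x \<sigma>_def by (intro tendsto_intros tau)

lemma eventually_eta_large: "\<forall>\<^sub>F n in sequentially. \<bar>v\<bar> < eta (x n) * sqrt (l n)"
proof -
  have "(\<lambda>n. (1 / (sqrt (l n) * x n)) / (eta (x n) / x n)) \<longlonglongrightarrow> 0 / \<sigma>"
    using sigma(1) by (intro tendsto_divide eps_tendsto eta_over_x_tendsto) auto
  then have "(\<lambda>n. \<bar>v\<bar> * ((1 / (sqrt (l n) * x n)) / (eta (x n) / x n))) \<longlonglongrightarrow> \<bar>v\<bar> * (0 / \<sigma>)"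
    by (intro tendsto_mult_left)
  then have "\<forall>\<^sub>F n in sequentially. \<bar>v\<bar> * ((1 / (sqrt (l n) * x n)) / (eta (x n) / x n)) < 1"
    by (rule order_tendstoD) simp
  then show ?thesis
  proof (rule eventually_mono)
    fix n
    assume *: "\<bar>v\<bar> * ((1 / (sqrt (l n) * x n)) / (eta (x n) / x n)) < 1"
    show "\<bar>v\<bar> < eta (x n) * sqrt (l n)"
      using * x_pos[of n] l_pos[of n] eta_pos[of n] by (simp add: field_simps)
  qed
qed

definition decay_limit :: real where
  "decay_limit = (3 - \<tau>\<^sup>2) / (4 + 2 * \<tau>)"

lemma decay_limit_pos: "decay_limit > 0"
  using tau_less tau_nonneg by (simp add: decay_limit_def)

lemma eventually_decay: "\<forall>\<^sub>F n in sequentially. decay_limit / 2 < decay (x n)"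
proof -
  have "decay (x n) = (3 - (1 / x n)\<^sup>2) / (4 + 2 * (1 / x n))" for n
  proof -
    have "(3 - (1 / x n)\<^sup>2) / (4 + 2 * (1 / x n)) =
        ((x n)\<^sup>2 * (3 - (1 / x n)\<^sup>2)) / ((x n)\<^sup>2 * (4 + 2 * (1 / x n)))"
      using x_pos[of n] by simp
    also have "(x n)\<^sup>2 * (3 - (1 / x n)\<^sup>2) = 3 * (x n)\<^sup>2 - 1"
      using x_pos[of n] by (simp add: field_simps)
    also have "(x n)\<^sup>2 * (4 + 2 * (1 / x n)) = 4 * (x n)\<^sup>2 + 2 * x n"
      using x_pos[of n] by (simp add: field_simps power2_eq_square)
    finally show ?thesis
      by (simp add: decay_def)
  qed
  moreover have "(\<lambda>n. (3 - (1 / x n)\<^sup>2) / (4 + 2 * (1 / x n))) \<longlonglongrightarrow> decay_limit"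
    unfolding decay_limit_def using tau_nonneg by (intro tendsto_intros tau) auto
  ultimately have "(\<lambda>n. decay (x n)) \<longlonglongrightarrow> decay_limit"
    by simp
  then show ?thesis
    using decay_limit_pos by (intro order_tendstoD) auto
qed

lemma Z_of_real: "Z n (of_real v) = vline (x n) (eta (x n) + v / sqrt (l n))"
  by (simp add: Z_def algebra_simps)

definition phase_ratio :: "nat \<Rightarrow> complex \<Rightarrow> complex" where
  "phase_ratio n v = phase (l n) (m n) (Z n v) / phase (l n) (m n) (\<zeta> n)"

lemma norm_phase_ratio_le:
  assumes "eta (x n) + v / sqrt (l n) \<ge> 0"
  shows "norm (phase_ratio n (of_real v)) \<le> exp (- decay (x n) * v\<^sup>2)"
proof -
  interpret saddle_point "l n" "x n" "m n"
    by (rule saddle_point)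
  have "norm (phase (l n) (m n) (Z n (of_real v))) \<le>
      peak (l n) (m n) (x n) * exp (- (l n * decay (x n)) * (v / sqrt (l n))\<^sup>2)"
    unfolding Z_of_real using norm_phase_le[OF assms] by simp
  also have "- (l n * decay (x n)) * (v / sqrt (l n))\<^sup>2 = - decay (x n) * v\<^sup>2"
    using l_pos by (simp add: power_divide)
  finally show ?thesis
    using peak_pos by (simp add: phase_ratio_def norm_divide peak_def divide_simps mult.commute)
qed

text \<open>The logarithmic derivative of \<open>phase_ratio\<close>, divided by \<open>- 2 v\<close>.\<close>

definition curvature :: "nat \<Rightarrow> complex \<Rightarrow> complex" where
  "curvature n v = ((Z n v)\<^sup>2 + Z n v * \<zeta> n + (\<zeta> n)\<^sup>2 - 1) / ((Z n v)\<^sup>2 - 1)"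

lemma phase_ratio_deriv:
  assumes v: "\<bar>v\<bar> < eta (x n) * sqrt (l n)"
  shows "(phase_ratio n has_field_derivative - 2 * of_real v * curvature n (of_real v) * phase_ratio n (of_real v))
    (at (of_real v))"
proof -
  interpret saddle_point "l n" "x n" "m n"
    by (rule saddle_point)
  let ?s = "of_real (sqrt (l n)) :: complex"
  have s: "?s \<noteq> 0" "?s\<^sup>2 = of_real (l n)"
    using l_pos by (simp_all flip: of_real_power)
  have "- v / sqrt (l n) < eta (x n)"
    using v l_pos by (simp add: divide_simps)
  then have "Im (Z n (of_real v)) \<noteq> 0"
    unfolding Z_of_real by simp
  then have "1 + Z n (of_real v) \<noteq> 0" "1 - Z n (of_real v) \<noteq> 0"
    by (auto simp: complex_eq_iff)
  note d = phase_deriv[OF this]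
  have "(Z n has_field_derivative \<i> / ?s) (at (of_real v))"
    unfolding Z_def[abs_def] using s by (auto intro!: derivative_eq_intros)
  from DERIV_cdivide[OF DERIV_chain2[OF d this]]
  have "(phase_ratio n has_field_derivative
      2 * of_real (l n) * (Z n (of_real v) - \<zeta> n) * curvature n (of_real v) *
      phase (l n) (m n) (Z n (of_real v)) * (\<i> / ?s) / phase (l n) (m n) (\<zeta> n)) (at (of_real v))"
    by (simp only: phase_ratio_def[abs_def] curvature_def)
  also have "Z n (of_real v) - \<zeta> n = \<i> * of_real v / ?s"
    by (simp add: Z_def)
  also have "2 * of_real (l n) * (\<i> * of_real v / ?s) * curvature n (of_real v) *
      phase (l n) (m n) (Z n (of_real v)) * (\<i> / ?s) / phase (l n) (m n) (\<zeta> n) =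
      - 2 * of_real v * curvature n (of_real v) * phase_ratio n (of_real v)"
    using s(1) unfolding s(2)[symmetric] phase_ratio_def by (simp add: power2_eq_square algebra_simps)
  finally show ?thesis .
qed

lemma curvature_tendsto:
  assumes "\<And>n. \<bar>r n\<bar> \<le> R"
  shows "(\<lambda>n. curvature n (of_real (r n))) \<longlonglongrightarrow> \<kappa>"
proof -
  define w t z where "w = (\<lambda>n. 1 + \<i> * complex_of_real (eta (x n) / x n))"
    and "t = (\<lambda>n. complex_of_real (1 / x n))"
    and "z = (\<lambda>n. 1 + \<i> * complex_of_real (eta (x n) / x n) +
          \<i> * of_real (1 / (sqrt (l n) * x n) * r n))"
  have "(\<lambda>n. 1 / (sqrt (l n) * x n) * r n) \<longlonglongrightarrow> 0"
  proof (rule Lim_null_comparison)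
    show "(\<lambda>n. 1 / (sqrt (l n) * x n) * R) \<longlonglongrightarrow> 0"
      by (intro tendsto_mult_left_zero eps_tendsto)
    have "norm (1 / (sqrt (l n) * x n) * r n) \<le> 1 / (sqrt (l n) * x n) * R" for n
      using assms[of n] x_pos[of n] l_pos[of n] by (simp add: abs_mult divide_right_mono)
    then show "\<forall>\<^sub>F n in sequentially. norm (1 / (sqrt (l n) * x n) * r n) \<le> 1 / (sqrt (l n) * x n) * R"
      by simp
  qed
  then have "z \<longlonglongrightarrow> 1 + \<i> * of_real \<sigma> + \<i> * of_real 0"
    unfolding z_def by (intro tendsto_intros eta_over_x_tendsto)
  then have z: "z \<longlonglongrightarrow> \<omega>"
    by (simp add: \<omega>_def)
  have w: "w \<longlonglongrightarrow> \<omega>"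
    unfolding w_def \<omega>_def by (intro tendsto_intros eta_over_x_tendsto)
  have t: "t \<longlonglongrightarrow> of_real \<tau>"
    unfolding t_def by (intro tendsto_intros tau)
  have "(\<lambda>n. ((z n)\<^sup>2 + z n * w n + (w n)\<^sup>2 - (t n)\<^sup>2) / ((z n)\<^sup>2 - (t n)\<^sup>2)) \<longlonglongrightarrow>
      (\<omega>\<^sup>2 + \<omega> * \<omega> + \<omega>\<^sup>2 - (of_real \<tau>)\<^sup>2) / (\<omega>\<^sup>2 - (of_real \<tau>)\<^sup>2)"
    by (intro tendsto_intros z w t kappa_denom)
  also have "(\<omega>\<^sup>2 + \<omega> * \<omega> + \<omega>\<^sup>2 - (of_real \<tau>)\<^sup>2) / (\<omega>\<^sup>2 - (of_real \<tau>)\<^sup>2) = \<kappa>"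
    by (simp add: \<kappa>_def power2_eq_square algebra_simps)
  also have "(\<lambda>n. ((z n)\<^sup>2 + z n * w n + (w n)\<^sup>2 - (t n)\<^sup>2) / ((z n)\<^sup>2 - (t n)\<^sup>2)) =
      (\<lambda>n. curvature n (of_real (r n)))"
  proof
    fix n
    let ?x = "complex_of_real (x n)"
    have x: "?x \<noteq> 0"
      using x_pos[of n] by simp
    have "Z n (of_real (r n)) = ?x * z n" "\<zeta> n = ?x * w n" "1 = ?x * t n"
      using x l_pos[of n] unfolding Z_def z_def w_def t_def by (simp_all add: field_simps)
    then have "curvature n (of_real (r n)) =
        ((?x * z n)\<^sup>2 + (?x * z n) * (?x * w n) + (?x * w n)\<^sup>2 - (?x * t n)\<^sup>2) / ((?x * z n)\<^sup>2 - (?x * t n)\<^sup>2)"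
      unfolding curvature_def by (metis power_one)
    also have "\<dots> = (?x\<^sup>2 * ((z n)\<^sup>2 + z n * w n + (w n)\<^sup>2 - (t n)\<^sup>2)) / (?x\<^sup>2 * ((z n)\<^sup>2 - (t n)\<^sup>2))"
      by (simp add: power2_eq_square algebra_simps)
    finally show "((z n)\<^sup>2 + z n * w n + (w n)\<^sup>2 - (t n)\<^sup>2) / ((z n)\<^sup>2 - (t n)\<^sup>2) = curvature n (of_real (r n))"
      using x by simp
  qed
  finally show ?thesis .
qed

text \<open>Uniformity in \<open>r\<close> follows by applying the limit to a sequence of worst points \<open>r n\<close>.\<close>

lemma curvature_uniform:
  assumes "e > 0"
  shows "\<forall>\<^sub>F n in sequentially. \<forall>r. \<bar>r\<bar> \<le> R \<longrightarrow> norm (curvature n (of_real r) - \<kappa>) < e"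
proof (cases "R \<ge> 0")
  case True
  define bad where "bad = (\<lambda>n r. \<bar>r\<bar> \<le> R \<and> \<not> norm (curvature n (of_real r) - \<kappa>) < e)"
  define r where "r = (\<lambda>n. if \<exists>r. bad n r then SOME r. bad n r else 0)"
  have r: "bad n (r n)" if "bad n q" for n q
    unfolding r_def using that someI[of "bad n" q] by auto
  have "\<bar>r n\<bar> \<le> R" for n
    using r[of n] True by (cases "\<exists>q. bad n q") (auto simp: bad_def r_def)
  then have "(\<lambda>n. curvature n (of_real (r n))) \<longlonglongrightarrow> \<kappa>"
    by (rule curvature_tendsto)
  then have "\<forall>\<^sub>F n in sequentially. norm (curvature n (of_real (r n)) - \<kappa>) < e"
    using assms by (simp add: tendsto_iff dist_norm)
  then show ?thesis
    by (rule eventually_mono) (use r in \<open>auto simp: bad_def\<close>)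
qed (auto simp: abs_le_iff intro!: always_eventually)

text \<open>The product of \<open>phase_ratio\<close> and \<open>exp (\<kappa> v\<^sup>2)\<close> is \<open>1\<close> at \<open>v = 0\<close> and has a derivative that
  tends to \<open>0\<close> uniformly on bounded sets.\<close>

lemma phase_ratio_tendsto: "(\<lambda>n. phase_ratio n (of_real v)) \<longlonglongrightarrow> exp (- (\<kappa> * (of_real v)\<^sup>2))"
proof -
  define M where "M = exp (norm \<kappa> * v\<^sup>2)"
  let ?Q = "\<lambda>n w. phase_ratio n w * exp (\<kappa> * w\<^sup>2)"
  have "(\<lambda>n. ?Q n (of_real v)) \<longlonglongrightarrow> 1"
  proof (rule tendstoI)
    fix e0 :: real
    assume "e0 > 0"
    define e where "e = e0 / (1 + 2 * \<bar>v\<bar> * M * \<bar>v\<bar>)"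
    have den: "1 + 2 * \<bar>v\<bar> * M * \<bar>v\<bar> > 0"
      by (simp add: M_def add_pos_nonneg)
    then have e: "e > 0" "2 * \<bar>v\<bar> * e * M * \<bar>v\<bar> < e0"
      using \<open>e0 > 0\<close> by (simp_all add: e_def divide_simps mult_ac distrib_left)
    show "\<forall>\<^sub>F n in sequentially. dist (?Q n (of_real v)) 1 < e0"
      using curvature_uniform[OF e(1), of "\<bar>v\<bar>"] eventually_eta_large[of v]
    proof eventually_elim
      case (elim n)
      interpret saddle_point "l n" "x n" "m n"
        by (rule saddle_point)
      let ?S = "closed_segment 0 (complex_of_real v)"
      have "norm (?Q n (of_real v) - ?Q n 0) \<le> (2 * \<bar>v\<bar> * e * M) * norm (of_real v - 0 :: complex)"
      proof (rule field_differentiable_bound[where S = ?S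
            and f' = "\<lambda>w. 2 * w * (\<kappa> - curvature n w) * ?Q n w"])
        fix w
        assume "w \<in> ?S"
        then obtain t where t: "0 \<le> t" "t \<le> 1" "w = of_real (t * v)"
          by (auto simp: closed_segment_def scaleR_conv_of_real)
        define r where "r = t * v"
        have r: "\<bar>r\<bar> \<le> \<bar>v\<bar>" and w: "w = of_real r"
          using t by (simp_all add: r_def abs_mult mult_left_le_one_le)
        have small: "\<bar>r\<bar> < eta (x n) * sqrt (l n)"
          using r elim(2) by linarith
        then have "- r / sqrt (l n) < eta (x n)"
          using l_pos by (simp add: divide_simps)
        then have y: "eta (x n) + r / sqrt (l n) \<ge> 0"
          by simp
        have d2: "((\<lambda>w. exp (\<kappa> * w\<^sup>2)) has_field_derivative exp (\<kappa> * w\<^sup>2) * (\<kappa> * (2 * w))) (at w)"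
          by (auto intro!: derivative_eq_intros)
        have "(?Q n has_field_derivative
            - 2 * w * curvature n w * phase_ratio n w * exp (\<kappa> * w\<^sup>2) +
            exp (\<kappa> * w\<^sup>2) * (\<kappa> * (2 * w)) * phase_ratio n w) (at w)"
          using DERIV_mult[OF phase_ratio_deriv[OF small, folded w] d2] by simp
        also have "- 2 * w * curvature n w * phase_ratio n w * exp (\<kappa> * w\<^sup>2) +
            exp (\<kappa> * w\<^sup>2) * (\<kappa> * (2 * w)) * phase_ratio n w = 2 * w * (\<kappa> - curvature n w) * ?Q n w"
          by (simp add: algebra_simps)
        finally show "(?Q n has_field_derivative 2 * w * (\<kappa> - curvature n w) * ?Q n w) (at w within ?S)"
          by (rule has_field_derivative_at_within)
        have "norm (phase_ratio n w) \<le> exp (- decay (x n) * r\<^sup>2)"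
          unfolding w using y by (rule norm_phase_ratio_le)
        also have "\<dots> \<le> 1"
          using decay_pos by simp
        finally have 1: "norm (phase_ratio n w) \<le> 1" .
        have "norm (exp (\<kappa> * w\<^sup>2)) \<le> exp (norm (\<kappa> * w\<^sup>2))"
          by (rule norm_exp)
        also have "\<dots> \<le> M"
          using r unfolding M_def w by (simp add: norm_mult norm_power mult_left_mono abs_le_square_iff)
        finally have 2: "norm (exp (\<kappa> * w\<^sup>2)) \<le> M" .
        have "norm (2 * w * (\<kappa> - curvature n w) * ?Q n w) =
            2 * \<bar>r\<bar> * norm (curvature n w - \<kappa>) * (norm (phase_ratio n w) * norm (exp (\<kappa> * w\<^sup>2)))"
          by (simp only: norm_mult norm_minus_commute[of \<kappa>]) (simp add: w)
        also have "\<dots> \<le> 2 * \<bar>v\<bar> * e * (1 * M)"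
          using r 1 2 elim(1)[rule_format, OF r] e(1) unfolding w[symmetric]
          by (intro mult_mono) (auto simp: M_def)
        finally show "norm (2 * w * (\<kappa> - curvature n w) * ?Q n w) \<le> 2 * \<bar>v\<bar> * e * M"
          by simp
      qed auto
      moreover have "?Q n 0 = 1"
        using phase_saddle_nonzero by (simp add: phase_ratio_def Z_def)
      ultimately show ?case
        using e(2) by (simp add: dist_norm)
    qed
  qed
  then have "(\<lambda>n. ?Q n (of_real v) * exp (- (\<kappa> * (of_real v)\<^sup>2))) \<longlonglongrightarrow> 1 * exp (- (\<kappa> * (of_real v)\<^sup>2))"
    by (intro tendsto_mult_right)
  then show ?thesis
    by (simp add: mult.assoc flip: exp_add)
qed

end

section \<open>Laplace's method and the lower bound\<close>

lemma continuous_on_phase_vline: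
  assumes "x \<ge> 0"
  shows "continuous_on A (\<lambda>y. phase l m (vline x y))"
proof -
  have "1 + vline x y \<noteq> 0" for y
    using assms by (auto simp: complex_eq_iff)
  then show ?thesis
    unfolding phase_def cayley_def by (intro continuous_intros) auto
qed

context saddle_sequence
begin

text \<open>Laplace's method on the half line: after the substitution \<open>y = eta + v / sqrt l\<close> the integrands
  converge pointwise to a complex Gaussian, and the global bound \<open>norm_phase_le\<close> is a dominating
  function that is the same for all large \<open>n\<close>.\<close>

lemma laplace_limit:
  assumes cont: "\<And>n. continuous_on UNIV (\<lambda>y. W n (vline (x n) y))"
    and bound: "\<forall>\<^sub>F n in sequentially. \<forall>y\<ge>0. norm (W n (vline (x n) y)) \<le> C"
    and lim: "\<And>v. (\<lambda>n. W n (Z n (of_real v))) \<longlonglongrightarrow> w"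
  shows "(\<lambda>n. of_real (sqrt (l n)) / phase (l n) (m n) (\<zeta> n) *
      (LINT y:{0..}|lborel. phase (l n) (m n) (vline (x n) y) * W n (vline (x n) y)))
    \<longlonglongrightarrow> w * (LINT v|lborel. exp (- (\<kappa> * (complex_of_real v)\<^sup>2)))"
proof -
  define h where "h = (\<lambda>n v. indicator {0..} (eta (x n) + v / sqrt (l n)) *\<^sub>R
      (phase_ratio n (of_real v) * W n (Z n (of_real v))))"
  have eq: "of_real (sqrt (l n)) / phase (l n) (m n) (\<zeta> n) *
      (LINT y:{0..}|lborel. phase (l n) (m n) (vline (x n) y) * W n (vline (x n) y)) =
      (LINT v|lborel. h n v)" for n
  proof -
    let ?f = "\<lambda>y. indicator {0..} y *\<^sub>R (phase (l n) (m n) (vline (x n) y) * W n (vline (x n) y))"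
    have s: "1 / sqrt (l n) \<noteq> 0"
      using l_pos[of n] by simp
    have "(LINT y|lborel. ?f y) = \<bar>1 / sqrt (l n)\<bar> *\<^sub>R (LINT v|lborel. ?f (eta (x n) + 1 / sqrt (l n) * v))"
      by (rule lborel_integral_real_affine[OF s])
    also have "(LINT v|lborel. ?f (eta (x n) + 1 / sqrt (l n) * v)) =
        (LINT v|lborel. phase (l n) (m n) (\<zeta> n) * h n v)"
      using saddle_point.phase_saddle_nonzero[OF saddle_point, of n]
      by (intro Bochner_Integration.integral_cong) (simp_all add: h_def phase_ratio_def Z_of_real)
    finally show ?thesis
      using saddle_point.phase_saddle_nonzero[OF saddle_point, of n] l_pos[of n]
      by (simp add: set_lebesgue_integral_def scaleR_conv_of_real)
  qed
  obtain N where N: "\<And>n. n \<ge> N \<Longrightarrow> (\<forall>y\<ge>0. norm (W n (vline (x n) y)) \<le> C) \<and> decay_limit / 2 < decay (x n)"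
    using eventually_conj[OF bound eventually_decay] unfolding eventually_sequentially by blast
  have "(\<lambda>n. LINT v|lborel. h (n + N) v) \<longlonglongrightarrow> (LINT v|lborel. w * exp (- (\<kappa> * (complex_of_real v)\<^sup>2)))"
  proof (rule integral_dominated_convergence)
    show "(\<lambda>v. w * exp (- (\<kappa> * (complex_of_real v)\<^sup>2))) \<in> borel_measurable lborel"
      by (intro borel_measurable_integrable integrable_mult_right complex_gaussian_integrable Re_kappa_pos)
    show "h (n + N) \<in> borel_measurable lborel" for n
    proof -
      let ?y = "\<lambda>v. eta (x (n + N)) + v / sqrt (l (n + N))"
      have cy: "continuous_on UNIV ?y"
        using l_pos[of "n + N"] by (intro continuous_intros) auto
      have "continuous_on UNIV (\<lambda>v. phase_ratio (n + N) (of_real v))"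
        unfolding phase_ratio_def Z_of_real
        using saddle_point.phase_saddle_nonzero[OF saddle_point, of "n + N"] x_pos[of "n + N"]
        by (intro continuous_intros continuous_on_compose2[OF continuous_on_phase_vline cy])
          (auto simp: less_imp_le)
      moreover have "continuous_on UNIV (\<lambda>v. W (n + N) (Z (n + N) (of_real v)))"
        unfolding Z_of_real by (rule continuous_on_compose2[OF cont cy]) simp
      ultimately have "continuous_on UNIV (\<lambda>v. phase_ratio (n + N) (of_real v) * W (n + N) (Z (n + N) (of_real v)))"
        by (rule continuous_on_mult)
      then have [measurable]: "(\<lambda>v. phase_ratio (n + N) (of_real v) * W (n + N) (Z (n + N) (of_real v))) \<in> borel_measurable borel"
        by (rule borel_measurable_continuous_onI)
      show ?thesis
        unfolding h_def by measurable
    qed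
    show "integrable lborel (\<lambda>v. C * exp (- (decay_limit / 2) * (v - 0)\<^sup>2))"
      using decay_limit_pos by (intro integrable_mult_right gaussian_integral) auto
    have "norm (h (n + N) v) \<le> C * exp (- (decay_limit / 2) * (v - 0)\<^sup>2)" for n v
    proof (cases "eta (x (n + N)) + v / sqrt (l (n + N)) \<ge> 0")
      case True
      have "norm (h (n + N) v) = norm (phase_ratio (n + N) (of_real v)) * norm (W (n + N) (Z (n + N) (of_real v)))"
        using True by (simp add: h_def norm_mult)
      also have "\<dots> \<le> exp (- decay (x (n + N)) * v\<^sup>2) * C"
        using True N[of "n + N"]
        by (intro mult_mono norm_phase_ratio_le) (auto simp: Z_of_real)
      also have "\<dots> \<le> exp (- (decay_limit / 2) * v\<^sup>2) * C"
      proof (intro mult_right_mono)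
        show "exp (- decay (x (n + N)) * v\<^sup>2) \<le> exp (- (decay_limit / 2) * v\<^sup>2)"
          using N[of "n + N"] mult_right_mono[of "decay_limit / 2" "decay (x (n + N))" "v\<^sup>2"] by simp
        show "0 \<le> C"
          using N[of "n + N"] norm_ge_zero order_trans order_refl le_add2 by metis
      qed
      finally show ?thesis
        by (simp add: mult.commute)
    next
      case False
      have "0 \<le> C"
        using N[of "n + N"] norm_ge_zero order_trans order_refl le_add2 by metis
      then show ?thesis
        using False by (simp add: h_def)
    qed
    then show "AE v in lborel. norm (h (n + N) v) \<le> C * exp (- (decay_limit / 2) * (v - 0)\<^sup>2)" for n
      by simp
    have "(\<lambda>n. h n v) \<longlonglongrightarrow> w * exp (- (\<kappa> * (complex_of_real v)\<^sup>2))" for v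
    proof -
      have "(\<lambda>n. phase_ratio n (of_real v) * W n (Z n (of_real v))) \<longlonglongrightarrow> exp (- (\<kappa> * (complex_of_real v)\<^sup>2)) * w"
        by (intro tendsto_mult phase_ratio_tendsto lim)
      moreover have "\<forall>\<^sub>F n in sequentially. phase_ratio n (of_real v) * W n (Z n (of_real v)) = h n v"
        using eventually_eta_large[of v]
      proof eventually_elim
        case (elim n)
        then have "- v / sqrt (l n) < eta (x n)"
          using l_pos[of n] by (simp add: divide_simps)
        then show ?case
          by (simp add: h_def)
      qed
      ultimately have "(\<lambda>n. h n v) \<longlonglongrightarrow> exp (- (\<kappa> * (complex_of_real v)\<^sup>2)) * w"
        by (rule Lim_transform_eventually)
      then show ?thesis
        by (simp add: mult.commute)
    qed
    then show "AE v in lborel. (\<lambda>n. h (n + N) v) \<longlonglongrightarrow> w * exp (- (\<kappa> * (complex_of_real v)\<^sup>2))"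
      by (intro always_eventually allI LIMSEQ_ignore_initial_segment)
  qed
  then have "(\<lambda>n. LINT v|lborel. h n v) \<longlonglongrightarrow> (LINT v|lborel. w * exp (- (\<kappa> * (complex_of_real v)\<^sup>2)))"
    by (rule LIMSEQ_offset)
  then show ?thesis
    unfolding eq by simp
qed

definition G :: complex where
  "G = (LINT v|lborel. exp (- (\<kappa> * (complex_of_real v)\<^sup>2)))"

lemma G_nonzero: "G \<noteq> 0"
  using complex_gaussian_integral[OF Re_kappa_pos] by (auto simp: G_def)

definition weight :: "nat \<Rightarrow> complex \<Rightarrow> complex" where
  "weight n z = ((1 + \<zeta> n) / (1 + z))\<^sup>2"

text \<open>The real combination of neighbouring coefficients that belongs to this weight is shifted in
  phase by a quarter turn: the weight is \<open>\<i>\<close> at the saddle.\<close>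

definition quarter_turn :: "nat \<Rightarrow> complex \<Rightarrow> complex" where
  "quarter_turn n z = (cayley z - of_real (Re (cayley (\<zeta> n)))) / of_real (Im (cayley (\<zeta> n)))"

lemma Im_cayley_nonzero: "Im (cayley (\<zeta> n)) \<noteq> 0"
  using x_pos[of n] eta_pos[of n] saddle_point.Im_cayley_saddle[OF saddle_point, of n]
  by (auto simp: add_pos_pos add_nonneg_eq_0_iff)

lemma quarter_turn_eq:
  assumes "1 + z \<noteq> 0"
  shows "quarter_turn n z = \<i> + 2 * (\<zeta> n - z) / ((1 + z) * (1 + \<zeta> n)) / of_real (Im (cayley (\<zeta> n)))"
proof -
  have nz: "1 + \<zeta> n \<noteq> 0"
    using x_pos[of n] by (auto simp: complex_eq_iff)
  have "cayley z = cayley (\<zeta> n) + 2 * (\<zeta> n - z) / ((1 + z) * (1 + \<zeta> n))"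
    using assms nz by (simp add: cayley_def divide_simps) (simp add: algebra_simps)
  moreover have "cayley (\<zeta> n) - of_real (Re (cayley (\<zeta> n))) = \<i> * of_real (Im (cayley (\<zeta> n)))"
    by (simp add: complex_eq_iff)
  ultimately have "cayley z - of_real (Re (cayley (\<zeta> n))) =
      \<i> * of_real (Im (cayley (\<zeta> n))) + 2 * (\<zeta> n - z) / ((1 + z) * (1 + \<zeta> n))"
    by (simp add: algebra_simps)
  then show ?thesis
    using Im_cayley_nonzero[of n] by (simp add: quarter_turn_def add_divide_distrib)
qed

lemma norm_quarter_turn_diff:
  assumes "y \<ge> 0"
  shows "norm (quarter_turn n (vline (x n) y) - \<i>) =
    norm (\<zeta> n - vline (x n) y) * cmod (1 + \<zeta> n) / (cmod (1 + vline (x n) y) * eta (x n))"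
proof -
  interpret saddle_point "l n" "x n" "m n"
    by (rule saddle_point)
  have nz: "1 + vline (x n) y \<noteq> 0"
    using x_pos by (auto simp: complex_eq_iff)
  have "\<bar>Im (cayley (\<zeta> n))\<bar> = 2 * eta (x n) / (cmod (1 + \<zeta> n))\<^sup>2"
    unfolding Im_cayley_saddle cmod_one_plus_saddle using x_pos eta_pos by (simp add: abs_mult)
  moreover define d where "d = norm (\<zeta> n - vline (x n) y)"
  have "norm (quarter_turn n (vline (x n) y) - \<i>) =
      2 * d / (cmod (1 + vline (x n) y) * cmod (1 + \<zeta> n)) / \<bar>Im (cayley (\<zeta> n))\<bar>"
    unfolding quarter_turn_eq[OF nz] add_diff_cancel_left' norm_divide norm_mult norm_of_real d_def
    by (simp only: norm_numeral)
  moreover have "2 * d / (b * a) / (2 * eta (x n) / a\<^sup>2) = d * a / (b * eta (x n))" if "a > 0" for a b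
    using that eta_pos by (simp add: power2_eq_square)
  moreover have "cmod (1 + \<zeta> n) > 0"
    using x_le_cmod_one_plus_saddle x_pos by linarith
  ultimately show ?thesis
    unfolding d_def by simp
qed

lemma one_plus_zeta_nonzero: "1 + \<zeta> n \<noteq> 0"
  using x_pos[of n] by (auto simp: complex_eq_iff)

lemma norm_weight_le: "y \<ge> 0 \<Longrightarrow> norm (weight n (vline (x n) y)) \<le> 4"
proof -
  assume y: "y \<ge> 0"
  have "cmod (1 + vline (x n) y) > 0"
    using x_pos[of n] by (auto simp: complex_eq_iff)
  then have "cmod ((1 + \<zeta> n) / (1 + vline (x n) y)) \<le> 2"
    using saddle_point.cmod_one_plus_saddle_le[OF saddle_point, of y n] y
    by (simp add: norm_divide divide_le_eq)
  then have "(cmod ((1 + \<zeta> n) / (1 + vline (x n) y)))\<^sup>2 \<le> 2\<^sup>2"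
    by (intro power_mono) auto
  then show ?thesis
    by (simp add: weight_def norm_power)
qed

lemma eventually_norm_quarter_turn_le:
  "\<forall>\<^sub>F n in sequentially. \<forall>y\<ge>0. norm (quarter_turn n (vline (x n) y)) \<le> 1 + 3 / sqrt (decay_limit / 2)"
  using eventually_decay
proof eventually_elim
  case (elim n)
  interpret saddle_point "l n" "x n" "m n"
    by (rule saddle_point)
  show ?case
  proof (intro allI impI)
    fix y :: real
    assume y: "y \<ge> 0"
    let ?a = "cmod (1 + \<zeta> n)" and ?b = "cmod (1 + vline (x n) y)"
    have b: "?b > 0"
      using x_pos by (auto simp: complex_eq_iff)
    have "norm (\<zeta> n - vline (x n) y) = norm ((1 + \<zeta> n) - (1 + vline (x n) y))"
      by simp
    also have "\<dots> \<le> ?a + ?b"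
      by (rule norm_triangle_ineq4)
    also have "\<dots> \<le> 3 * ?b"
      using cmod_one_plus_saddle_le[OF y] by simp
    finally have 1: "norm (\<zeta> n - vline (x n) y) / ?b \<le> 3"
      using b by (simp add: divide_le_eq)
    have 2: "?a / eta (x n) \<le> 1 / sqrt (decay_limit / 2)"
    proof (rule power2_le_imp_le)
      have "(?a / eta (x n))\<^sup>2 = 1 / decay (x n)"
        by (simp add: power_divide eta_square decay_def cmod_one_plus_saddle)
      also have "\<dots> \<le> 1 / (decay_limit / 2)"
        using elim decay_limit_pos by (intro divide_left_mono) auto
      also have "\<dots> = (1 / sqrt (decay_limit / 2))\<^sup>2"
        using decay_limit_pos by (simp add: power_divide)
      finally show "(?a / eta (x n))\<^sup>2 \<le> (1 / sqrt (decay_limit / 2))\<^sup>2" .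
    qed (use decay_limit_pos in simp)
    have "norm (quarter_turn n (vline (x n) y) - \<i>) =
        (norm (\<zeta> n - vline (x n) y) / ?b) * (?a / eta (x n))"
      unfolding norm_quarter_turn_diff[OF y] by simp
    also have "\<dots> \<le> 3 * (1 / sqrt (decay_limit / 2))"
      using eta_pos by (intro mult_mono 1 2) (auto simp: less_imp_le)
    finally show "norm (quarter_turn n (vline (x n) y)) \<le> 1 + 3 / sqrt (decay_limit / 2)"
      using norm_triangle_ineq[of "quarter_turn n (vline (x n) y) - \<i>" \<i>] by simp
  qed
qed

lemma shift_tendsto: "(\<lambda>n. \<bar>v\<bar> / (sqrt (l n) * x n)) \<longlonglongrightarrow> 0"
  using tendsto_mult_left[OF eps_tendsto, of "\<bar>v\<bar>"] by simp

lemma weight_tendsto: "(\<lambda>n. weight n (Z n (of_real v))) \<longlonglongrightarrow> 1"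
proof -
  have "(\<lambda>n. (1 + Z n (of_real v)) / (1 + \<zeta> n) - 1) \<longlonglongrightarrow> 0"
  proof (rule Lim_null_comparison[OF always_eventually shift_tendsto[of v]], rule allI)
    fix n
    interpret saddle_point "l n" "x n" "m n"
      by (rule saddle_point)
    have "(1 + Z n (of_real v)) / (1 + \<zeta> n) - 1 = (\<i> * of_real v / of_real (sqrt (l n))) / (1 + \<zeta> n)"
      using one_plus_zeta_nonzero[of n] by (simp add: Z_def divide_simps)
    then have "norm ((1 + Z n (of_real v)) / (1 + \<zeta> n) - 1) = \<bar>v\<bar> / (sqrt (l n) * cmod (1 + \<zeta> n))"
      using l_pos by (simp add: norm_divide norm_mult)
    also have "\<dots> \<le> \<bar>v\<bar> / (sqrt (l n) * x n)"
      using x_le_cmod_one_plus_saddle x_pos l_pos by (intro divide_left_mono mult_left_mono mult_pos_pos) auto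
    finally show "norm ((1 + Z n (of_real v)) / (1 + \<zeta> n) - 1) \<le> \<bar>v\<bar> / (sqrt (l n) * x n)" .
  qed
  from tendsto_add[OF this tendsto_const[of 1]]
  have "(\<lambda>n. (1 + Z n (of_real v)) / (1 + \<zeta> n)) \<longlonglongrightarrow> 1"
    by simp
  from tendsto_power[OF tendsto_inverse[OF this], of 2] show ?thesis
    by (simp add: weight_def inverse_eq_divide)
qed

lemma quarter_turn_tendsto: "(\<lambda>n. quarter_turn n (Z n (of_real v))) \<longlonglongrightarrow> \<i>"
proof -
  have "(\<lambda>n. 2 * (\<bar>v\<bar> / (sqrt (l n) * x n)) / (eta (x n) / x n)) \<longlonglongrightarrow> 2 * 0 / \<sigma>"
    using sigma(1) by (intro tendsto_intros shift_tendsto eta_over_x_tendsto) auto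
  then have lim: "(\<lambda>n. 2 * (\<bar>v\<bar> / (sqrt (l n) * x n)) / (eta (x n) / x n)) \<longlonglongrightarrow> 0"
    by simp
  have "(\<lambda>n. quarter_turn n (Z n (of_real v)) - \<i>) \<longlonglongrightarrow> 0"
  proof (rule Lim_null_comparison[OF _ lim])
    show "\<forall>\<^sub>F n in sequentially. norm (quarter_turn n (Z n (of_real v)) - \<i>) \<le>
        2 * (\<bar>v\<bar> / (sqrt (l n) * x n)) / (eta (x n) / x n)"
      using eventually_eta_large[of v]
    proof eventually_elim
      case (elim n)
      interpret saddle_point "l n" "x n" "m n"
        by (rule saddle_point)
      have "- v / sqrt (l n) < eta (x n)"
        using elim l_pos by (simp add: divide_simps)
      then have y: "eta (x n) + v / sqrt (l n) \<ge> 0"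
        by simp
      let ?b = "cmod (1 + Z n (of_real v))"
      have b: "?b > 0"
        unfolding Z_of_real using x_pos by (auto simp: complex_eq_iff)
      have "norm (quarter_turn n (Z n (of_real v)) - \<i>) =
          norm (\<zeta> n - Z n (of_real v)) * cmod (1 + \<zeta> n) / (?b * eta (x n))"
        unfolding Z_of_real by (rule norm_quarter_turn_diff[OF y])
      also have "norm (\<zeta> n - Z n (of_real v)) = \<bar>v\<bar> / sqrt (l n)"
        using l_pos by (simp add: Z_def norm_divide norm_mult)
      also have "\<bar>v\<bar> / sqrt (l n) * cmod (1 + \<zeta> n) / (?b * eta (x n)) \<le>
          \<bar>v\<bar> / sqrt (l n) * (2 * ?b) / (?b * eta (x n))"
        using cmod_one_plus_saddle_le[OF y] eta_pos b l_pos unfolding Z_of_real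
        by (intro divide_right_mono mult_left_mono) auto
      also have "\<dots> = 2 * (\<bar>v\<bar> / (sqrt (l n) * x n)) / (eta (x n) / x n)"
        using x_pos b by simp
      finally show ?case .
    qed
  qed
  from tendsto_add[OF this tendsto_const[of \<i>]] show ?thesis
    by simp
qed

lemma continuous_on_weight: "continuous_on UNIV (\<lambda>y. weight n (vline (x n) y))"
proof -
  have "1 + vline (x n) y \<noteq> 0" for y
    using x_pos[of n] by (auto simp: complex_eq_iff)
  then show ?thesis
    unfolding weight_def by (intro continuous_intros) auto
qed

lemma continuous_on_quarter_turn: "continuous_on UNIV (\<lambda>y. quarter_turn n (vline (x n) y))"
proof -
  have "1 + vline (x n) y \<noteq> 0" for y
    using x_pos[of n] by (auto simp: complex_eq_iff)
  then have "continuous_on UNIV (\<lambda>y. cayley (vline (x n) y))"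
    unfolding cayley_def by (intro continuous_intros) auto
  moreover have "complex_of_real (Im (cayley (\<zeta> n))) \<noteq> 0"
    using Im_cayley_nonzero[of n] of_real_eq_0_iff by blast
  ultimately show ?thesis
    unfolding quarter_turn_def by (intro continuous_intros ballI)
qed

text \<open>The value of the kernel at the saddle times the width of the Gaussian.\<close>

definition amplitude :: "nat \<Rightarrow> complex" where
  "amplitude n = phase (l n) (m n) (\<zeta> n) / (of_real (sqrt (l n)) * (1 + \<zeta> n)\<^sup>2)"

lemma amplitude_nonzero: "amplitude n \<noteq> 0"
  using saddle_point.phase_saddle_nonzero[OF saddle_point, of n] l_pos[of n] one_plus_zeta_nonzero[of n]
  by (simp add: amplitude_def)

lemma norm_amplitude:
  "norm (amplitude n) = peak (l n) (m n) (x n) / (sqrt (l n) * (4 * (x n)\<^sup>2 + 2 * x n))"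
  using l_pos[of n] saddle_point.cmod_one_plus_saddle[OF saddle_point, of n]
  by (simp add: amplitude_def peak_def norm_divide norm_mult norm_power)

definition kernel_integral :: "nat \<Rightarrow> nat \<Rightarrow> complex" where
  "kernel_integral n j = (LINT y:{0..}|lborel. cheb_kernel (l n) (m n + j) (vline (x n) y))"

lemma cheb_coeff_eq: "cheb_coeff (l n) (Suc (m n + j)) = 4 / pi * Re (kernel_integral n j)"
  unfolding kernel_integral_def using l_pos[of n] x_pos[of n] by (intro cheb_coeff_vline) auto

lemma kernel_integral_limit: "(\<lambda>n. kernel_integral n 0 / amplitude n) \<longlonglongrightarrow> G"
proof -
  have "(\<lambda>n. of_real (sqrt (l n)) / phase (l n) (m n) (\<zeta> n) *
      (LINT y:{0..}|lborel. phase (l n) (m n) (vline (x n) y) * weight n (vline (x n) y))) \<longlonglongrightarrow> 1 * G"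
    unfolding G_def
    by (rule laplace_limit[of weight 4])
      (auto intro!: always_eventually continuous_on_weight weight_tendsto norm_weight_le)
  moreover have "of_real (sqrt (l n)) / phase (l n) (m n) (\<zeta> n) *
      (LINT y:{0..}|lborel. phase (l n) (m n) (vline (x n) y) * weight n (vline (x n) y)) =
      kernel_integral n 0 / amplitude n" for n
  proof -
    have "phase (l n) (m n) z * weight n z = (1 + \<zeta> n)\<^sup>2 * cheb_kernel (l n) (m n + 0) z" for z
      unfolding saddle_point.cheb_kernel_eq_phase[OF saddle_point] by (simp add: weight_def power_divide)
    then show ?thesis
      by (simp add: kernel_integral_def amplitude_def)
  qed
  ultimately show ?thesis
    by simp
qed

lemma kernel_integral_limit_quarter_turn:
  "(\<lambda>n. (kernel_integral n 1 - of_real (Re (cayley (\<zeta> n))) * kernel_integral n 0) /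
      of_real (Im (cayley (\<zeta> n))) / amplitude n) \<longlonglongrightarrow> \<i> * G"
proof -
  let ?W = "\<lambda>n z. weight n z * quarter_turn n z"
  have "(\<lambda>n. of_real (sqrt (l n)) / phase (l n) (m n) (\<zeta> n) *
      (LINT y:{0..}|lborel. phase (l n) (m n) (vline (x n) y) * ?W n (vline (x n) y))) \<longlonglongrightarrow> \<i> * G"
    unfolding G_def
  proof (rule laplace_limit[of ?W "4 * (1 + 3 / sqrt (decay_limit / 2))"])
    show "continuous_on UNIV (\<lambda>y. ?W n (vline (x n) y))" for n
      by (intro continuous_on_mult continuous_on_weight continuous_on_quarter_turn)
    show "\<forall>\<^sub>F n in sequentially. \<forall>y\<ge>0. norm (?W n (vline (x n) y)) \<le> 4 * (1 + 3 / sqrt (decay_limit / 2))"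
      using eventually_norm_quarter_turn_le
    proof eventually_elim
      case (elim n)
      show ?case
      proof (intro allI impI)
        fix y :: real
        assume "y \<ge> 0"
        with elim show "norm (?W n (vline (x n) y)) \<le> 4 * (1 + 3 / sqrt (decay_limit / 2))"
          unfolding norm_mult by (intro mult_mono norm_weight_le) auto
      qed
    qed
    show "(\<lambda>n. ?W n (Z n (of_real v))) \<longlonglongrightarrow> \<i>" for v
      using tendsto_mult[OF weight_tendsto quarter_turn_tendsto] by simp
  qed
  moreover have "of_real (sqrt (l n)) / phase (l n) (m n) (\<zeta> n) *
      (LINT y:{0..}|lborel. phase (l n) (m n) (vline (x n) y) * ?W n (vline (x n) y)) =
      (kernel_integral n 1 - of_real (Re (cayley (\<zeta> n))) * kernel_integral n 0) /
      of_real (Im (cayley (\<zeta> n))) / amplitude n" for n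
  proof -
    let ?p = "complex_of_real (Re (cayley (\<zeta> n)))" and ?q = "complex_of_real (Im (cayley (\<zeta> n)))"
    let ?K = "\<lambda>j y. cheb_kernel (l n) (m n + j) (vline (x n) y)"
    have "phase (l n) (m n) z * ?W n z = (1 + \<zeta> n)\<^sup>2 / ?q *
        (cheb_kernel (l n) (m n + 1) z - ?p * cheb_kernel (l n) (m n + 0) z)" for z
    proof -
      have "f * ((w / b)\<^sup>2 * ((c - p) / q)) = w\<^sup>2 / q * (f * (c ^ 1 / b\<^sup>2) - p * (f * (c ^ 0 / b\<^sup>2)))"
        for f w b c p q :: complex
        by (simp add: power_divide) (simp add: divide_inverse algebra_simps)
      then show ?thesis
        unfolding saddle_point.cheb_kernel_eq_phase[OF saddle_point] weight_def quarter_turn_def .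
    qed
    then have "(LINT y:{0..}|lborel. phase (l n) (m n) (vline (x n) y) * ?W n (vline (x n) y)) =
        (1 + \<zeta> n)\<^sup>2 / ?q * (LINT y:{0..}|lborel. ?K 1 y - ?p * ?K 0 y)"
      by (simp only: set_integral_mult_right)
    also have "(LINT y:{0..}|lborel. ?K 1 y - ?p * ?K 0 y) = kernel_integral n 1 - ?p * kernel_integral n 0"
    proof -
      have si: "set_integrable lborel {0..} (?K j)" for j
        using l_pos[of n] x_pos[of n] by (intro set_integrable_cheb_kernel) auto
      have "(LINT y:{0..}|lborel. ?K 1 y - ?p * ?K 0 y) =
          (LINT y:{0..}|lborel. ?K 1 y) - (LINT y:{0..}|lborel. ?p * ?K 0 y)"
        by (rule set_integral_diff(2)[OF si set_integrable_mult_right[OF si]])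
      then show ?thesis
        unfolding kernel_integral_def by (simp only: set_integral_mult_right)
    qed
    finally show ?thesis
      by (simp add: amplitude_def mult_ac)
  qed
  ultimately show ?thesis
    by simp
qed

text \<open>The two limits have phases that differ by a right angle, so the two real parts cannot be small
  at the same time, whatever the phase of the amplitude.\<close>

theorem cheb_coeff_lower_bound:
  "\<exists>c>0. \<forall>\<^sub>F n in sequentially. \<exists>k>m n.
    c * (peak (l n) (m n) (x n) / (sqrt (l n) * x n ^ 3)) \<le> \<bar>cheb_coeff (l n) k\<bar>"
proof -
  define c where "c = norm G / (4 * pi * (2 + 16 / \<sigma>))"
  have G: "norm G > 0"
    using G_nonzero by simp
  have c: "c > 0"
    using G sigma(1) by (simp add: c_def add_pos_pos)
  define X where "X = (\<lambda>n. kernel_integral n 0 / amplitude n)"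
  define Y where "Y = (\<lambda>n. (kernel_integral n 1 - of_real (Re (cayley (\<zeta> n))) * kernel_integral n 0) /
      of_real (Im (cayley (\<zeta> n))) / amplitude n)"
  have "\<forall>\<^sub>F n in sequentially. dist (X n) G < norm G / 4"
    unfolding X_def by (rule tendstoD[OF kernel_integral_limit]) (use G in simp)
  moreover have "\<forall>\<^sub>F n in sequentially. dist (Y n) (\<i> * G) < norm G / 4"
    unfolding Y_def by (rule tendstoD[OF kernel_integral_limit_quarter_turn]) (use G in simp)
  moreover have "\<forall>\<^sub>F n in sequentially. \<sigma> / 2 < eta (x n) / x n"
    by (rule order_tendstoD[OF eta_over_x_tendsto]) (use sigma in simp)
  ultimately have "\<forall>\<^sub>F n in sequentially. \<exists>k>m n.
      c * (peak (l n) (m n) (x n) / (sqrt (l n) * x n ^ 3)) \<le> \<bar>cheb_coeff (l n) k\<bar>"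
  proof eventually_elim
    case (elim n)
    interpret saddle_point "l n" "x n" "m n"
      by (rule saddle_point)
    define A p q where "A = amplitude n" and "p = Re (cayley (\<zeta> n))" and "q = Im (cayley (\<zeta> n))"
    define a1 a2 where "a1 = \<bar>cheb_coeff (l n) (Suc (m n))\<bar>" and "a2 = \<bar>cheb_coeff (l n) (Suc (m n + 1))\<bar>"
    define M where "M = max a1 a2"
    have A: "A \<noteq> 0"
      by (simp add: A_def amplitude_nonzero)
    have AX: "A * X n = kernel_integral n 0"
      using A by (simp add: X_def A_def)
    have AY: "A * Y n = (kernel_integral n 1 - of_real p * kernel_integral n 0) / of_real q"
      using A by (simp add: Y_def A_def p_def q_def)
    have a1: "\<bar>Re (kernel_integral n 0)\<bar> = pi / 4 * a1"
      using cheb_coeff_eq[of n 0] by (simp add: a1_def abs_mult)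
    have a2: "\<bar>Re (kernel_integral n 1)\<bar> = pi / 4 * a2"
      using cheb_coeff_eq[of n 1] by (simp add: a2_def abs_mult)
    have M: "a1 \<le> M" "a2 \<le> M" "0 \<le> M"
      by (auto simp: M_def a1_def)
    have p: "\<bar>p\<bar> \<le> 1"
      using abs_Re_le_cmod[of "cayley (\<zeta> n)"] norm_cayley_le_1[of "\<zeta> n"] x_pos
      by (simp add: p_def cayley_def)
    have "\<bar>Re (A * X n)\<bar> \<le> pi / 4 * M"
      using M by (simp add: AX a1)
    moreover have "\<bar>Re (A * Y n)\<bar> \<le> pi / 4 * (2 * M) / \<bar>q\<bar>"
    proof -
      have "\<bar>Re (A * Y n)\<bar> = \<bar>Re (kernel_integral n 1) - p * Re (kernel_integral n 0)\<bar> / \<bar>q\<bar>"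
        by (simp add: AY Re_divide_of_real)
      also have "\<bar>Re (kernel_integral n 1) - p * Re (kernel_integral n 0)\<bar> \<le>
          \<bar>Re (kernel_integral n 1)\<bar> + \<bar>p\<bar> * \<bar>Re (kernel_integral n 0)\<bar>"
        using abs_triangle_ineq4[of "Re (kernel_integral n 1)" "p * Re (kernel_integral n 0)"]
        by (simp add: abs_mult)
      also have "\<dots> \<le> \<bar>Re (kernel_integral n 1)\<bar> + 1 * \<bar>Re (kernel_integral n 0)\<bar>"
        using p by (intro add_left_mono mult_right_mono) auto
      also have "\<dots> \<le> pi / 4 * (2 * M)"
      proof -
        have "pi / 4 * (a2 + a1) \<le> pi / 4 * (2 * M)"
          using M by (intro mult_left_mono) auto
        then show ?thesis
          unfolding a1 a2 by (simp add: distrib_left)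
      qed
      finally show ?thesis
        by (simp add: divide_right_mono)
    qed
    moreover have "norm A * (norm G / 2) \<le> \<bar>Re (A * X n)\<bar> + \<bar>Re (A * Y n)\<bar>"
    proof -
      have small: "\<bar>Re (A * (B - C))\<bar> \<le> norm A * (norm G / 4)" if "dist C B < norm G / 4" for B C
      proof -
        have "\<bar>Re (A * (B - C))\<bar> \<le> norm A * norm (B - C)"
          by (metis abs_Re_le_cmod norm_mult)
        also have "\<dots> \<le> norm A * (norm G / 4)"
          using that by (intro mult_left_mono) (auto simp: dist_norm norm_minus_commute)
        finally show ?thesis .
      qed
      have "norm (A * G) \<le> \<bar>Re (A * G)\<bar> + \<bar>Im (A * G)\<bar>"
        by (rule cmod_le)
      also have "\<bar>Im (A * G)\<bar> = \<bar>Re (A * (\<i> * G))\<bar>"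
        by (simp add: algebra_simps abs_minus_commute)
      also have "\<bar>Re (A * G)\<bar> \<le> \<bar>Re (A * X n)\<bar> + \<bar>Re (A * (G - X n))\<bar>"
        by (simp add: algebra_simps)
      also have "\<bar>Re (A * (G - X n))\<bar> \<le> norm A * (norm G / 4)"
        using elim(1) by (rule small)
      also have "\<bar>Re (A * (\<i> * G))\<bar> \<le> \<bar>Re (A * Y n)\<bar> + \<bar>Re (A * (\<i> * G - Y n))\<bar>"
        by (simp add: algebra_simps)
      also have "\<bar>Re (A * (\<i> * G - Y n))\<bar> \<le> norm A * (norm G / 4)"
        using elim(2) by (rule small)
      finally show ?thesis
        by (simp add: norm_mult)
    qed
    ultimately have "norm A * (norm G / 2) \<le> pi / 4 * (M * (1 + 2 / \<bar>q\<bar>))"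
      by (simp add: algebra_simps)
    also have "\<dots> \<le> pi / 4 * (M * (x n * (2 + 16 / \<sigma>)))"
    proof (intro mult_left_mono M)
      have x2: "1 \<le> 2 * x n"
        using x_gt_half by simp
      have "1 / \<bar>q\<bar> = (2 * x n + 1) / (eta (x n) / x n)"
        unfolding q_def Im_cayley_saddle using x_pos eta_pos
        by (simp add: abs_mult power2_eq_square field_simps)
      also have "\<dots> \<le> (4 * x n) / (\<sigma> / 2)"
        by (rule frac_le[OF _ _ _ less_imp_le[OF elim(3)]]) (use sigma(1) x2 in simp_all)
      finally have "2 / \<bar>q\<bar> \<le> 16 * x n / \<sigma>"
        by simp
      then show "1 + 2 / \<bar>q\<bar> \<le> x n * (2 + 16 / \<sigma>)"
        using x2 by (simp add: distrib_left mult.commute)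
    qed simp
    finally have "norm A * (norm G / 2) \<le> pi / 4 * (M * (x n * (2 + 16 / \<sigma>)))" .
    moreover have "peak (l n) (m n) (x n) / (sqrt (l n) * (8 * (x n)\<^sup>2)) \<le> norm A"
    proof -
      have "2 * x n \<le> 4 * (x n)\<^sup>2"
        using x_gt_half x_pos by (simp add: power2_eq_square)
      then show ?thesis
        unfolding A_def norm_amplitude using peak_pos l_pos x_pos
        by (intro divide_left_mono mult_left_mono mult_pos_pos) (auto simp: add_pos_pos)
    qed
    then have "peak (l n) (m n) (x n) / (sqrt (l n) * (8 * (x n)\<^sup>2)) * (norm G / 2) \<le> norm A * (norm G / 2)"
      by (intro mult_right_mono) auto
    ultimately have le: "peak (l n) (m n) (x n) / (sqrt (l n) * (8 * (x n)\<^sup>2)) * (norm G / 2) \<le>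
        pi / 4 * (M * (x n * (2 + 16 / \<sigma>)))"
      by linarith
    have B: "2 + 16 / \<sigma> > 0"
      using sigma(1) by (simp add: add_pos_pos)
    have "c * (peak (l n) (m n) (x n) / (sqrt (l n) * x n ^ 3)) =
        (peak (l n) (m n) (x n) / (sqrt (l n) * (8 * (x n)\<^sup>2)) * (norm G / 2)) / (pi / 4 * (x n * (2 + 16 / \<sigma>)))"
      using B x_pos by (simp add: c_def power2_eq_square power3_eq_cube)
    also have "\<dots> \<le> M"
      using le B x_pos by (subst pos_divide_le_eq) (auto simp: mult_ac)
    finally have "c * (peak (l n) (m n) (x n) / (sqrt (l n) * x n ^ 3)) \<le> M" .
    then show ?case
      unfolding M_def a1_def a2_def max_def
      by (auto split: if_splits intro: exI[of _ "Suc (m n)"] exI[of _ "Suc (m n + 1)"])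
  qed
  with c show ?thesis
    by blast
qed

end

section \<open>Two-sided bounds in terms of the saddle\<close>

text \<open>The derivative \<open>24 t\<^sup>2 - 2\<close> of \<open>8 t\<^sup>3 - 2 t\<close> is at least \<open>6\<close> for \<open>3 t\<^sup>2 \<ge> 1\<close>. Hence the inverse function
  is Lipschitz, which yields uniqueness of the saddle and its continuous dependence on the parameter.\<close>

lemma cubic_expanding:
  fixes a b :: real
  assumes "b > 0" "3 * b\<^sup>2 \<ge> 1" "b \<le> a"
  shows "6 * (a - b) \<le> (8 * a ^ 3 - 2 * a) - (8 * b ^ 3 - 2 * b)"
proof -
  have "b\<^sup>2 \<le> a\<^sup>2" "b\<^sup>2 \<le> a * b"
    using assms by (auto simp: power2_eq_square intro: mult_mono)
  then have "6 \<le> 8 * (a\<^sup>2 + a * b + b\<^sup>2) - 2"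
    using assms(2) unfolding distrib_left by linarith
  then have "6 * (a - b) \<le> (8 * (a\<^sup>2 + a * b + b\<^sup>2) - 2) * (a - b)"
    using assms by (intro mult_right_mono) auto
  also have "\<dots> = (8 * a ^ 3 - 2 * a) - (8 * b ^ 3 - 2 * b)"
    by (simp add: power2_eq_square power3_eq_cube algebra_simps)
  finally show ?thesis .
qed

text \<open>\<open>xi a\<close> is the real part of the saddle for the ratio \<open>a = l / m\<close>.\<close>

definition is_xi :: "real \<Rightarrow> real \<Rightarrow> bool" where
  "is_xi a x \<longleftrightarrow> x > 0 \<and> 3 * x\<^sup>2 > 1 \<and> a * (8 * x ^ 3 - 2 * x) = 1"

definition xi :: "real \<Rightarrow> real" where
  "xi a = (SOME x. is_xi a x)"

lemma is_xi_cubic: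
  assumes "is_xi a x"
  shows "8 * x ^ 3 - 2 * x = 1 / a"
proof -
  have "c = 1 / a" if "a * c = 1" for c
    using that by (auto simp: eq_divide_eq mult.commute)
  then show ?thesis
    using assms by (simp add: is_xi_def)
qed

lemma abs_is_xi_diff_le:
  assumes "is_xi a x" "is_xi b y"
  shows "\<bar>x - y\<bar> \<le> \<bar>1 / a - 1 / b\<bar> / 6"
proof -
  note assms[THEN is_xi_cubic]
  then show ?thesis
    using cubic_expanding[of x y] cubic_expanding[of y x] assms by (auto simp: is_xi_def abs_if)
qed

lemma is_xi_unique: "is_xi a x \<Longrightarrow> is_xi a y \<Longrightarrow> x = y"
  using abs_is_xi_diff_le[of a x a y] by simp

text \<open>At \<open>x = 1 / sqrt 3\<close>, where the complex roots meet on the real axis, the cubic \<open>8 x\<^sup>3 - 2 x\<close> equals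
  \<open>1 / alpha_c\<close>; above this point it takes every larger value.\<close>

lemma is_xi_xi:
  assumes "0 < a" "a < alpha_c"
  shows "is_xi a (xi a)"
proof -
  define p where "p = (\<lambda>t :: real. 8 * t ^ 3 - 2 * t)"
  define b where "b = 1 / sqrt 3"
  have b: "b > 0" "3 * b\<^sup>2 = 1"
    by (simp_all add: b_def power_divide)
  have pb3: "p b = 2 * b / 3"
    using b(2) by (simp add: p_def power2_eq_square power3_eq_cube algebra_simps)
  then have "p b = 1 / alpha_c"
    by (simp add: b_def alpha_c_def field_simps)
  then have pb: "p b < 1 / a"
    using assms by (simp add: frac_less2)
  have "6 * (b + 1 / a - b) \<le> p (b + 1 / a) - p b"
    unfolding p_def using assms b by (intro cubic_expanding) auto
  moreover have "1 / a \<le> 6 * (b + 1 / a - b)"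
    using assms by (simp add: divide_right_mono)
  moreover have "p b > 0"
    using b by (simp add: pb3)
  ultimately have "1 / a \<le> p (b + 1 / a)"
    by linarith
  then have "\<exists>x\<ge>b. x \<le> b + 1 / a \<and> p x = 1 / a"
    using pb assms by (intro IVT') (auto simp: p_def intro!: continuous_intros)
  then obtain x where x: "b \<le> x" "p x = 1 / a"
    by blast
  have "b \<noteq> x"
    using pb x(2) by auto
  then have "b < x"
    using x(1) by simp
  then have "b\<^sup>2 < x\<^sup>2"
    using b(1) by (intro power_strict_mono) auto
  then have "is_xi a x"
    using x b assms \<open>b < x\<close> by (auto simp: is_xi_def p_def)
  then show ?thesis
    unfolding xi_def by (rule someI)
qed

lemma xi_half: "is_xi a x \<Longrightarrow> x > 1 / 2"
proof -
  assume x: "is_xi a x"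
  then have "(1 / 2)\<^sup>2 < x\<^sup>2"
    by (simp add: is_xi_def power_divide)
  then show ?thesis
    by (rule power2_less_imp_less) (use x in \<open>simp add: is_xi_def\<close>)
qed

lemma saddle_point_xi:
  assumes l: "l > 0" and m: "m > 0" and a: "l / real m < alpha_c"
  shows "saddle_point l (xi (l / real m)) m"
proof -
  have "is_xi (l / real m) (xi (l / real m))"
    using l m a by (intro is_xi_xi) auto
  then show ?thesis
    using l m by unfold_locales (auto simp: is_xi_def field_simps)
qed

lemma zeta_eq:
  assumes "is_xi a x"
  shows "zeta a = saddle x"
  unfolding zeta_def
proof (rule the_equality)
  have e: "eta x > 0" "(eta x)\<^sup>2 = 3 * x\<^sup>2 - 1"
    using assms by (auto simp: is_xi_def eta_def)
  have "saddle x ^ 3 - saddle x = saddle x * ((saddle x)\<^sup>2 - 1)"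
    by (simp add: power2_eq_square power3_eq_cube algebra_simps)
  also have "(saddle x)\<^sup>2 - 1 = of_real (- 2 * x) * (of_real x - \<i> * of_real (eta x))"
    using e(2) by (simp add: complex_eq_iff power2_eq_square)
  also have "saddle x * \<dots> = of_real (- 2 * x) * (of_real (x\<^sup>2) + of_real ((eta x)\<^sup>2))"
    by (simp add: power2_eq_square algebra_simps)
  also have "\<dots> = of_real (- (8 * x ^ 3 - 2 * x))"
    unfolding e(2) by (simp add: power2_eq_square power3_eq_cube algebra_simps)
  finally have cubic: "saddle x ^ 3 - saddle x = of_real (- (8 * x ^ 3 - 2 * x))" .
  have "of_real a * (saddle x ^ 3 - saddle x) + 1 = of_real (1 - a * (8 * x ^ 3 - 2 * x))"
    unfolding cubic by (simp add: algebra_simps)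
  also have "1 - a * (8 * x ^ 3 - 2 * x) = 0"
    using assms by (simp add: is_xi_def)
  finally have "of_real a * (saddle x ^ 3 - saddle x) + 1 = 0"
    by (simp only: of_real_0)
  moreover have "Re (saddle x) > 0" "Im (saddle x) > 0"
    using assms e(1) by (simp_all add: is_xi_def)
  ultimately show "Re (saddle x) > 0 \<and> Im (saddle x) > 0 \<and> of_real a * (saddle x ^ 3 - saddle x) + 1 = 0"
    by blast
next
  fix z
  assume z: "Re z > 0 \<and> Im z > 0 \<and> of_real a * (z ^ 3 - z) + 1 = 0"
  define r s where "r = Re z" and "s = Im z"
  have rs: "r > 0" "s > 0"
    using z by (auto simp: r_def s_def)
  have re: "a * (r ^ 3 - 3 * r * s\<^sup>2 - r) + 1 = 0" and im: "a * (s * (3 * r\<^sup>2 - s\<^sup>2 - 1)) = 0"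
    using z unfolding complex_eq_iff r_def s_def
    by (simp_all add: power2_eq_square power3_eq_cube algebra_simps)
  have "a \<noteq> 0"
    using re by auto
  then have s2: "s\<^sup>2 = 3 * r\<^sup>2 - 1"
    using im rs by simp
  have "is_xi a r"
  proof -
    have "3 * r\<^sup>2 > 1"
      using s2 rs by (metis diff_gt_0_iff_gt zero_less_power)
    moreover have "a * (8 * r ^ 3 - 2 * r) = 1"
      using re unfolding s2 by (simp add: power2_eq_square power3_eq_cube algebra_simps)
    ultimately show ?thesis
      using rs by (simp add: is_xi_def)
  qed
  then have "r = x"
    using assms by (rule is_xi_unique)
  moreover have "s = eta r"
    using s2 rs by (metis eta_def real_sqrt_unique less_imp_le)
  ultimately show "z = saddle x"
    by (simp add: complex_eq_iff r_def s_def)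
qed

text \<open>The logarithm of \<open>H_e\<close> as a function of the real part of the saddle.\<close>

definition log_rate :: "real \<Rightarrow> real" where
  "log_rate x = ln ((2 * x - 1) / (2 * x + 1)) / 2 - (2 * x\<^sup>2 - 1) / (8 * x ^ 3 - 2 * x)"

lemma (in saddle_point) peak_eq: "peak l m x = exp (real m * log_rate x)"
proof -
  have q: "(2 * x - 1) / (2 * x + 1) > 0"
    using x_gt_half by simp
  have "norm (cayley (saddle x)) = sqrt ((2 * x - 1) / (2 * x + 1))"
    by (metis norm_cayley_saddle norm_ge_zero real_sqrt_unique)
  also have "\<dots> = exp (ln ((2 * x - 1) / (2 * x + 1)) / 2)"
  proof -
    have "sqrt r = exp (ln r / 2)" if "r > 0" for r
      using that by (simp add: powr_half_sqrt[symmetric] powr_def)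
    then show ?thesis
      using q by blast
  qed
  finally have c: "norm (cayley (saddle x)) = exp (ln ((2 * x - 1) / (2 * x + 1)) / 2)" .
  have p: "8 * x ^ 3 - 2 * x \<noteq> 0"
  proof -
    have "8 * x ^ 3 - 2 * x = 2 * x * (2 * x - 1) * (2 * x + 1)"
      by (simp add: power3_eq_cube algebra_simps)
    then show ?thesis
      using x_gt_half by simp
  qed
  have "peak l m x = exp (l * (1 - 2 * x\<^sup>2)) * exp (ln ((2 * x - 1) / (2 * x + 1)) / 2) ^ m"
    unfolding peak_def phase_def norm_mult norm_power norm_exp_square c
    by (simp add: eta_square algebra_simps)
  also have "\<dots> = exp (l * (1 - 2 * x\<^sup>2) + real m * (ln ((2 * x - 1) / (2 * x + 1)) / 2))"
    by (simp only: exp_add exp_of_nat_mult)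
  also have "l * (1 - 2 * x\<^sup>2) = - (real m * ((2 * x\<^sup>2 - 1) / (8 * x ^ 3 - 2 * x)))"
  proof -
    have "l * (- t) = - (l * d * (t / d))" if "d \<noteq> 0" for t d
      using that by simp
    from this[OF p, of "2 * x\<^sup>2 - 1"] show ?thesis
      unfolding m_eq by simp
  qed
  finally show ?thesis
    by (simp add: log_rate_def algebra_simps)
qed

lemma H_e_eq:
  assumes "is_xi a x" "a > 0"
  shows "H_e a = exp (log_rate x)"
proof -
  have p: "8 * x ^ 3 - 2 * x \<noteq> 0" and a: "a = 1 / (8 * x ^ 3 - 2 * x)"
    using is_xi_cubic[OF assms(1)] assms(2) by simp_all
  interpret saddle_point a x 1
    using assms by unfold_locales (auto simp: is_xi_def)
  have "cmod ((saddle x - 1) / (saddle x + 1)) = norm (cayley (saddle x))"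
    by (simp only: cayley_def norm_divide norm_minus_commute[of "saddle x" 1] add.commute[of "saddle x" 1])
  moreover have "exp (a * Re ((saddle x)\<^sup>2)) = norm (exp (of_real a * (saddle x)\<^sup>2))"
    by simp
  ultimately have "H_e a = peak a 1 x"
    unfolding H_e_def zeta_eq[OF assms(1)] peak_def phase_def norm_mult by (simp only: power_one_right mult.commute)
  then show ?thesis
    using peak_eq by simp
qed

text \<open>Up to constants all three errors lie between the modulus of any later coefficient and the uniform
  norm of the remainder, so that one estimate of each kind serves all of them.\<close>

lemma error_lower:
  assumes D: "D \<in> {best_error, sup_error, l2_error}" and l: "l > 0" and k: "m < k"
  shows "\<bar>cheb_coeff l k\<bar> / 2 \<le> D m l"
  using D abs_cheb_coeff_le_best_error[OF l k] abs_cheb_coeff_le_l2_error[OF l k]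
    best_error_le_sup_error[OF l, of m] by auto

lemma error_upper:
  assumes D: "D \<in> {best_error, sup_error, l2_error}" and l: "l > 0"
  shows "D m l \<le> 2 * sup_error m l"
proof -
  have "0 \<le> sup_error m l"
    using abs_cheb_coeff_le_best_error[OF l lessI, of m] best_error_le_sup_error[OF l, of m]
      abs_ge_zero[of "cheb_coeff l (Suc m)"] by linarith
  moreover have "sqrt pi \<le> 2"
    using pi_less_4 real_sqrt_le_mono[of pi 4] by simp
  then have "sqrt pi * sup_error m l \<le> 2 * sup_error m l"
    using \<open>0 \<le> sup_error m l\<close> by (rule mult_right_mono)
  ultimately show ?thesis
    using D best_error_le_sup_error[OF l, of m] l2_error_le_sup_error[OF l, of m] by auto
qed

text \<open>The powers of \<open>x n\<close> on the two sides differ. This is harmless: they agree up to constants when the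
  saddle stays bounded, and otherwise only logarithms of the errors are compared.\<close>

lemma (in saddle_sequence) two_sided_bound:
  assumes D: "D \<in> {best_error, sup_error, l2_error}"
  shows "\<exists>A>0. \<exists>B>0. \<forall>\<^sub>F n in sequentially.
    A * (peak (l n) (m n) (x n) / (sqrt (l n) * x n ^ 3)) \<le> D (m n) (l n) \<and>
    D (m n) (l n) \<le> B * (peak (l n) (m n) (x n) / (sqrt (l n) * x n))"
proof -
  from cheb_coeff_lower_bound obtain c where c: "c > 0"
    and ev: "\<forall>\<^sub>F n in sequentially. \<exists>k>m n.
      c * (peak (l n) (m n) (x n) / (sqrt (l n) * x n ^ 3)) \<le> \<bar>cheb_coeff (l n) k\<bar>"
    by blast
  define B where "B = 4 / pi * sqrt (pi / (decay_limit / 2))"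
  have B: "B > 0"
    using decay_limit_pos by (simp add: B_def)
  from ev eventually_decay have "\<forall>\<^sub>F n in sequentially.
      c / 2 * (peak (l n) (m n) (x n) / (sqrt (l n) * x n ^ 3)) \<le> D (m n) (l n) \<and>
      D (m n) (l n) \<le> B * (peak (l n) (m n) (x n) / (sqrt (l n) * x n))"
  proof eventually_elim
    case (elim n)
    interpret saddle_point "l n" "x n" "m n"
      by (rule saddle_point)
    from elim(1) obtain k where "k > m n"
      "c * (peak (l n) (m n) (x n) / (sqrt (l n) * x n ^ 3)) \<le> \<bar>cheb_coeff (l n) k\<bar>"
      by blast
    then have "c / 2 * (peak (l n) (m n) (x n) / (sqrt (l n) * x n ^ 3)) \<le> D (m n) (l n)"
      using error_lower[OF D l_pos, of "m n" k] by simp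
    moreover have "D (m n) (l n) \<le> B * (peak (l n) (m n) (x n) / (sqrt (l n) * x n))"
    proof -
      have "D (m n) (l n) \<le> 2 * tail_bound"
        using error_upper[OF D l_pos, of "m n"] sup_error_le_tail_bound by simp
      also have "tail_bound = 2 / (pi * x n) * peak (l n) (m n) (x n) * (sqrt (pi / decay (x n)) / sqrt (l n))"
        by (simp add: tail_bound_def real_sqrt_divide real_sqrt_mult)
      also have "2 * \<dots> \<le> 2 * (2 / (pi * x n) * peak (l n) (m n) (x n) * (sqrt (pi / (decay_limit / 2)) / sqrt (l n)))"
        using elim(2) decay_limit_pos decay_pos x_pos l_pos peak_pos
        by (intro mult_left_mono divide_right_mono real_sqrt_le_mono divide_left_mono) auto
      also have "\<dots> = B * (peak (l n) (m n) (x n) / (sqrt (l n) * x n))"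
        by (simp add: B_def mult_ac)
      finally show ?thesis .
    qed
    ultimately show ?case ..
  qed
  with c B show ?thesis
    by (intro exI[of _ "c / 2"] exI[of _ B] conjI) auto
qed

lemma error_two_sided:
  fixes lam :: "nat \<Rightarrow> real"
  defines "\<xi> \<equiv> \<lambda>m. xi (lam m / real m)"
  assumes D: "D \<in> {best_error, sup_error, l2_error}"
    and lam: "\<forall>\<^sub>F m in sequentially. lam m > 0"
    and sub: "\<forall>\<^sub>F m in sequentially. lam m / real m < alpha_c"
    and lim: "(\<lambda>m. 1 / \<xi> m) \<longlonglongrightarrow> \<tau>" "\<tau>\<^sup>2 < 3"
    and narrow: "filterlim (\<lambda>m. lam m * (\<xi> m)\<^sup>2) at_top sequentially"
  shows "\<exists>A>0. \<exists>B>0. \<forall>\<^sub>F m in sequentially.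
    A * (exp (real m * log_rate (\<xi> m)) / (sqrt (lam m) * \<xi> m ^ 3)) \<le> D m (lam m) \<and>
    D m (lam m) \<le> B * (exp (real m * log_rate (\<xi> m)) / (sqrt (lam m) * \<xi> m))"
proof -
  have "\<forall>\<^sub>F m in sequentially. saddle_point (lam m) (\<xi> m) m"
    using lam sub eventually_gt_at_top[of 0]
    by eventually_elim (simp add: \<xi>_def saddle_point_xi)
  then obtain N where N: "\<And>m. m \<ge> N \<Longrightarrow> saddle_point (lam m) (\<xi> m) m"
    unfolding eventually_sequentially by blast
  interpret saddle_sequence "\<lambda>n. lam (n + N)" "\<lambda>n. \<xi> (n + N)" "\<lambda>n. n + N" \<tau>
  proof (rule saddle_sequence.intro)
    show "saddle_point (lam (n + N)) (\<xi> (n + N)) (n + N)" for n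
      by (rule N) simp
    show "(\<lambda>n. 1 / \<xi> (n + N)) \<longlonglongrightarrow> \<tau>"
      using lim(1) by (rule LIMSEQ_ignore_initial_segment)
    show "filterlim (\<lambda>n. lam (n + N) * (\<xi> (n + N))\<^sup>2) at_top sequentially"
      by (rule filterlim_compose[OF narrow filterlim_add_const_nat_at_top])
  qed (rule lim(2))
  from two_sided_bound[OF D] obtain A B where AB: "A > 0" "B > 0"
    and ev: "\<forall>\<^sub>F n in sequentially.
      A * (peak (lam (n + N)) (n + N) (\<xi> (n + N)) / (sqrt (lam (n + N)) * \<xi> (n + N) ^ 3)) \<le> D (n + N) (lam (n + N)) \<and>
      D (n + N) (lam (n + N)) \<le> B * (peak (lam (n + N)) (n + N) (\<xi> (n + N)) / (sqrt (lam (n + N)) * \<xi> (n + N)))"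
    by blast
  have "\<forall>\<^sub>F n in sequentially.
      A * (peak (lam n) n (\<xi> n) / (sqrt (lam n) * \<xi> n ^ 3)) \<le> D n (lam n) \<and>
      D n (lam n) \<le> B * (peak (lam n) n (\<xi> n) / (sqrt (lam n) * \<xi> n))"
    by (rule eventually_sequentially_seg[THEN iffD1, OF ev])
  moreover have "\<forall>\<^sub>F n in sequentially. n \<ge> N"
    by (rule eventually_ge_at_top)
  ultimately have "\<forall>\<^sub>F m in sequentially.
    A * (exp (real m * log_rate (\<xi> m)) / (sqrt (lam m) * \<xi> m ^ 3)) \<le> D m (lam m) \<and>
    D m (lam m) \<le> B * (exp (real m * log_rate (\<xi> m)) / (sqrt (lam m) * \<xi> m))"
    by eventually_elim (use N saddle_point.peak_eq in auto)
  with AB show ?thesis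
    by blast
qed

section \<open>Asymptotics of the errors\<close>

text \<open>On the logarithmic scale \<open>S\<close> the algebraic factors of a two-sided bound disappear.\<close>

lemma log_error_limit:
  fixes D lam x S :: "nat \<Rightarrow> real"
  assumes AB: "A > 0" "B > 0"
    and bounds: "\<forall>\<^sub>F m in sequentially. A * (exp (E m) / (sqrt (lam m) * x m ^ 3)) \<le> D m \<and>
      D m \<le> B * (exp (E m) / (sqrt (lam m) * x m))"
    and pos: "\<forall>\<^sub>F m in sequentially. lam m > 0" "\<forall>\<^sub>F m in sequentially. x m > 0"
    and S: "filterlim S at_top sequentially"
    and lim: "(\<lambda>m. E m / S m) \<longlonglongrightarrow> r"
    and negligible: "(\<lambda>m. ln (lam m) / S m) \<longlonglongrightarrow> 0" "(\<lambda>m. ln (x m) / S m) \<longlonglongrightarrow> 0"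
  shows "(\<lambda>m. ln (D m) / S m) \<longlonglongrightarrow> r" and "\<forall>\<^sub>F m in sequentially. D m > 0"
proof -
  let ?lo = "\<lambda>m. ln A + E m - ln (lam m) / 2 - 3 * ln (x m)"
  let ?up = "\<lambda>m. ln B + E m - ln (lam m) / 2 - ln (x m)"
  have ev: "\<forall>\<^sub>F m in sequentially. D m > 0 \<and> ?lo m \<le> ln (D m) \<and> ln (D m) \<le> ?up m"
    using bounds pos
  proof eventually_elim
    case (elim m)
    define lo up where "lo = A * (exp (E m) / (sqrt (lam m) * x m ^ 3))"
      and "up = B * (exp (E m) / (sqrt (lam m) * x m))"
    have pos: "lo > 0" "up > 0"
      using AB elim by (simp_all add: lo_def up_def)
    have "ln lo = ?lo m" "ln up = ?up m"
      using AB elim by (simp_all add: lo_def up_def ln_mult ln_div ln_sqrt ln_realpow)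
    moreover have "lo \<le> D m" "D m \<le> up"
      using elim by (simp_all add: lo_def up_def)
    ultimately show ?case
      using pos by (metis less_le_trans ln_le_cancel_iff)
  qed
  then show "\<forall>\<^sub>F m in sequentially. D m > 0"
    by (rule eventually_mono) simp
  have Spos: "\<forall>\<^sub>F m in sequentially. S m > 0"
    using S by (simp add: filterlim_at_top_dense)
  have inv: "(\<lambda>m. a / S m) \<longlonglongrightarrow> 0" for a
    by (rule tendsto_divide_0[OF tendsto_const filterlim_at_top_imp_at_infinity[OF S]])
  show "(\<lambda>m. ln (D m) / S m) \<longlonglongrightarrow> r"
  proof (rule real_tendsto_sandwich)
    have "(\<lambda>m. ln A / S m + E m / S m - 1 / 2 * (ln (lam m) / S m) - 3 * (ln (x m) / S m)) \<longlonglongrightarrow>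
        0 + r - 1 / 2 * 0 - 3 * 0"
      by (intro tendsto_intros inv lim negligible)
    then show "(\<lambda>m. ?lo m / S m) \<longlonglongrightarrow> r"
      by (simp add: add_divide_distrib diff_divide_distrib)
    have "(\<lambda>m. ln B / S m + E m / S m - 1 / 2 * (ln (lam m) / S m) - ln (x m) / S m) \<longlonglongrightarrow>
        0 + r - 1 / 2 * 0 - 0"
      by (intro tendsto_intros inv lim negligible)
    then show "(\<lambda>m. ?up m / S m) \<longlonglongrightarrow> r"
      by (simp add: add_divide_distrib diff_divide_distrib)
    show "\<forall>\<^sub>F m in sequentially. ?lo m / S m \<le> ln (D m) / S m"
      using ev Spos by eventually_elim (simp add: divide_right_mono)
    show "\<forall>\<^sub>F m in sequentially. ln (D m) / S m \<le> ?up m / S m"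
      using ev Spos by eventually_elim (simp add: divide_right_mono)
  qed
qed

text \<open>For large \<open>x\<close> the logarithm of the Cayley transform contributes \<open>- 1 / (2 x)\<close> and the Gaussian factor
  \<open>- 1 / (4 x)\<close>.\<close>

lemma log_rate_at_top: "((\<lambda>x. x * log_rate x) \<longlongrightarrow> - 3 / 4) at_top"
  unfolding log_rate_def by real_asymp

lemma alpha_c_pos: "alpha_c > 0"
  by (simp add: alpha_c_def)

text \<open>Here the saddle escapes to infinity, with \<open>8 (x m)\<^sup>3\<close> asymptotic to \<open>m / lam m\<close>, and the exponent
  \<open>m log_rate (x m)\<close> is asymptotic to \<open>- 3 m / (4 x m)\<close>. In the proof, \<open>Q m\<close> compares \<open>m / x m\<close> with the claimed
  scale; its cube is a rational expression in \<open>lam m / m powr \<gamma>\<close> and \<open>1 / x m\<close>.\<close>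

lemma subcritical_growth_limit:
  fixes lam :: "nat \<Rightarrow> real"
  assumes lam_pos: "\<And>m. m \<ge> 1 \<Longrightarrow> lam m > 0"
    and D: "D \<in> {best_error, sup_error, l2_error}"
    and c: "c > 0" and g: "0 \<le> \<gamma>" "\<gamma> < 1"
    and lam: "lam \<sim>[sequentially] (\<lambda>m. c * real m powr \<gamma>)"
  shows "(\<lambda>m. ln (D m (lam m)) / real m powr ((2 + \<gamma>) / 3)) \<longlonglongrightarrow> - (3 / 2) * c powr (1 / 3)"
proof -
  define S where "S = (\<lambda>m. real m powr ((2 + \<gamma>) / 3))"
  define L where "L = (\<lambda>m. lam m / real m powr \<gamma>)"
  define a where "a = (\<lambda>m. lam m / real m)"
  define x where "x = (\<lambda>m. xi (a m))"
  have m1: "\<forall>\<^sub>F m in sequentially. m \<ge> (1 :: nat)"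
    by (rule eventually_ge_at_top)
  have S: "filterlim S at_top sequentially"
    unfolding S_def using g by real_asymp
  have lam_ev: "\<forall>\<^sub>F m in sequentially. lam m > 0"
    using m1 lam_pos by (rule eventually_mono)
  have L: "L \<longlonglongrightarrow> c"
  proof -
    have "\<forall>\<^sub>F m in sequentially. lam m \<noteq> 0 \<or> c * real m powr \<gamma> \<noteq> 0"
      using lam_ev by (rule eventually_mono) simp
    with lam have "(\<lambda>m. lam m / (c * real m powr \<gamma>)) \<longlonglongrightarrow> 1"
      by (rule asymp_equivD_strong)
    from tendsto_mult_left[OF this, of c] show ?thesis
      using c by (simp add: L_def)
  qed
  have a_eq: "\<forall>\<^sub>F m in sequentially. L m * real m powr (\<gamma> - 1) = a m"
    using m1 by (rule eventually_mono) (auto simp: L_def a_def powr_diff field_simps)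
  have "(\<lambda>m. real m powr (\<gamma> - 1)) \<longlonglongrightarrow> 0"
    using g by real_asymp
  from tendsto_mult[OF L this] have a0: "a \<longlonglongrightarrow> 0"
    using Lim_transform_eventually[OF _ a_eq] by simp
  have sub: "\<forall>\<^sub>F m in sequentially. a m < alpha_c"
    using a0 alpha_c_pos by (rule order_tendstoD)
  have apos: "\<forall>\<^sub>F m in sequentially. a m > 0"
    using m1 by (rule eventually_mono) (simp add: a_def lam_pos)
  have x: "\<forall>\<^sub>F m in sequentially. is_xi (a m) (x m)"
    using apos sub by eventually_elim (simp add: x_def is_xi_xi)
  have xpos: "\<forall>\<^sub>F m in sequentially. x m > 0"
    using x by (rule eventually_mono) (simp add: is_xi_def)
  have inv3: "(\<lambda>m. (1 / x m) ^ 3) \<longlonglongrightarrow> 0"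
  proof (rule real_tendsto_sandwich[OF _ _ tendsto_const])
    show "\<forall>\<^sub>F m in sequentially. 0 \<le> (1 / x m) ^ 3"
      using xpos by (rule eventually_mono) simp
    show "\<forall>\<^sub>F m in sequentially. (1 / x m) ^ 3 \<le> 8 * a m"
      using x apos
    proof eventually_elim
      case (elim m)
      then have "1 \<le> 8 * a m * x m ^ 3"
        by (auto simp: is_xi_def algebra_simps)
      then show ?case
        using elim by (simp add: is_xi_def power_divide divide_le_eq)
    qed
    show "(\<lambda>m. 8 * a m) \<longlonglongrightarrow> 0"
      using tendsto_mult_left[OF a0, of 8] by simp
  qed
  have "(\<lambda>m. root 3 ((1 / x m) ^ 3)) \<longlonglongrightarrow> root 3 0"
    by (intro tendsto_real_root inv3)
  then have inv: "(\<lambda>m. 1 / x m) \<longlonglongrightarrow> 0"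
    by (simp add: odd_real_root_power_cancel)
  have xtop: "filterlim x at_top sequentially"
  proof -
    have "filterlim (\<lambda>m. inverse (1 / x m)) at_top sequentially"
      by (rule filterlim_inverse_at_top[OF inv]) (use xpos in \<open>auto elim: eventually_mono\<close>)
    then show ?thesis
      by simp
  qed
  \<comment> \<open>The saddle equation in the form \<open>m = lam m x\<^sup>3 (8 - 2 / x\<^sup>2)\<close>.\<close>
  have K: "(\<lambda>m. 8 - 2 * (1 / x m)\<^sup>2) \<longlonglongrightarrow> 8"
    using tendsto_diff[OF tendsto_const[of 8] tendsto_mult_left[OF tendsto_power[OF inv, of 2], of 2]] by simp
  have Kpos: "\<forall>\<^sub>F m in sequentially. 0 < 8 - 2 * (1 / x m)\<^sup>2"
    using K by (rule order_tendstoD) simp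
  have eq: "\<forall>\<^sub>F m in sequentially. real m = lam m * x m ^ 3 * (8 - 2 * (1 / x m)\<^sup>2)"
    using x apos m1
  proof eventually_elim
    case (elim m)
    have "x m ^ 3 * (8 - 2 * (1 / x m)\<^sup>2) = 8 * x m ^ 3 - 2 * x m"
      using elim by (simp add: is_xi_def power2_eq_square power3_eq_cube field_simps)
    also have "\<dots> = real m / lam m"
      using is_xi_cubic[OF elim(1)] by (simp add: a_def)
    finally show ?case
      using lam_pos[of m] elim by (simp add: mult.assoc)
  qed
  define Q where "Q = (\<lambda>m. real m / (x m * S m))"
  have Q: "Q \<longlonglongrightarrow> 2 * c powr (1 / 3)"
  proof -
    have "(\<lambda>m. root 3 ((8 - 2 * (1 / x m)\<^sup>2) * L m)) \<longlonglongrightarrow> root 3 (8 * c)"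
      by (intro tendsto_real_root tendsto_mult K L)
    moreover have "\<forall>\<^sub>F m in sequentially. root 3 ((8 - 2 * (1 / x m)\<^sup>2) * L m) = Q m"
      using eq xpos lam_ev m1
    proof eventually_elim
      case (elim m)
      have S3: "S m ^ 3 = (real m)\<^sup>2 * real m powr \<gamma>"
      proof -
        have "S m ^ 3 = real m powr (real 3 * ((2 + \<gamma>) / 3))"
          unfolding S_def using elim(4) by (subst powr_power) simp_all
        also have "real 3 * ((2 + \<gamma>) / 3) = 2 + \<gamma>"
          by simp
        finally show ?thesis
          using elim(4) by (simp add: powr_add)
      qed
      have "Q m ^ 3 = real m ^ 3 / (x m ^ 3 * ((real m)\<^sup>2 * real m powr \<gamma>))"
        by (simp add: Q_def power_divide power_mult_distrib S3)
      also have "\<dots> = real m / (x m ^ 3 * real m powr \<gamma>)"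
        using elim by (simp add: power2_eq_square power3_eq_cube)
      also have "\<dots> = (8 - 2 * (1 / x m)\<^sup>2) * L m"
        using elim(2,3) by (subst elim(1)) (simp add: L_def)
      finally show ?case
        by (metis odd_numeral odd_real_root_power_cancel)
    qed
    ultimately have "Q \<longlonglongrightarrow> root 3 (8 * c)"
      by (rule Lim_transform_eventually)
    also have "root 3 (8 * c) = 2 * c powr (1 / 3)"
    proof -
      have "(2 * c powr (1 / 3)) ^ 3 = 8 * c"
        using c by (simp add: power_mult_distrib powr_powr flip: powr_numeral)
      then show ?thesis
        by (metis odd_numeral odd_real_root_power_cancel)
    qed
    finally show ?thesis .
  qed
  have narrow: "filterlim (\<lambda>m. lam m * (x m)\<^sup>2) at_top sequentially"
  proof -
    have "filterlim (\<lambda>m. (Q m / (8 - 2 * (1 / x m)\<^sup>2)) * S m) at_top sequentially"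
    proof (rule filterlim_tendsto_pos_mult_at_top[OF _ _ S])
      show "(\<lambda>m. Q m / (8 - 2 * (1 / x m)\<^sup>2)) \<longlonglongrightarrow> 2 * c powr (1 / 3) / 8"
        by (intro tendsto_divide Q K) simp
    qed (use c in simp)
    moreover have "\<forall>\<^sub>F m in sequentially. (Q m / (8 - 2 * (1 / x m)\<^sup>2)) * S m = lam m * (x m)\<^sup>2"
      using eq xpos m1 Kpos
    proof eventually_elim
      case (elim m)
      define k where "k = 8 - 2 * (1 / x m)\<^sup>2"
      have k: "k > 0" "real m = lam m * x m ^ 3 * k"
        using elim(1,4) by (simp_all only: k_def)
      have S0: "S m > 0"
        using elim(3) by (simp add: S_def)
      have "Q m / k * S m = real m / x m / k"
        using S0 by (simp add: Q_def)
      also have "\<dots> = lam m * (x m)\<^sup>2"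
        using k(1) elim(2) unfolding k(2) by (simp add: power2_eq_square power3_eq_cube)
      finally show ?case
        by (simp add: k_def)
    qed
    ultimately show ?thesis
      by (rule filterlim_mono_eventually[OF _ order_refl order_refl])
  qed
  have lnm: "(\<lambda>m. ln (real m) / S m) \<longlonglongrightarrow> 0"
    unfolding S_def using g by real_asymp
  have inS: "(\<lambda>m. f m / S m) \<longlonglongrightarrow> 0" if "f \<longlonglongrightarrow> r" for f r
    by (rule tendsto_divide_0[OF that filterlim_at_top_imp_at_infinity[OF S]])
  have lnlam: "(\<lambda>m. ln (lam m) / S m) \<longlonglongrightarrow> 0"
  proof -
    have "(\<lambda>m. ln (L m) / S m + \<gamma> * (ln (real m) / S m)) \<longlonglongrightarrow> 0 + \<gamma> * 0"
      using c by (intro tendsto_add tendsto_mult_left lnm inS[OF tendsto_ln[OF L]]) auto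
    moreover have "\<forall>\<^sub>F m in sequentially. ln (L m) / S m + \<gamma> * (ln (real m) / S m) = ln (lam m) / S m"
      using lam_ev m1
      by eventually_elim (simp add: L_def ln_div ln_powr diff_divide_distrib)
    ultimately show ?thesis
      using Lim_transform_eventually by fastforce
  qed
  have lnx: "(\<lambda>m. ln (x m) / S m) \<longlonglongrightarrow> 0"
  proof -
    have "(\<lambda>m. (ln (real m) / S m - ln (lam m) / S m - ln (8 - 2 * (1 / x m)\<^sup>2) / S m) / 3) \<longlonglongrightarrow> (0 - 0 - 0) / 3"
      by (intro tendsto_divide tendsto_diff tendsto_const lnm lnlam inS[OF tendsto_ln[OF K]]) auto
    moreover have "\<forall>\<^sub>F m in sequentially.
        (ln (real m) / S m - ln (lam m) / S m - ln (8 - 2 * (1 / x m)\<^sup>2) / S m) / 3 = ln (x m) / S m"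
      using eq xpos lam_ev Kpos
    proof eventually_elim
      case (elim m)
      have "ln (real m) = ln (lam m) + 3 * ln (x m) + ln (8 - 2 * (1 / x m)\<^sup>2)"
        using elim by (subst elim(1)) (simp add: ln_mult ln_realpow)
      then show ?case
        by (simp add: add_divide_distrib)
    qed
    ultimately show ?thesis
      using Lim_transform_eventually by fastforce
  qed
  have main: "(\<lambda>m. real m * log_rate (x m) / S m) \<longlonglongrightarrow> - (3 / 2) * c powr (1 / 3)"
  proof -
    have "(\<lambda>m. (x m * log_rate (x m)) * Q m) \<longlonglongrightarrow> (- 3 / 4) * (2 * c powr (1 / 3))"
      by (intro tendsto_mult Q filterlim_compose[OF log_rate_at_top xtop])
    moreover have "\<forall>\<^sub>F m in sequentially. (x m * log_rate (x m)) * Q m = real m * log_rate (x m) / S m"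
      using xpos by eventually_elim (simp add: Q_def)
    ultimately show ?thesis
      using Lim_transform_eventually by fastforce
  qed
  obtain A B where "A > 0" "B > 0" and "\<forall>\<^sub>F m in sequentially.
      A * (exp (real m * log_rate (x m)) / (sqrt (lam m) * x m ^ 3)) \<le> D m (lam m) \<and>
      D m (lam m) \<le> B * (exp (real m * log_rate (x m)) / (sqrt (lam m) * x m))"
    using error_two_sided[OF D lam_ev, of 0] sub inv narrow unfolding x_def a_def by auto
  from log_error_limit(1)[OF this lam_ev xpos S main lnlam lnx] show ?thesis
    unfolding S_def .
qed

lemma fixed_parameter_asymptotics:
  assumes D: "D \<in> {best_error, sup_error, l2_error}" and l: "l > 0"
  shows "(\<lambda>m. ln (D m l)) \<sim>[sequentially] (\<lambda>m. - (3 / 2) * (l * (real m)\<^sup>2) powr (1 / 3))"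
proof -
  have "(\<lambda>m. ln (D m l) / real m powr ((2 + 0) / 3)) \<longlonglongrightarrow> - (3 / 2) * l powr (1 / 3)"
  proof (rule subcritical_growth_limit[OF _ D l])
    show "(\<lambda>_. l) \<sim>[sequentially] (\<lambda>m. l * real m powr 0)"
      by (rule asymp_equiv_refl_ev) (use eventually_gt_at_top[of 0] in \<open>auto elim: eventually_mono\<close>)
  qed (use l in auto)
  then have "(\<lambda>m. ln (D m l) / real m powr (2 / 3) / (- (3 / 2) * l powr (1 / 3))) \<longlonglongrightarrow>
      - (3 / 2) * l powr (1 / 3) / (- (3 / 2) * l powr (1 / 3))"
    using l by (intro tendsto_divide tendsto_const) auto
  then have "(\<lambda>m. ln (D m l) / real m powr (2 / 3) / (- (3 / 2) * l powr (1 / 3))) \<longlonglongrightarrow> 1"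
    using l by simp
  moreover have "\<forall>\<^sub>F m in sequentially. ln (D m l) / real m powr (2 / 3) / (- (3 / 2) * l powr (1 / 3)) =
      ln (D m l) / (- (3 / 2) * (l * (real m)\<^sup>2) powr (1 / 3))"
    using eventually_gt_at_top[of 0]
  proof eventually_elim
    case (elim m)
    have "((real m)\<^sup>2) powr (1 / 3) = real m powr (2 / 3)"
      using elim by (simp add: powr_powr flip: powr_numeral)
    then show ?case
      using l by (simp add: powr_mult mult_ac)
  qed
  ultimately have "(\<lambda>m. ln (D m l) / (- (3 / 2) * (l * (real m)\<^sup>2) powr (1 / 3))) \<longlonglongrightarrow> 1"
    by (rule Lim_transform_eventually)
  then show ?thesis
    by (rule asymp_equivI')
qed

text \<open>Here the saddle converges to the saddle of the limit ratio \<open>\<alpha>\<close>.\<close>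

lemma proportional_two_sided:
  fixes lam :: "nat \<Rightarrow> real"
  assumes D: "D \<in> {best_error, sup_error, l2_error}"
    and a: "0 < \<alpha>" "\<alpha> < alpha_c"
    and lim: "(\<lambda>m. lam m / real m) \<longlonglongrightarrow> \<alpha>"
    and x_def: "\<And>m. x m = xi (lam m / real m)"
  shows "x \<longlonglongrightarrow> xi \<alpha>" and "\<forall>\<^sub>F m in sequentially. lam m > 0"
    and "\<exists>A>0. \<exists>B>0. \<forall>\<^sub>F m in sequentially.
      A * (exp (real m * log_rate (x m)) / (sqrt (lam m) * x m ^ 3)) \<le> D m (lam m) \<and>
      D m (lam m) \<le> B * (exp (real m * log_rate (x m)) / (sqrt (lam m) * x m))"
proof -
  have pos: "\<forall>\<^sub>F m in sequentially. lam m / real m > 0"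
    using lim a(1) by (rule order_tendstoD)
  have sub: "\<forall>\<^sub>F m in sequentially. lam m / real m < alpha_c"
    using lim a(2) by (rule order_tendstoD)
  have xa: "is_xi \<alpha> (xi \<alpha>)"
    using a by (rule is_xi_xi)
  then have x0: "xi \<alpha> > 0" "3 * (xi \<alpha>)\<^sup>2 > 1"
    by (auto simp: is_xi_def)
  have "(\<lambda>m. x m - xi \<alpha>) \<longlonglongrightarrow> 0"
  proof (rule Lim_null_comparison)
    show "\<forall>\<^sub>F m in sequentially. norm (x m - xi \<alpha>) \<le> \<bar>1 / (lam m / real m) - 1 / \<alpha>\<bar> / 6"
      using pos sub
    proof eventually_elim
      case (elim m)
      then have "is_xi (lam m / real m) (x m)"
        unfolding x_def by (rule is_xi_xi)
      from abs_is_xi_diff_le[OF this xa] show ?case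
        by simp
    qed
    have "(\<lambda>m. \<bar>1 / (lam m / real m) - 1 / \<alpha>\<bar> / 6) \<longlonglongrightarrow> \<bar>1 / \<alpha> - 1 / \<alpha>\<bar> / 6"
      using a by (intro tendsto_intros lim) auto
    then show "(\<lambda>m. \<bar>1 / (lam m / real m) - 1 / \<alpha>\<bar> / 6) \<longlonglongrightarrow> 0"
      by simp
  qed
  then show x: "x \<longlonglongrightarrow> xi \<alpha>"
    by (rule LIM_zero_cancel)
  show lam_ev: "\<forall>\<^sub>F m in sequentially. lam m > 0"
    using pos by (rule eventually_mono) (auto simp: zero_less_divide_iff)
  have inv: "(\<lambda>m. 1 / x m) \<longlonglongrightarrow> 1 / xi \<alpha>"
    using x0 by (intro tendsto_intros x) auto
  have inv_less: "(1 / xi \<alpha>)\<^sup>2 < 3"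
    using x0 by (simp add: power_divide divide_less_eq)
  have "filterlim (\<lambda>m. (lam m / real m * (x m)\<^sup>2) * real m) at_top sequentially"
  proof (rule filterlim_tendsto_pos_mult_at_top[OF _ _ filterlim_real_sequentially])
    show "(\<lambda>m. lam m / real m * (x m)\<^sup>2) \<longlonglongrightarrow> \<alpha> * (xi \<alpha>)\<^sup>2"
      by (intro tendsto_intros lim x)
  qed (use a x0 in simp)
  moreover have "\<forall>\<^sub>F m in sequentially. (lam m / real m * (x m)\<^sup>2) * real m = lam m * (x m)\<^sup>2"
    using eventually_gt_at_top[of 0] by eventually_elim simp
  ultimately have narrow: "filterlim (\<lambda>m. lam m * (x m)\<^sup>2) at_top sequentially"
    by (rule filterlim_mono_eventually[OF _ order_refl order_refl])
  show "\<exists>A>0. \<exists>B>0. \<forall>\<^sub>F m in sequentially.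
      A * (exp (real m * log_rate (x m)) / (sqrt (lam m) * x m ^ 3)) \<le> D m (lam m) \<and>
      D m (lam m) \<le> B * (exp (real m * log_rate (x m)) / (sqrt (lam m) * x m))"
    using error_two_sided[OF D lam_ev sub _ inv_less] inv narrow unfolding x_def by auto
qed

lemma proportional_root_limit:
  fixes lam :: "nat \<Rightarrow> real"
  assumes D: "D \<in> {best_error, sup_error, l2_error}"
    and a: "0 < \<alpha>" "\<alpha> < alpha_c"
    and lim: "(\<lambda>m. lam m / real m) \<longlonglongrightarrow> \<alpha>"
  shows "(\<lambda>m. D m (lam m) powr (1 / real m)) \<longlonglongrightarrow> H_e \<alpha>"
proof -
  define x where "x = (\<lambda>m. xi (lam m / real m))"
  have "x m = xi (lam m / real m)" for m
    by (simp add: x_def)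
  note two = proportional_two_sided[OF D a lim this]
  have xa: "is_xi \<alpha> (xi \<alpha>)"
    using a by (rule is_xi_xi)
  then have x0: "xi \<alpha> > 0" "xi \<alpha> > 1 / 2"
    using xi_half by (auto simp: is_xi_def)
  have xpos: "\<forall>\<^sub>F m in sequentially. x m > 0"
    using two(1) x0(1) by (rule order_tendstoD)
  have inm: "(\<lambda>m. f m / real m) \<longlonglongrightarrow> 0" if "f \<longlonglongrightarrow> r" for f :: "nat \<Rightarrow> real" and r
    by (rule tendsto_divide_0[OF that filterlim_at_top_imp_at_infinity[OF filterlim_real_sequentially]])
  have lnx: "(\<lambda>m. ln (x m) / real m) \<longlonglongrightarrow> 0"
    using x0 by (intro inm[OF tendsto_ln[OF two(1)]]) auto
  have lnlam: "(\<lambda>m. ln (lam m) / real m) \<longlonglongrightarrow> 0"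
  proof -
    have "(\<lambda>m. ln (real m) / real m) \<longlonglongrightarrow> 0"
      by real_asymp
    then have "(\<lambda>m. ln (lam m / real m) / real m + ln (real m) / real m) \<longlonglongrightarrow> 0 + 0"
      using a by (intro tendsto_add inm[OF tendsto_ln[OF lim]]) auto
    moreover have "\<forall>\<^sub>F m in sequentially. ln (lam m / real m) / real m + ln (real m) / real m = ln (lam m) / real m"
      using two(2) eventually_gt_at_top[of 0]
      by eventually_elim (simp add: ln_div diff_divide_distrib)
    ultimately show ?thesis
      using Lim_transform_eventually by fastforce
  qed
  have "isCont log_rate (xi \<alpha>)"
  proof -
    have "8 * xi \<alpha> ^ 3 - 2 * xi \<alpha> \<noteq> 0"
      using is_xi_cubic[OF xa] a by simp
    then show ?thesis
      unfolding log_rate_def using x0 by (intro continuous_intros) auto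
  qed
  then have "(\<lambda>m. log_rate (x m)) \<longlonglongrightarrow> log_rate (xi \<alpha>)"
    using two(1) by (rule isCont_tendsto_compose)
  moreover have "\<forall>\<^sub>F m in sequentially. log_rate (x m) = real m * log_rate (x m) / real m"
    using eventually_gt_at_top[of 0] by eventually_elim simp
  ultimately have main: "(\<lambda>m. real m * log_rate (x m) / real m) \<longlonglongrightarrow> log_rate (xi \<alpha>)"
    by (rule Lim_transform_eventually)
  obtain A B where AB: "A > 0" "B > 0" "\<forall>\<^sub>F m in sequentially.
      A * (exp (real m * log_rate (x m)) / (sqrt (lam m) * x m ^ 3)) \<le> D m (lam m) \<and>
      D m (lam m) \<le> B * (exp (real m * log_rate (x m)) / (sqrt (lam m) * x m))"
    using two(3) by blast
  note log_limit = log_error_limit[OF AB two(2) xpos filterlim_real_sequentially main lnlam lnx]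
  have "(\<lambda>m. exp (ln (D m (lam m)) / real m)) \<longlonglongrightarrow> exp (log_rate (xi \<alpha>))"
    by (intro tendsto_exp log_limit(1))
  moreover have "\<forall>\<^sub>F m in sequentially. exp (ln (D m (lam m)) / real m) = D m (lam m) powr (1 / real m)"
    using log_limit(2) by eventually_elim (simp add: powr_def)
  ultimately show ?thesis
    unfolding H_e_eq[OF xa a(1)] by (rule Lim_transform_eventually)
qed

lemma proportional_sharp_bounds:
  assumes D: "D \<in> {best_error, sup_error, l2_error}"
    and a: "0 < \<alpha>" "\<alpha> < alpha_c"
  shows "\<exists>A>0. \<exists>B>0. \<forall>\<^sub>F m in sequentially.
    A * (real m powr (- 1 / 2) * H_e \<alpha> ^ m) \<le> D m (\<alpha> * real m) \<and>
    D m (\<alpha> * real m) \<le> B * (real m powr (- 1 / 2) * H_e \<alpha> ^ m)"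
proof -
  have ev: "\<forall>\<^sub>F m in sequentially. \<alpha> * real m / real m = \<alpha>"
    using eventually_gt_at_top[of 0] by eventually_elim simp
  then have "(\<lambda>m. \<alpha> * real m / real m) \<longlonglongrightarrow> \<alpha>"
    by (rule tendsto_eventually)
  from proportional_two_sided(3)[OF D a this refl] obtain A B where AB: "A > 0" "B > 0"
    and bounds: "\<forall>\<^sub>F m in sequentially.
      A * (exp (real m * log_rate (xi (\<alpha> * real m / real m))) / (sqrt (\<alpha> * real m) * xi (\<alpha> * real m / real m) ^ 3))
        \<le> D m (\<alpha> * real m) \<and>
      D m (\<alpha> * real m) \<le>
        B * (exp (real m * log_rate (xi (\<alpha> * real m / real m))) / (sqrt (\<alpha> * real m) * xi (\<alpha> * real m / real m)))"
    by blast
  have xa: "is_xi \<alpha> (xi \<alpha>)"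
    using a by (rule is_xi_xi)
  then have x0: "xi \<alpha> > 0"
    by (simp add: is_xi_def)
  define A' B' where "A' = A / (sqrt \<alpha> * xi \<alpha> ^ 3)" and "B' = B / (sqrt \<alpha> * xi \<alpha>)"
  have "A' > 0" "B' > 0"
    using AB a x0 by (simp_all add: A'_def B'_def)
  moreover have "\<forall>\<^sub>F m in sequentially.
    A' * (real m powr (- 1 / 2) * H_e \<alpha> ^ m) \<le> D m (\<alpha> * real m) \<and>
    D m (\<alpha> * real m) \<le> B' * (real m powr (- 1 / 2) * H_e \<alpha> ^ m)"
    using bounds ev eventually_gt_at_top[of 0]
  proof eventually_elim
    case (elim m)
    have H: "H_e \<alpha> ^ m = exp (real m * log_rate (xi \<alpha>))"
      by (simp only: H_e_eq[OF xa a(1)] exp_of_nat_mult)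
    have s: "real m powr (- 1 / 2) = 1 / sqrt (real m)"
      using elim(3) powr_minus[of "real m" "1 / 2"] by (simp add: powr_half_sqrt inverse_eq_divide)
    show ?case
      using elim(1) unfolding elim(2) H s A'_def B'_def by (simp add: real_sqrt_mult mult_ac)
  qed
  ultimately show ?thesis
    by blast
qed

theorem corollary5p7:
  fixes lam :: "nat \<Rightarrow> real" and D :: "nat \<Rightarrow> real \<Rightarrow> real"
  assumes lam_pos: "\<And>m. m \<ge> 1 \<Longrightarrow> lam m > 0"
    and D: "D \<in> {best_error, sup_error, l2_error}"
  shows
    "(\<forall>c \<gamma>. c > 0 \<longrightarrow> 0 \<le> \<gamma> \<longrightarrow> \<gamma> < 1 \<longrightarrow>
        lam \<sim>[sequentially] (\<lambda>m. c * real m powr \<gamma>) \<longrightarrow>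
        (\<lambda>m. ln (D m (lam m)) / real m powr ((2 + \<gamma>) / 3))
          \<longlonglongrightarrow> - (3 / 2) * c powr (1 / 3))
   \<and> (\<forall>l>0. (\<lambda>m. ln (D m l)) \<sim>[sequentially]
              (\<lambda>m. - (3 / 2) * (l * (real m)\<^sup>2) powr (1 / 3)))
   \<and> (\<forall>\<alpha>. 0 < \<alpha> \<longrightarrow> \<alpha> < alpha_c \<longrightarrow>
        (\<lambda>m. lam m / real m) \<longlonglongrightarrow> \<alpha> \<longrightarrow>
        (\<lambda>m. D m (lam m) powr (1 / real m)) \<longlonglongrightarrow> H_e \<alpha>)
   \<and> (\<forall>\<alpha>. 0 < \<alpha> \<longrightarrow> \<alpha> < alpha_c \<longrightarrow>
        (\<exists>A>0. \<exists>B>0. \<forall>\<^sub>F m in sequentially.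
           A * (real m powr (- 1 / 2) * H_e \<alpha> ^ m) \<le> D m (\<alpha> * real m) \<and>
           D m (\<alpha> * real m) \<le> B * (real m powr (- 1 / 2) * H_e \<alpha> ^ m)))"
  by (intro conjI allI impI subcritical_growth_limit[OF lam_pos D] fixed_parameter_asymptotics[OF D]
      proportional_root_limit[OF D] proportional_sharp_bounds[OF D])

end
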